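(* Let $\mathcal{C}\mathcal{M}on$ be the category of commutative topological monoids and continuous homomorphisms. The classifying space functor $B:\mathcal{C}\mathcal{M}on\to\mathcal{C}\mathcal{M}on$ and the loop space functor $\Omega:\mathcal{C}\mathcal{M}on\to\mathcal{C}\mathcal{M}on$ form an adjoint pair, with $B$ left adjoint to $\Omega$, enriched over the category $\mathcal{T}op^{*}$ of based $k$-spaces; that is, there are based homeomorphisms $\mathcal{C}\mathcal{M}on(BM,N)\cong\mathcal{C}\mathcal{M}on(M,\Omega N)$, natural in $M$ and $N$.
   Context: All spaces are $k$-spaces ($A\subset X$ is closed iff $p^{-1}(A)$ is closed in $C$ for each map $p:C\to X$ with $C$ compact Hausdorff); products and function spaces are formed in $k$-spaces. A topological monoid is a monoid in $k$-spaces, canonically based by its unit. $\mathcal{C}\mathcal{M}on(M,N)$ has the subspace topology of the based $k$-function space (compact-open topology turned into a $k$-space), with the constant homomorphism as base point. $BM$ is the topological realization of the simplicial space $[n]\mapsto M^n$ (the bar construction $B(\ast,M,\ast)$): the faces are $d^0(x_1,\dots,x_n)=(x_2,\dots,x_n)$, $d^i(x_1,\dots,x_n)=(x_1,\dots,x_ix_{i+1},\dots,x_n)$ for $0<i<n$, $d^n(x_1,\dots,x_n)=(x_1,\dots,x_{n-1})$, and degeneracies insert the unit. For commutative $M$, $BM$ is a commutative topological monoid with multiplication $BM\times BM\cong B(M\times M)\to BM$ induced by the multiplication homomorphism $M\times M\to M$. $\Omega M$ is the usual space of based maps $S^1\to M$ with point-wise multiplication in $M$. *)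

theory Defs
  imports "HOL-Analysis.Analysis" "HOL-Homology.Homology" "HOL-Algebra.Group"
begin

section \<open>k-spaces\<close>

text \<open>
  The notion of k-space used here tests with continuous maps out of compact Hausdorff spaces; it
  differs from the library's \<^const>\<open>k_space\<close>, which tests with arbitrary compact subspaces.

  HOL cannot quantify over compact Hausdorff spaces of all types inside a definition. The type
  \<open>('a + nat) set set\<close> is large enough: \<open>k_closedin_test_map\<close> below shows that the definition with
  test spaces in this type implies the condition for test spaces in every other type.
\<close>

type_synonym 'a test_point = "('a + nat) set set"

definition test_map :: "'c topology \<Rightarrow> 'a topology \<Rightarrow> ('c \<Rightarrow> 'a) \<Rightarrow> bool" where
  "test_map C X p \<longleftrightarrow> compact_space C \<and> Hausdorff_space C \<and> continuous_map C X p"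

definition k_closedin :: "'a topology \<Rightarrow> 'a set \<Rightarrow> bool" where
  "k_closedin X A \<longleftrightarrow> A \<subseteq> topspace X \<and>
    (\<forall>(C :: 'a test_point topology) p.
       test_map C X p \<longrightarrow> closedin C {c \<in> topspace C. p c \<in> A})"

definition test_k_space :: "'a topology \<Rightarrow> bool" where
  "test_k_space X \<longleftrightarrow> (\<forall>A. closedin X A \<longleftrightarrow> k_closedin X A)"

definition kify :: "'a topology \<Rightarrow> 'a topology" where
  "kify X = topology (\<lambda>U. U \<subseteq> topspace X \<and> k_closedin X (topspace X - U))"


subsection \<open>Adequacy of the bounded type of test spaces\<close>

text \<open>
  Test maps on arbitrary types give nothing new. Suppose the preimage of \<open>A\<close> under \<open>p\<close> is not closed.
  A point in its closure, and one point for each member of a family of subsets of the preimage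
  that is
  indexed by formal terms over the sets of points of \<open>X\<close> and closed under the operations the
  argument needs, determine a compact subspace of a product of two-point spaces and a test map
  on it for which the preimage of \<open>A\<close> is not closed either.
\<close>

lemma k_closedin_test_map_small:
  fixes X :: "'a topology" and C :: "'c topology" and j :: "'c \<Rightarrow> 'a test_point"
  assumes "k_closedin X A" "inj j" "test_map C X p"
  shows "closedin C {c \<in> topspace C. p c \<in> A}"
proof -
  let ?C = "pullback_topology (range j) (inv_into UNIV j) C"
  have h1: "continuous_map ?C C (inv_into UNIV j)"
    using continuous_map_pullback[of C C id "range j" "inv_into UNIV j"] by simp
  have ts: "topspace ?C = j ` topspace C"
    using assms(2) by (auto simp: topspace_pullback_topology image_iff)
  have h2: "continuous_map C ?C j"
    by (rule continuous_map_pullback') (use assms(2) in \<open>auto simp: o_def inj_def\<close>)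
  have hm: "homeomorphic_maps C ?C j (inv_into UNIV j)"
    unfolding homeomorphic_maps_def using h1 h2 assms(2) by (simp add: ts)
  then have hs: "C homeomorphic_space ?C" unfolding homeomorphic_space_def by (intro exI)
  have "compact_space ?C" "Hausdorff_space ?C"
    using assms(3) homeomorphic_compact_space[OF hs] homeomorphic_Hausdorff_space[OF hs]
    by (auto simp: test_map_def)
  moreover have "continuous_map ?C X (p \<circ> inv_into UNIV j)"
    using continuous_map_compose[OF h1] assms(3) by (auto simp: test_map_def)
  ultimately have "test_map ?C X (p \<circ> inv_into UNIV j)"
    by (simp add: test_map_def)
  then have "closedin ?C {c \<in> topspace ?C. (p \<circ> inv_into UNIV j) c \<in> A}"
    using assms(1) by (simp only: k_closedin_def)
  then have "closedin C {c \<in> topspace C. j c \<in> {c \<in> topspace ?C. (p \<circ> inv_into UNIV j) c \<in> A}}"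
    by (rule closedin_continuous_map_preimage[OF h2])
  moreover have "{c \<in> topspace C. j c \<in> {c \<in> topspace ?C. (p \<circ> inv_into UNIV j) c \<in> A}} = {c \<in> topspace C. p c \<in> A}"
    using assms(2) unfolding ts by (simp cong: conj_cong)
  ultimately show ?thesis by (simp only:)
qed

lemma ex_inj_nat_pairing: "\<exists>g :: nat \<times> ('a + nat) \<Rightarrow> 'a + nat. inj g"
proof -
  have inf: "infinite (UNIV :: ('a + nat) set)"
    by (metis finite_Plus_UNIV_iff infinite_UNIV_nat)
  have "BNF_Wellorder_Constructions.ordIso2 (BNF_Cardinal_Order_Relation.card_of (UNIV \<times> UNIV :: (('a+nat) \<times> ('a + nat)) set)) (BNF_Cardinal_Order_Relation.card_of (UNIV :: ('a+nat) set))"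
    using inf by (rule card_of_Times_same_infinite)
  then have "\<exists>h. bij_betw h (UNIV \<times> UNIV :: (('a+nat) \<times> ('a + nat)) set) (UNIV :: ('a+nat) set)"
    by (rule card_of_ordIso[THEN iffD2])
  then obtain h :: "('a+nat) \<times> ('a + nat) \<Rightarrow> 'a + nat"
    where "bij_betw h (UNIV \<times> UNIV) UNIV" by (rule exE)
  then have h: "inj h" by (simp add: bij_betw_def)
  have "inj (\<lambda>z :: nat \<times> ('a + nat). h (Inr (fst z), snd z))"
  proof (rule injI)
    fix x y :: "nat \<times> ('a + nat)"
    assume "h (Inr (fst x), snd x) = h (Inr (fst y), snd y)"
    with h have "(Inr (fst x) :: 'a + nat, snd x) = (Inr (fst y), snd y)" by (rule injD)
    then show "x = y" by (simp add: prod_eq_iff)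
  qed
  then show ?thesis by (rule exI[where P = inj])
qed

datatype 'o test_term = T_all | T_int "'o test_term" "'o test_term" | T_diff "'o test_term" "'o test_term" | T_split "'o test_term" 'o 'o
  | T_pt "'o test_term" | T_nbhd 'o

primrec test_term_code :: "(nat \<times> ('a + nat) \<Rightarrow> 'a + nat) \<Rightarrow> 'a set test_term \<Rightarrow> (nat \<times> ('a + nat)) set" where
  "test_term_code g T_all = {(0, Inr 0)}"
| "test_term_code g (T_int a b) = {(1, Inr 0)} \<union> {10} \<times> g ` test_term_code g a \<union> {11} \<times> g ` test_term_code g b"
| "test_term_code g (T_diff a b) = {(2, Inr 0)} \<union> {10} \<times> g ` test_term_code g a \<union> {11} \<times> g ` test_term_code g b"
| "test_term_code g (T_split a U V) = {(3, Inr 0)} \<union> {10} \<times> g ` test_term_code g a \<union> {11} \<times> Inl ` U \<union> {12} \<times> Inl ` V"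
| "test_term_code g (T_pt a) = {(4, Inr 0)} \<union> {10} \<times> g ` test_term_code g a"
| "test_term_code g (T_nbhd U) = {(5, Inr 0)} \<union> {10} \<times> Inl ` U"

lemma inj_test_term_code:
  assumes g: "inj g" shows "inj (test_term_code g)"
proof -
  have gi: "g ` S = g ` T \<longleftrightarrow> S = T" for S T using g by (simp add: inj_image_eq_iff)
  have ii: "Inl ` U = (Inl ` V :: ('a + nat) set) \<longleftrightarrow> U = V" for U V by (simp add: inj_image_eq_iff)
  have vi: "Pair k -` insert x S = (if fst x = k then insert (snd x) (Pair k -` S) else Pair k -` S)"
    for k :: nat and x :: "nat \<times> ('a + nat)" and S by (cases x) auto
  have vt: "Pair k -` ({m} \<times> S) = (if k = m then S else {})"
    for k m :: nat and S :: "('a + nat) set" by auto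
  have sl: "test_term_code g a = test_term_code g b \<Longrightarrow> Pair k -` test_term_code g a = Pair k -` test_term_code g b" for a b k by simp
  have tg: "test_term_code g a = test_term_code g b \<Longrightarrow> k < 10 \<Longrightarrow> (k, Inr 0) \<in> test_term_code g a \<longleftrightarrow> (k, Inr 0) \<in> test_term_code g b" for a b k by simp
  have "test_term_code g a = test_term_code g b \<Longrightarrow> a = b" for a b
  proof (induction a arbitrary: b)
    case T_all
    from tg[OF this, of 0] show ?case by (cases b) auto
  next
    case (T_int a1 a2)
    from tg[OF T_int.prems, of 1] obtain b1 b2 where b: "b = T_int b1 b2" by (cases b) auto
    show ?case using sl[OF T_int.prems, of 10] sl[OF T_int.prems, of 11] T_int.IH
      by (auto simp: b gi vi vt vimage_Un)
  next
    case (T_diff a1 a2)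
    from tg[OF T_diff.prems, of 2] obtain b1 b2 where b: "b = T_diff b1 b2" by (cases b) auto
    show ?case using sl[OF T_diff.prems, of 10] sl[OF T_diff.prems, of 11] T_diff.IH
      by (auto simp: b gi vi vt vimage_Un)
  next
    case (T_split a U V)
    from tg[OF T_split.prems, of 3] obtain b1 U' V' where b: "b = T_split b1 U' V'" by (cases b) auto
    show ?case
      using sl[OF T_split.prems, of 10] sl[OF T_split.prems, of 11] sl[OF T_split.prems, of 12] T_split.IH
      by (auto simp: b gi ii vi vt vimage_Un)
  next
    case (T_pt a)
    from tg[OF T_pt.prems, of 4] obtain b1 where b: "b = T_pt b1" by (cases b) auto
    show ?case using sl[OF T_pt.prems, of 10] T_pt.IH by (auto simp: b gi vi vt vimage_Un)
  next
    case (T_nbhd U)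
    from tg[OF T_nbhd.prems, of 5] obtain U' where b: "b = T_nbhd U'" by (cases b) auto
    show ?case using sl[OF T_nbhd.prems, of 10] by (auto simp: b ii vi vt vimage_Un)
  qed
  then show ?thesis by (auto intro: injI)
qed


primrec test_sem ::
    "'c set \<Rightarrow> ('c set \<Rightarrow> 'o \<Rightarrow> 'o \<Rightarrow> 'c set) \<Rightarrow> ('c set \<Rightarrow> 'c) \<Rightarrow> ('o \<Rightarrow> 'c set) \<Rightarrow> 'o test_term \<Rightarrow> 'c set" where
  "test_sem D lo pt nb T_all = D"
| "test_sem D lo pt nb (T_int a b) = test_sem D lo pt nb a \<inter> test_sem D lo pt nb b"
| "test_sem D lo pt nb (T_diff a b) = test_sem D lo pt nb a - test_sem D lo pt nb b"
| "test_sem D lo pt nb (T_split a U V) = test_sem D lo pt nb a \<inter> lo (test_sem D lo pt nb a) U V"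
| "test_sem D lo pt nb (T_pt a) = {pt (test_sem D lo pt nb a)} \<inter> D"
| "test_sem D lo pt nb (T_nbhd U) = D \<inter> nb U"

lemma test_sem_subset: "test_sem D lo pt nb a \<subseteq> D"
  by (induction a) auto

lemma small_test_map:
  fixes X :: "'a topology" and C :: "'c topology"
  assumes p: "test_map C X p" and AX: "A \<subseteq> topspace X"
    and nc: "\<not> closedin C {d \<in> topspace C. p d \<in> A}"
  shows "\<exists>(C' :: ('a set test_term \<Rightarrow> bool) topology) p'. test_map C' X p' \<and> \<not> closedin C' {d \<in> topspace C'. p' d \<in> A}"
proof -
  define D where "D = {d \<in> topspace C. p d \<in> A}"
  define P where "P U = {d \<in> topspace C. p d \<in> U}" for U
  have comp: "compact_space C" and haus: "Hausdorff_space C" and pc: "continuous_map C X p"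
    using p by (auto simp: test_map_def)
  have reg: "regular_space C" using comp haus compact_Hausdorff_imp_regular_space by blast
  have norm: "normal_space C"
    using comp haus compact_Hausdorff_or_regular_imp_normal_space by blast
  have Popen: "openin C (P U)" if "openin X U" for U
    unfolding P_def using pc that openin_continuous_map_preimage by blast
  have DC: "D \<subseteq> topspace C" by (auto simp: D_def)
  define cl where cl_def: "cl = (\<lambda>B. Abstract_Topology.closure_of C B)"
  have cl_mono: "A \<subseteq> B \<Longrightarrow> cl A \<subseteq> cl B" for A B unfolding cl_def by (rule closure_of_mono)
  have cl_sub: "A \<subseteq> topspace C \<Longrightarrow> A \<subseteq> cl A" for A unfolding cl_def by (rule closure_of_subset)
  have cl_closed: "closedin C (cl A)" for A unfolding cl_def by (rule closedin_closure_of)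
  have cl_min: "A \<subseteq> B \<Longrightarrow> closedin C B \<Longrightarrow> cl A \<subseteq> B" for A B unfolding cl_def by (rule closure_of_minimal)
  have in_cl: "x \<in> cl A \<longleftrightarrow> x \<in> topspace C \<and> (\<forall>B. x \<in> B \<and> openin C B \<longrightarrow> (\<exists>y. y \<in> A \<and> y \<in> B))" for x A
    unfolding cl_def by (rule in_closure_of)
  obtain c where cD: "c \<in> cl D" and cn: "c \<notin> D"
    using nc DC unfolding D_def[symmetric]
    unfolding cl_def by (meson closure_of_subset_eq subsetI)
  have cC: "c \<in> topspace C" using cD in_cl by blast
  have pcA: "p c \<notin> A" using cn cC by (auto simp: D_def)
  \<comment> \<open>shrinking\<close>
  define R where "R b U V L \<longleftrightarrow> (openin X U \<and> openin X V \<and> b \<subseteq> D \<and> cl b \<subseteq> P U \<union> P V \<longrightarrow>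
          cl (b \<inter> L) \<subseteq> P U \<and> cl (b - L) \<subseteq> P V)" for b U V L
  have R: "\<exists>L. R b U V L" for b U V
  proof (cases "openin X U \<and> openin X V \<and> b \<subseteq> D \<and> cl b \<subseteq> P U \<union> P V")
    case True
    have "closedin C (cl b - P V)"
      using True Popen by (simp add: closedin_diff cl_closed)
    moreover have "cl b - P V \<subseteq> P U" using True by auto
    ultimately obtain G where G: "openin C G" "cl b - P V \<subseteq> G" "cl G \<subseteq> P U"
      using norm True Popen unfolding normal_space_alt cl_def by meson
    have "cl (b \<inter> G) \<subseteq> P U"
      using G(3) cl_mono[of "b \<inter> G" G] by auto
    moreover have "cl (b - G) \<subseteq> cl b \<inter> (topspace C - G)"
    proof (rule cl_min)
      show "b - G \<subseteq> cl b \<inter> (topspace C - G)"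
        using True DC cl_sub[of b] by auto
      show "closedin C (cl b \<inter> (topspace C - G))"
        using G(1) by (simp add: closedin_Int closedin_diff cl_closed)
    qed
    then have "cl (b - G) \<subseteq> P V" using G(2) by auto
    ultimately have "R b U V G" by (simp add: R_def)
    then show ?thesis by (rule exI)
  next
    case False
    then have "R b U V undefined" by (auto simp: R_def)
    then show ?thesis by (rule exI)
  qed
  define lo where "lo b U V = (SOME L. R b U V L)" for b U V
  have "R b U V (lo b U V)" for b U V
    unfolding lo_def by (rule someI_ex[OF R])
  then have lo: "cl (b \<inter> lo b U V) \<subseteq> P U \<and> cl (b - lo b U V) \<subseteq> P V" if "openin X U" "openin X V" "b \<subseteq> D" "cl b \<subseteq> P U \<union> P V" for b U V
    using that unfolding R_def by blast
  define R' where "R' U G \<longleftrightarrow> (openin X U \<and> p c \<in> U \<longrightarrow>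
      openin C G \<and> c \<in> G \<and> cl G \<subseteq> P U)" for U G
  have R': "\<exists>G. R' U G" for U
  proof (cases "openin X U \<and> p c \<in> U")
    case True
    then have "openin C (P U)" "c \<in> P U" using Popen cC by (auto simp: P_def)
    then have "closedin C (topspace C - P U)" "c \<in> topspace C - (topspace C - P U)"
      using cC by auto
    then obtain G where "openin C G" "c \<in> G" "disjnt (topspace C - P U) (cl G)"
      using reg[unfolded regular_space, folded cl_def, rule_format, OF conjI] by blast
    moreover have "cl G \<subseteq> topspace C" using in_cl by blast
    ultimately have "openin C G \<and> c \<in> G \<and> cl G \<subseteq> P U" by (auto simp: disjnt_iff)
    then have "R' U G" by (simp add: R'_def)
    then show ?thesis by (rule exI)
  next
    case False
    then have "R' U undefined" by (auto simp: R'_def)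
    then show ?thesis by (rule exI)
  qed
  define nb where "nb U = (SOME G. R' U G)" for U
  have "R' U (nb U)" for U
    unfolding nb_def by (rule someI_ex[OF R'])
  then have nb: "openin C (nb U) \<and> c \<in> nb U \<and> cl (nb U) \<subseteq> P U"
    if "openin X U" "p c \<in> U" for U
    using that unfolding R'_def by blast
  define dn where "dn = test_sem D lo (\<lambda>b. SOME d. d \<in> b) nb"
  have dnD: "dn t \<subseteq> D" for t unfolding dn_def by (rule test_sem_subset)
  have dnC: "dn t \<subseteq> topspace C" for t using dnD DC by blast
  have dn_simps: "dn T_all = D" "dn (T_int a b) = dn a \<inter> dn b" "dn (T_diff a b) = dn a - dn b"
     "dn (T_split a U V) = dn a \<inter> lo (dn a) U V" "dn (T_nbhd U) = D \<inter> nb U" for a b U V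
    by (simp_all add: dn_def)
  have dn_Pt: "\<exists>d \<in> dn a. dn (T_pt a) = {d}" if "dn a \<noteq> {}" for a
  proof -
    have "(SOME d. d \<in> dn a) \<in> dn a" using that by (simp add: some_in_eq)
    moreover have "dn (T_pt a) = {SOME d. d \<in> dn a} \<inter> D" by (simp add: dn_def)
    ultimately show ?thesis using dnD by blast
  qed
  \<comment> \<open>the product of two-point spaces\<close>
  define T :: "('a set test_term \<Rightarrow> bool) topology" where
    "T = product_topology (\<lambda>_. discrete_topology UNIV) UNIV"
  have topT: "topspace T = UNIV" by (simp add: T_def topspace_product_topology)
  have compT: "compact_space T"
    unfolding T_def by (simp add: compact_space_product_topology compact_space_discrete_topology)
  have hausT: "Hausdorff_space T"
    unfolding T_def by (simp add: Hausdorff_space_product_topology)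
  have cyl: "openin T {w. \<forall>t \<in> F. w t = v t}" if "finite F" for F v
  proof -
    have "{w. \<forall>t \<in> F. w t = v t} = Pi\<^sub>E UNIV (\<lambda>t. if t \<in> F then {v t} else UNIV)"
      by (auto simp: PiE_iff split: if_splits)
    moreover have "finite {t. (if t \<in> F then {v t} else UNIV) \<noteq> (UNIV :: bool set)}"
      by (rule finite_subset[OF _ that]) auto
    ultimately show ?thesis
      unfolding T_def by (simp add: openin_PiE_gen)
  qed
  define Z where "Z E F = {v. \<exists>d \<in> E. \<forall>t \<in> F. v t = (d \<in> dn t)}" for E and F :: "'a set test_term set"
  have Zclosed: "closedin T (Z E F)" if "finite F" for E F
  proof -
    have "openin T (- Z E F)"
    proof (subst openin_subopen, intro ballI)
      fix v assume v: "v \<in> - Z E F"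
      then have "{w. \<forall>t \<in> F. w t = v t} \<subseteq> - Z E F" by (auto simp: Z_def)
      then show "\<exists>S. openin T S \<and> v \<in> S \<and> S \<subseteq> - Z E F" using cyl[OF that] by blast
    qed
    then show ?thesis by (simp add: closedin_def topT Compl_eq_Diff_UNIV)
  qed
  define S where "S = (\<Inter>F \<in> {F. finite F}. Z D F)"
  have S: "\<exists>d \<in> D. \<forall>t \<in> F. v t = (d \<in> dn t)" if "v \<in> S" "finite F" for v F
    using that by (auto simp: S_def Z_def)
  have chiS: "(\<lambda>t. d \<in> dn t) \<in> S" if "d \<in> D" for d
    using that by (auto simp: S_def Z_def)
  have Sclosed: "closedin T S"
    unfolding S_def by (rule closedin_Inter) (auto simp: Zclosed)
  define C' where "C' = subtopology T S"
  have topC': "topspace C' = S" by (simp add: C'_def topT)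
  have compC': "compact_space C'"
    unfolding C'_def using Sclosed compT by (simp add: closedin_compact_space compact_space_subtopology)
  have hausC': "Hausdorff_space C'"
    unfolding C'_def using hausT by (simp add: Hausdorff_space_subtopology)
  \<comment> \<open>the points of C compatible with a point of C'\<close>
  define K where "K v = {u \<in> topspace C. \<forall>t. v t \<longrightarrow> u \<in> cl (dn t)}" for v
  define Good where "Good v u \<longleftrightarrow> u \<in> K v \<and>
     (\<forall>U. openin X U \<and> p u \<in> U \<longrightarrow> (\<exists>t. v t \<and> cl (dn t) \<subseteq> P U))" for v u
  have ex_good: "\<exists>u. Good v u" if v: "v \<in> S" for v
  proof (rule ccontr)
    assume "\<not> ?thesis"
    then have nG: "\<not> Good v u" for u by simp
    define W where "W u = (SOME U. openin X U \<and> p u \<in> U \<and> (\<forall>t. v t \<longrightarrow> \<not> cl (dn t) \<subseteq> P U))" for u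
    have WW: "openin X (W u) \<and> p u \<in> W u \<and> (\<forall>t. v t \<longrightarrow> \<not> cl (dn t) \<subseteq> P (W u))" if "u \<in> K v" for u
    proof -
      have "\<exists>U. openin X U \<and> p u \<in> U \<and> (\<forall>t. v t \<longrightarrow> \<not> cl (dn t) \<subseteq> P U)"
        using nG[of u] that unfolding Good_def by blast
      then show ?thesis unfolding W_def by (rule someI_ex)
    qed
    then have W: "openin X (W u) \<and> p u \<in> W u" if "u \<in> K v" for u using that by simp
    have Wn: "\<not> cl (dn t) \<subseteq> P (W u)" if "u \<in> K v" "v t" for u t using WW that by simp
    let ?\<U> = "(\<lambda>u. P (W u)) ` K v \<union> (\<lambda>t. topspace C - cl (dn t)) ` {t. v t}"
    have "\<forall>U \<in> ?\<U>. openin C U"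
      using W Popen cl_closed by (auto intro: openin_diff)
    moreover have "topspace C \<subseteq> \<Union>?\<U>"
    proof
      fix x assume "x \<in> topspace C"
      then show "x \<in> \<Union>?\<U>"
        using W by (cases "x \<in> K v") (auto simp: K_def P_def)
    qed
    ultimately obtain \<F> where \<F>: "finite \<F>" "\<F> \<subseteq> ?\<U>" "topspace C \<subseteq> \<Union>\<F>"
      using comp unfolding compact_space_alt by meson
    define Q0 where "Q0 = {U \<in> \<F>. U \<in> (\<lambda>u. P (W u)) ` K v}"
    define F0 where "F0 = {U \<in> \<F>. U \<in> (\<lambda>t. topspace C - cl (dn t)) ` {t. v t}}"
    have "finite Q0" "Q0 \<subseteq> (\<lambda>u. P (W u)) ` K v" using \<F>(1) by (auto simp: Q0_def)
    then obtain Q where Q: "Q \<subseteq> K v" "finite Q" "Q0 = (\<lambda>u. P (W u)) ` Q"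
      using finite_subset_image by meson
    have "finite F0" "F0 \<subseteq> (\<lambda>t. topspace C - cl (dn t)) ` {t. v t}" using \<F>(1) by (auto simp: F0_def)
    then obtain F where F: "F \<subseteq> {t. v t}" "finite F" "F0 = (\<lambda>t. topspace C - cl (dn t)) ` F"
      using finite_subset_image by meson
    have "\<F> = Q0 \<union> F0" using \<F>(2) by (auto simp: Q0_def F0_def)
    then have \<F>eq: "\<F> = (\<lambda>u. P (W u)) ` Q \<union> (\<lambda>t. topspace C - cl (dn t)) ` F"
      using Q(3) F(3) by simp
    note QF = Q(1,2) F(1,2)
    have vTot: "v T_all" using S[OF v, of "{T_all}"] by (auto simp: dn_simps)
    have "\<exists>s. v s \<and> (\<forall>t \<in> F. dn s \<subseteq> dn t)"
      using QF(4,3)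
    proof (induction F)
      case empty
      show ?case using vTot by auto
    next
      case (insert a F)
      then obtain s where s: "v s" "\<forall>t \<in> F. dn s \<subseteq> dn t" by auto
      have "v (T_int a s)" using S[OF v, of "{a, s, T_int a s}"] s(1) insert.prems by (auto simp: dn_simps)
      moreover have "\<forall>t \<in> insert a F. dn (T_int a s) \<subseteq> dn t" using s(2) by (auto simp: dn_simps)
      ultimately show ?case by blast
    qed
    then obtain s where s: "v s" "\<forall>t \<in> F. dn s \<subseteq> dn t" by auto
    have "cl (dn s) \<subseteq> P (\<Union>(W ` Q))"
    proof
      fix x assume x: "x \<in> cl (dn s)"
      then have "x \<in> topspace C" using in_cl by blast
      moreover have "x \<in> cl (dn t)" if "t \<in> F" for t
        using cl_mono[of "dn s" "dn t"] s(2) that x by auto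
      ultimately have "x \<in> \<Union>((\<lambda>u. P (W u)) ` Q)" using \<F>(3) unfolding \<F>eq by blast
      then show "x \<in> P (\<Union>(W ` Q))" by (auto simp: P_def)
    qed
    with QF(2,1) s(1) show False
    proof (induction Q arbitrary: s)
      case empty
      then have "dn s = {}" using cl_sub[OF dnC[of s]] by (auto simp: P_def)
      then show ?case using S[OF v, of "{s}"] empty by auto
    next
      case (insert u Q)
      let ?V = "\<Union>(W ` Q)"
      have o: "openin X (W u)" "openin X ?V" using W insert.prems by auto
      have "cl (dn s) \<subseteq> P (W u) \<union> P ?V" using insert.prems(3) by (auto simp: P_def)
      note L = lo[OF o dnD this]
      let ?l = "T_split s (W u) ?V"
      have "v ?l \<or> v (T_diff s ?l)"
        using S[OF v, of "{s, ?l, T_diff s ?l}"] insert.prems(2) by (auto simp: dn_simps)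
      then show ?case
      proof
        assume "v ?l"
        moreover have "cl (dn ?l) \<subseteq> P (W u)" using L by (simp add: dn_simps)
        ultimately show False using Wn insert.prems(1) by auto
      next
        assume m: "v (T_diff s ?l)"
        have "dn (T_diff s ?l) = dn s - lo (dn s) (W u) ?V" by (auto simp: dn_simps)
        then have "cl (dn (T_diff s ?l)) \<subseteq> P ?V" using L by simp
        then show False using insert.IH[OF _ m] insert.prems(1) by blast
      qed
    qed
  qed
  \<comment> \<open>the limit point\<close>
  let ?I = "{(G, F). openin C G \<and> c \<in> G \<and> finite F}"
  have "\<Inter>((\<lambda>(G, F). Z (G \<inter> D) F) ` ?I) \<noteq> {}"
  proof (rule compT[unfolded compact_space_fip, rule_format], intro conjI ballI allI impI)
    fix Y assume "Y \<in> (\<lambda>(G, F). Z (G \<inter> D) F) ` ?I"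
    then obtain G F where "Y = Z (G \<inter> D) F" "finite F" by auto
    then show "closedin T Y" using Zclosed by simp
  next
    fix \<F> assume \<F>: "finite \<F> \<and> \<F> \<subseteq> (\<lambda>(G, F). Z (G \<inter> D) F) ` ?I"
    obtain J where J: "J \<subseteq> ?I" "finite J" "\<F> = (\<lambda>(G, F). Z (G \<inter> D) F) ` J"
      using finite_subset_image[OF conjunct1[OF \<F>] conjunct2[OF \<F>]] by auto
    let ?G = "topspace C \<inter> \<Inter>(fst ` J)"
    have "openin C ?G"
      using J(1,2) by (cases "J = {}") (auto intro!: openin_Int openin_Inter)
    moreover have "c \<in> ?G" using cC J(1) by auto
    ultimately obtain d where d: "d \<in> D" "d \<in> ?G" using cD[unfolded in_cl, THEN conjunct2, rule_format, OF conjI] by blast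
    have "(\<lambda>t. d \<in> dn t) \<in> Y" if Y: "Y \<in> \<F>" for Y
    proof -
      obtain G F where "(G, F) \<in> J" "Y = Z (G \<inter> D) F" using Y J(3) by auto
      moreover then have "d \<in> G" using d(2) by force
      ultimately show ?thesis using d(1) by (auto simp: Z_def)
    qed
    then show "\<Inter>\<F> \<noteq> {}" by blast
  qed
  then obtain vc where vc0: "vc \<in> \<Inter>((\<lambda>(G, F). Z (G \<inter> D) F) ` ?I)" by blast
  have vc: "\<exists>d \<in> G \<inter> D. \<forall>t \<in> F. vc t = (d \<in> dn t)" if "openin C G" "c \<in> G" "finite F" for G F
  proof -
    have "(G, F) \<in> ?I" using that by simp
    then have "vc \<in> Z (G \<inter> D) F" using vc0 by blast
    then show ?thesis by (simp add: Z_def)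
  qed
  have vcS: "vc \<in> S"
    unfolding S_def Z_def using vc[OF openin_topspace cC] by blast
  have goodc: "Good vc c"
    unfolding Good_def
  proof (intro conjI allI impI)
    show "c \<in> K vc"
      unfolding K_def
    proof (clarsimp simp: cC)
      fix t assume t: "vc t"
      show "c \<in> cl (dn t)"
        unfolding in_cl using vc[of _ "{t}"] t cC by blast
    qed
  next
    fix U assume U: "openin X U \<and> p c \<in> U"
    then have n: "openin C (nb U)" "c \<in> nb U" "cl (nb U) \<subseteq> P U" using nb by auto
    have "vc (T_nbhd U)" using vc[OF n(1,2), of "{T_nbhd U}"] by (auto simp: dn_simps)
    moreover have "cl (dn (T_nbhd U)) \<subseteq> P U"
      using n(3) cl_mono[of "dn (T_nbhd U)" "nb U"] by (auto simp: dn_simps)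
    ultimately show "\<exists>t. vc t \<and> cl (dn t) \<subseteq> P U" by blast
  qed
  define q where "q v = (if v = vc then c else SOME u. Good v u)" for v
  have q: "Good v (q v)" if "v \<in> S" for v
    using goodc someI_ex[OF ex_good[OF that]] by (auto simp: q_def)
  have qK: "q v \<in> K v" if "v \<in> S" for v using q[OF that] by (simp add: Good_def)
  have cont: "continuous_map C' X (p \<circ> q)"
    unfolding continuous_map_def topC'
  proof (intro conjI allI impI)
    show "p \<circ> q \<in> S \<rightarrow> topspace X"
      using qK pc by (auto simp: K_def continuous_map_def Pi_iff)
  next
    fix U assume U: "openin X U"
    show "openin C' {v \<in> S. (p \<circ> q) v \<in> U}"
    proof (subst openin_subopen, intro ballI)
      fix v assume "v \<in> {v \<in> S. (p \<circ> q) v \<in> U}"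
      then have v: "v \<in> S" "p (q v) \<in> U" by auto
      then obtain t where t: "v t" "cl (dn t) \<subseteq> P U"
        using q U unfolding Good_def by blast
      let ?B = "S \<inter> {w. \<forall>s \<in> {t}. w s = v s}"
      have "openin C' ?B" unfolding C'_def using cyl[of "{t}" v] by (simp add: openin_subtopology_Int2)
      moreover have "v \<in> ?B" using v by simp
      moreover have "?B \<subseteq> {v \<in> S. (p \<circ> q) v \<in> U}"
        using qK t by (auto simp: K_def P_def)
      ultimately show "\<exists>B. openin C' B \<and> v \<in> B \<and> B \<subseteq> {v \<in> S. (p \<circ> q) v \<in> U}" by blast
    qed
  qed
  have "\<not> closedin C' {v \<in> topspace C'. (p \<circ> q) v \<in> A}"
  proof
    let ?E = "{v \<in> topspace C'. (p \<circ> q) v \<in> A}"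
    assume "closedin C' ?E"
    then have "openin C' (S - ?E)" by (auto simp: closedin_def topC')
    then obtain O' where O': "openin T O'" "S - ?E = O' \<inter> S"
      unfolding C'_def openin_subtopology by blast
    have "(p \<circ> q) vc \<notin> A" using pcA by (simp add: q_def)
    then have "vc \<in> S - ?E" using vcS by simp
    then have "vc \<in> O'" using O'(2) by blast
    then have "\<exists>B. finite {i \<in> UNIV. B i \<noteq> topspace (discrete_topology (UNIV :: bool set))} \<and>
        (\<forall>i \<in> UNIV. openin (discrete_topology UNIV) (B i)) \<and> vc \<in> Pi\<^sub>E UNIV B \<and> Pi\<^sub>E UNIV B \<subseteq> O'"
      using O'(1)[unfolded T_def openin_product_topology_alt] by (rule bspec[rotated])
    then obtain B where B: "finite {t. B t \<noteq> UNIV}" "vc \<in> Pi\<^sub>E UNIV B" "Pi\<^sub>E UNIV B \<subseteq> O'"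
      by (elim exE conjE) (simp only: topspace_discrete_topology UNIV_I simp_thms)
    let ?F = "{t. B t \<noteq> UNIV}"
    obtain d where d: "d \<in> D" "\<forall>t \<in> ?F. vc t = (d \<in> dn t)" using S[OF vcS B(1)] by blast
    have "\<exists>s. d \<in> dn s \<and> (\<forall>e \<in> dn s. \<forall>t \<in> F. (e \<in> dn t) = (d \<in> dn t))" if "finite F" for F
      using that
    proof (induction F)
      case empty
      have "d \<in> dn T_all" using d(1) by (simp add: dn_simps)
      then show ?case by (intro exI[of _ T_all]) simp
    next
      case (insert a F)
      from insert.IH obtain s where s: "d \<in> dn s" "\<forall>e \<in> dn s. \<forall>t \<in> F. (e \<in> dn t) = (d \<in> dn t)"
        by (elim exE conjE)
      let ?s = "if d \<in> dn a then T_int s a else T_diff s a"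
      have "d \<in> dn ?s" using s(1) by (simp add: dn_simps)
      moreover have "\<forall>e \<in> dn ?s. e \<in> dn s \<and> (e \<in> dn a) = (d \<in> dn a)" by (simp add: dn_simps)
      then have "\<forall>e \<in> dn ?s. \<forall>t \<in> insert a F. (e \<in> dn t) = (d \<in> dn t)"
        using s(2) by (metis insert_iff)
      ultimately show ?case by (intro exI[of _ ?s] conjI)
    qed
    from this[OF B(1)] obtain s where s: "d \<in> dn s" "\<forall>e \<in> dn s. \<forall>t \<in> ?F. (e \<in> dn t) = (d \<in> dn t)"
      by (elim exE conjE)
    then have "dn s \<noteq> {}" by blast
    from dn_Pt[OF this] obtain e where e: "e \<in> dn s" "dn (T_pt s) = {e}" by (elim bexE)
    let ?w = "\<lambda>t. e \<in> dn t"
    have eD: "e \<in> D" using e(1) dnD by blast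
    have wS: "?w \<in> S" by (rule chiS[OF eD])
    have "?w t \<in> B t" for t
    proof (cases "t \<in> ?F")
      case True
      then have "?w t = vc t" using d(2) s(2) e(1) by blast
      then show ?thesis using B(2) by (simp add: PiE_iff)
    qed auto
    then have "?w \<in> O'" using B(3) by (auto simp: PiE_iff)
    then have nE: "?w \<notin> ?E" using O'(2) wS by blast
    have "\<forall>t. ?w t \<longrightarrow> q ?w \<in> cl (dn t)" using qK[OF wS] by (simp add: K_def)
    moreover have "?w (T_pt s)" using e(2) by simp
    ultimately have "q ?w \<in> cl (dn (T_pt s))" by blast
    moreover have "cl {e} = {e}"
      using haus eD DC unfolding cl_def by (meson closure_of_closedin closedin_Hausdorff_sing_eq subsetD)
    ultimately have "q ?w = e" using e(2) by simp
    then show False using nE wS eD by (simp add: topC' D_def)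
  qed
  then show ?thesis
    using compC' hausC' cont unfolding test_map_def by blast
qed

lemma k_closedin_test_map:
  fixes X :: "'a topology" and C :: "'c topology"
  assumes A: "k_closedin X A" and p: "test_map C X p"
  shows "closedin C {c \<in> topspace C. p c \<in> A}"
proof (rule ccontr)
  assume "\<not> ?thesis"
  moreover have "A \<subseteq> topspace X" using A by (simp add: k_closedin_def)
  ultimately obtain C' :: "('a set test_term \<Rightarrow> bool) topology" and p' where C': "test_map C' X p'"
    and n: "\<not> closedin C' {d \<in> topspace C'. p' d \<in> A}"
    using small_test_map[OF p] by blast
  obtain g :: "nat \<times> ('a + nat) \<Rightarrow> 'a + nat" where g: "inj g"
    using ex_inj_nat_pairing by (rule exE)
  let ?e = "\<lambda>t. g ` test_term_code g t"
  have e: "inj ?e"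
    using inj_test_term_code[OF g] g by (simp add: inj_def inj_image_eq_iff)
  have "inj (\<lambda>v. ?e ` {t. v t})"
  proof (rule injI)
    fix v w :: "'a set test_term \<Rightarrow> bool"
    assume "?e ` {t. v t} = ?e ` {t. w t}"
    then have "{t. v t} = {t. w t}" by (simp only: inj_image_eq_iff[OF e])
    then show "v = w" by (simp add: set_eq_iff fun_eq_iff)
  qed
  then show False using k_closedin_test_map_small[OF A _ C'] n by blast
qed


subsection \<open>Products and function spaces\<close>

definition k_prod :: "'a topology \<Rightarrow> 'b topology \<Rightarrow> ('a \<times> 'b) topology" where
  "k_prod X Y = kify (prod_topology X Y)"

definition k_power :: "nat \<Rightarrow> 'a topology \<Rightarrow> (nat \<Rightarrow> 'a) topology" where
  "k_power n X = kify (product_topology (\<lambda>_. X) {..<n})"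

text \<open>
  Maps are represented by their extensional representatives, so that equality of functions is
  equality of maps.
\<close>

definition cmaps :: "'a topology \<Rightarrow> 'b topology \<Rightarrow> ('a \<Rightarrow> 'b) set" where
  "cmaps X Y = {f \<in> extensional (topspace X). continuous_map X Y f}"

definition compact_open_topology :: "'a topology \<Rightarrow> 'b topology \<Rightarrow> ('a \<Rightarrow> 'b) topology" where
  "compact_open_topology X Y =
     topology_generated_by {{f \<in> cmaps X Y. f ` K \<subseteq> U} | K U. compactin X K \<and> openin Y U}"

definition k_fun :: "'a topology \<Rightarrow> 'b topology \<Rightarrow> ('a \<Rightarrow> 'b) topology" where
  "k_fun X Y = kify (compact_open_topology X Y)"

text \<open>A subspace of a k-space need not be a k-space, so subspace topologies are turned into k-topologies.\<close>

definition k_subspace :: "'a topology \<Rightarrow> 'a set \<Rightarrow> 'a topology" where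
  "k_subspace X S = kify (subtopology X S)"

definition based_k_fun ::
    "'a topology \<Rightarrow> 'a \<Rightarrow> 'b topology \<Rightarrow> 'b \<Rightarrow> ('a \<Rightarrow> 'b) topology" where
  "based_k_fun X x\<^sub>0 Y y\<^sub>0 = k_subspace (k_fun X Y) {f. f x\<^sub>0 = y\<^sub>0}"


section \<open>Commutative topological monoids\<close>

record 'a top_monoid = "'a monoid" +
  mtop :: "'a topology"

definition CMon :: "'a top_monoid \<Rightarrow> bool" where
  "CMon M \<longleftrightarrow> comm_monoid M \<and> topspace (mtop M) = carrier M \<and> test_k_space (mtop M) \<and>
     continuous_map (k_prod (mtop M) (mtop M)) (mtop M) (\<lambda>(x, y). x \<otimes>\<^bsub>M\<^esub> y)"

definition CMon_hom :: "'a top_monoid \<Rightarrow> 'b top_monoid \<Rightarrow> ('a \<Rightarrow> 'b) set" where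
  "CMon_hom M N = {f \<in> cmaps (mtop M) (mtop N). f \<in> hom M N \<and> f \<one>\<^bsub>M\<^esub> = \<one>\<^bsub>N\<^esub>}"

definition CMon_id :: "'a top_monoid \<Rightarrow> 'a \<Rightarrow> 'a" where
  "CMon_id M = (\<lambda>x\<in>carrier M. x)"

definition CMon_const :: "'a top_monoid \<Rightarrow> 'b top_monoid \<Rightarrow> 'a \<Rightarrow> 'b" where
  "CMon_const M N = (\<lambda>x\<in>carrier M. \<one>\<^bsub>N\<^esub>)"

definition CMon_space :: "'a top_monoid \<Rightarrow> 'b top_monoid \<Rightarrow> ('a \<Rightarrow> 'b) topology" where
  "CMon_space M N =
     k_subspace (based_k_fun (mtop M) \<one>\<^bsub>M\<^esub> (mtop N) \<one>\<^bsub>N\<^esub>) (CMon_hom M N)"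

definition prod_top_monoid ::
    "'a top_monoid \<Rightarrow> 'b top_monoid \<Rightarrow> ('a \<times> 'b) top_monoid" (infixr \<open>\<times>\<^sub>M\<^sub>o\<^sub>n\<close> 80) where
  "M \<times>\<^sub>M\<^sub>o\<^sub>n N =
     \<lparr>carrier = carrier M \<times> carrier N,
      mult = (\<lambda>(x, y) (x', y'). (x \<otimes>\<^bsub>M\<^esub> x', y \<otimes>\<^bsub>N\<^esub> y')),
      one = (\<one>\<^bsub>M\<^esub>, \<one>\<^bsub>N\<^esub>),
      mtop = k_prod (mtop M) (mtop N)\<rparr>"


section \<open>Topological realization of simplicial spaces\<close>

definition quotient_topology :: "'a topology \<Rightarrow> 'a rel \<Rightarrow> 'a set topology" where
  "quotient_topology X r = topology (\<lambda>U. U \<subseteq> topspace X // r \<and> openin X (\<Union>U))"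

definition simplex_topology :: "nat \<Rightarrow> (nat \<Rightarrow> real) topology" where
  "simplex_topology n = subtopology (powertop_real UNIV) (standard_simplex n)"

text \<open>
  The codegeneracy of the standard simplices that adds the coordinates \<open>k\<close> and \<open>k + 1\<close>. The coface
  maps are the library's \<^const>\<open>simplical_face\<close>, which insert a zero coordinate.
\<close>

definition simplical_degen :: "nat \<Rightarrow> (nat \<Rightarrow> real) \<Rightarrow> nat \<Rightarrow> real" where
  "simplical_degen k t =
     (\<lambda>j. if j < k then t j else if j = k then t k + t (Suc k) else t (Suc j))"

type_synonym 'a real_point = "(nat \<times> 'a \<times> (nat \<Rightarrow> real)) set"

text \<open>
  A simplicial space is given by its spaces \<open>X n\<close>, its faces \<open>d n i\<close> from \<open>X n\<close> to \<open>X (n - 1)\<close> and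
  its degeneracies \<open>s n i\<close> from \<open>X n\<close> to \<open>X (n + 1)\<close>. Points of the realization are equivalence
  classes of triples \<open>(n, x, t)\<close>.
\<close>

definition prerealization :: "(nat \<Rightarrow> 'a topology) \<Rightarrow> (nat \<times> 'a \<times> (nat \<Rightarrow> real)) topology" where
  "prerealization X = sum_topology (\<lambda>n. k_prod (X n) (simplex_topology n)) UNIV"

definition realization_gen ::
    "(nat \<Rightarrow> 'a topology) \<Rightarrow> (nat \<Rightarrow> nat \<Rightarrow> 'a \<Rightarrow> 'a) \<Rightarrow> (nat \<Rightarrow> nat \<Rightarrow> 'a \<Rightarrow> 'a)
      \<Rightarrow> (nat \<times> 'a \<times> (nat \<Rightarrow> real)) rel" where
  "realization_gen X d s =
     {((n - 1, d n i x, t), (n, x, simplical_face i t)) | n i x t.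
         1 \<le> n \<and> i \<le> n \<and> x \<in> topspace (X n) \<and> t \<in> standard_simplex (n - 1)} \<union>
     {((n + 1, s n i x, t), (n, x, simplical_degen i t)) | n i x t.
         i \<le> n \<and> x \<in> topspace (X n) \<and> t \<in> standard_simplex (n + 1)}"

definition realization_rel ::
    "(nat \<Rightarrow> 'a topology) \<Rightarrow> (nat \<Rightarrow> nat \<Rightarrow> 'a \<Rightarrow> 'a) \<Rightarrow> (nat \<Rightarrow> nat \<Rightarrow> 'a \<Rightarrow> 'a)
      \<Rightarrow> (nat \<times> 'a \<times> (nat \<Rightarrow> real)) rel" where
  "realization_rel X d s =
     Restr ((realization_gen X d s \<union> (realization_gen X d s)\<inverse>)\<^sup>*) (topspace (prerealization X))"

definition realization ::
    "(nat \<Rightarrow> 'a topology) \<Rightarrow> (nat \<Rightarrow> nat \<Rightarrow> 'a \<Rightarrow> 'a) \<Rightarrow> (nat \<Rightarrow> nat \<Rightarrow> 'a \<Rightarrow> 'a)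
      \<Rightarrow> 'a real_point topology" where
  "realization X d s = quotient_topology (prerealization X) (realization_rel X d s)"


section \<open>The classifying space functor\<close>

text \<open>
  A tuple \<open>(x\<^sub>1, \<dots>, x\<^sub>n)\<close> is an extensional function on \<open>{..<n}\<close>, hence indices are shifted by one.
  For \<open>i = 0\<close> and \<open>i = n\<close> the middle case of \<open>bar_face\<close> does not occur, and the first
  respectively last entry is dropped.
\<close>

definition bar_face :: "'a top_monoid \<Rightarrow> nat \<Rightarrow> nat \<Rightarrow> (nat \<Rightarrow> 'a) \<Rightarrow> nat \<Rightarrow> 'a" where
  "bar_face M n i x =
     (\<lambda>j\<in>{..<n - 1}. if Suc j < i then x j
                      else if Suc j = i then x j \<otimes>\<^bsub>M\<^esub> x (Suc j)
                      else x (Suc j))"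

definition bar_degen :: "'a top_monoid \<Rightarrow> nat \<Rightarrow> nat \<Rightarrow> (nat \<Rightarrow> 'a) \<Rightarrow> nat \<Rightarrow> 'a" where
  "bar_degen M n i x =
     (\<lambda>j\<in>{..<n + 1}. if j < i then x j else if j = i then \<one>\<^bsub>M\<^esub> else x (j - 1))"

type_synonym 'a bar_point = "(nat \<Rightarrow> 'a) real_point"

definition B_space :: "'a top_monoid \<Rightarrow> 'a bar_point topology" where
  "B_space M = realization (\<lambda>n. k_power n (mtop M)) (bar_face M) (bar_degen M)"

definition B_class :: "'a top_monoid \<Rightarrow> nat \<times> (nat \<Rightarrow> 'a) \<times> (nat \<Rightarrow> real) \<Rightarrow> 'a bar_point" where
  "B_class M p =
     realization_rel (\<lambda>n. k_power n (mtop M)) (bar_face M) (bar_degen M) `` {p}"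

definition B_map ::
    "'a top_monoid \<Rightarrow> 'b top_monoid \<Rightarrow> ('a \<Rightarrow> 'b) \<Rightarrow> 'a bar_point \<Rightarrow> 'b bar_point" where
  "B_map M N f =
     (\<lambda>u\<in>topspace (B_space M).
        the_elem ((\<lambda>(n, x, t). B_class N (n, \<lambda>i\<in>{..<n}. f (x i), t)) ` u))"

text \<open>
  The inverse of the canonical homeomorphism \<open>B (M \<times> M) \<rightarrow> B M \<times> B M\<close>, whose components are
  induced by the projections.
\<close>

definition B_pair :: "'a top_monoid \<Rightarrow> 'a bar_point \<Rightarrow> 'a bar_point \<Rightarrow> ('a \<times> 'a) bar_point" where
  "B_pair M u v =
     (THE w. w \<in> topspace (B_space (M \<times>\<^sub>M\<^sub>o\<^sub>n M)) \<and>
        B_map (M \<times>\<^sub>M\<^sub>o\<^sub>n M) M fst w = u \<and> B_map (M \<times>\<^sub>M\<^sub>o\<^sub>n M) M snd w = v)"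

definition B_obj :: "'a top_monoid \<Rightarrow> 'a bar_point top_monoid" where
  "B_obj M =
     \<lparr>carrier = topspace (B_space M),
      mult = (\<lambda>u v. B_map (M \<times>\<^sub>M\<^sub>o\<^sub>n M) M (\<lambda>(x, y). x \<otimes>\<^bsub>M\<^esub> y) (B_pair M u v)),
      one = B_class M (0, \<lambda>i\<in>{..<0}. \<one>\<^bsub>M\<^esub>, \<lambda>j. if j = 0 then 1 else 0),
      mtop = B_space M\<rparr>"


section \<open>The loop space functor\<close>

definition circle :: "complex topology" where
  "circle = top_of_set (sphere 0 1)"

definition Omega_space :: "'a top_monoid \<Rightarrow> (complex \<Rightarrow> 'a) topology" where
  "Omega_space M = based_k_fun circle 1 (mtop M) \<one>\<^bsub>M\<^esub>"

definition Omega_obj :: "'a top_monoid \<Rightarrow> (complex \<Rightarrow> 'a) top_monoid" where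
  "Omega_obj M =
     \<lparr>carrier = topspace (Omega_space M),
      mult = (\<lambda>\<omega> \<eta>. \<lambda>z\<in>topspace circle. \<omega> z \<otimes>\<^bsub>M\<^esub> \<eta> z),
      one = (\<lambda>z\<in>topspace circle. \<one>\<^bsub>M\<^esub>),
      mtop = Omega_space M\<rparr>"

definition Omega_map ::
    "'a top_monoid \<Rightarrow> 'b top_monoid \<Rightarrow> ('a \<Rightarrow> 'b) \<Rightarrow> (complex \<Rightarrow> 'a) \<Rightarrow> complex \<Rightarrow> 'b" where
  "Omega_map M N f = (\<lambda>\<omega>\<in>carrier (Omega_obj M). \<lambda>z\<in>topspace circle. f (\<omega> z))"


section \<open>The adjunction\<close>

text \<open>
  The loop \<open>t \<mapsto> [m; (t, 1 - t)]\<close> in \<open>B M\<close>, with \<open>t \<in> [0, 1)\<close> parametrizing the circle by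
  \<open>exp (2 \<pi> \<i> t)\<close>.
\<close>

definition B_loop :: "'a top_monoid \<Rightarrow> 'a \<Rightarrow> complex \<Rightarrow> 'a bar_point" where
  "B_loop M m z =
     (let t = Arg2pi z / (2 * pi)
      in B_class M (1, \<lambda>i\<in>{..<1}. m, \<lambda>j. if j = 0 then t else if j = 1 then 1 - t else 0))"

definition adjunct ::
    "'a top_monoid \<Rightarrow> 'b top_monoid \<Rightarrow> ('a bar_point \<Rightarrow> 'b) \<Rightarrow> 'a \<Rightarrow> complex \<Rightarrow> 'b" where
  "adjunct M N h = (\<lambda>m\<in>carrier M. \<lambda>z\<in>topspace circle. h (B_loop M m z))"

end

(*
The classifying space of a commutative monoid M is the tensor M (x) S^1: by commutativity a point
[x_1,...,x_n; t] is the same as a configuration of points t_0 + ... + t_(i-1) of the open interval (0,1)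
with labels x_i, where labels of coinciding points are multiplied, points with label 1 are erased and
points vanish at the end points. Hence B M is in bijection with the finitely supported functions from
(0,1) to M; in this description its product is pointwise, and a homomorphism h on B M is determined by
the loops z |-> h [m; z], from which it is recovered as the product of the values at the labelled points.

All continuity statements are reduced to maps out of compact Hausdorff spaces. A space X is controlled by
a family of maps from compact Hausdorff spaces that determines its topology; for B M the maps
d |-> [x(d); t(d)] form such a family, although a test map into B M need not lift to the simplices.
Whitehead's theorem on products with compact spaces reduces continuity on products and the exponential law
to such families. Unsorted points depend continuously on labels and positions because the parameter space
is a finite union of closed sets on each of which one permutation sorts the positions.
*)

theory Submission
  imports Defs
begin

section \<open>Compact Hausdorff test spaces\<close>

text \<open>The usual construction of the product on \<open>B M\<close> subdivides a product of two
  simplices in order to identify \<open>B (M x M)\<close> with \<open>B M x B M\<close>. Here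
  commutativity does this work: a product is represented by two concatenated lists of labelled
  positions, and the subdivision survives only as the closed sets on which one permutation sorts
  such a list. The obstacle is that the description of points by functions on (0,1) is a mere
  bijection. The support of such a function jumps when a label becomes the unit, when positions
  collide or when a position reaches an end point, and no topology is put on the functions.
  Algebraic identities are therefore checked on functions, while continuity is always proved from
  lists of fixed length with continuously varying labels and positions. Each construction on
  homomorphisms is proved continuous for a whole family over a compact Hausdorff space
  \<open>C\<close>. A one-point \<open>C\<close> gives continuity of the individual map, an
  arbitrary \<open>C\<close> gives the enrichment.\<close>

definition chaus :: "'a topology \<Rightarrow> bool" where
  "chaus C \<longleftrightarrow> compact_space C \<and> Hausdorff_space C"

lemma test_map_iff: "test_map C X p \<longleftrightarrow> chaus C \<and> continuous_map C X p"
  by (auto simp: test_map_def chaus_def)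

lemma chaus_prod: "chaus C \<Longrightarrow> chaus D \<Longrightarrow> chaus (prod_topology C D)"
  by (simp add: chaus_def compact_space_prod_topology Hausdorff_space_prod_topology)

lemma chaus_closed_subspace: "chaus C \<Longrightarrow> closedin C S \<Longrightarrow> chaus (subtopology C S)"
  by (simp add: chaus_def Hausdorff_space_subtopology closedin_compact_space compact_space_subtopology)

lemma chaus_point: "chaus (discrete_topology {x})"
  by (simp add: chaus_def compact_space_discrete_topology)

lemma k_closedin_compl:
  fixes X :: "'a topology"
  assumes "U \<subseteq> topspace X"
  shows "k_closedin X (topspace X - U) \<longleftrightarrow>
    (\<forall>(C :: 'a test_point topology) p. test_map C X p \<longrightarrow> openin C {c \<in> topspace C. p c \<in> U})"
proof -
  have "closedin C {c \<in> topspace C. p c \<in> topspace X - U} \<longleftrightarrow> openin C {c \<in> topspace C. p c \<in> U}"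
    if "test_map C X p" for C :: "'a test_point topology" and p
  proof -
    have "{c \<in> topspace C. p c \<in> topspace X - U} = topspace C - {c \<in> topspace C. p c \<in> U}"
      using that by (auto simp: test_map_def continuous_map_def)
    then show ?thesis
      using openin_closedin_eq[of C "{c \<in> topspace C. p c \<in> U}"] by auto
  qed
  then show ?thesis unfolding k_closedin_def by auto
qed

lemma openin_kify:
  fixes X :: "'a topology"
  shows "openin (kify X) U \<longleftrightarrow> U \<subseteq> topspace X \<and>
    (\<forall>(C :: 'a test_point topology) p. test_map C X p \<longrightarrow> openin C {c \<in> topspace C. p c \<in> U})"
proof -
  let ?P = "\<lambda>U. U \<subseteq> topspace X \<and>
    (\<forall>(C :: 'a test_point topology) p. test_map C X p \<longrightarrow> openin C {c \<in> topspace C. p c \<in> U})"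
  have eq: "(\<lambda>U. U \<subseteq> topspace X \<and> k_closedin X (topspace X - U)) = ?P"
    using k_closedin_compl by (intro ext) blast
  have "istopology ?P"
    unfolding istopology_def
  proof (intro conjI allI impI)
    fix S T C p assume "?P S" "?P T" "test_map (C :: 'a test_point topology) X p"
    moreover have "{c \<in> topspace C. p c \<in> S \<inter> T} = {c \<in> topspace C. p c \<in> S} \<inter> {c \<in> topspace C. p c \<in> T}"
      by auto
    ultimately show "openin C {c \<in> topspace C. p c \<in> S \<inter> T}" by (metis (no_types) openin_Int)
  next
    fix K C p assume K: "\<forall>S\<in>K. ?P S" "test_map (C :: 'a test_point topology) X p"
    have "{c \<in> topspace C. p c \<in> \<Union>K} = \<Union>((\<lambda>S. {c \<in> topspace C. p c \<in> S}) ` K)"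
      by auto
    then show "openin C {c \<in> topspace C. p c \<in> \<Union>K}" using K by auto
  qed blast+
  then show ?thesis unfolding kify_def eq by (simp add: topology_inverse')
qed

lemma topspace_kify [simp]: "topspace (kify X) = topspace X"
proof -
  have "openin (kify X) (topspace X)"
    unfolding openin_kify
  proof (intro conjI allI impI)
    fix C :: "'a test_point topology" and p assume "test_map C X p"
    then have "{c \<in> topspace C. p c \<in> topspace X} = topspace C"
      by (auto simp: test_map_def continuous_map_def)
    then show "openin C {c \<in> topspace C. p c \<in> topspace X}" by simp
  qed simp
  then show ?thesis by (meson openin_kify openin_subset openin_topspace subset_antisym)
qed

text \<open>Here the bound on the type of test spaces is removed, by
  \<open>k_closedin_test_map\<close>. Afterwards products and closed subspaces of test spaces may
  serve as test spaces although they live on other types.\<close>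

lemma openin_test_map:
  fixes X :: "'a topology" and C :: "'c topology"
  assumes "openin (kify X) U" "test_map C X p"
  shows "openin C {c \<in> topspace C. p c \<in> U}"
proof -
  have U: "U \<subseteq> topspace X" using assms(1) by (simp add: openin_kify)
  then have "k_closedin X (topspace X - U)" using assms(1) k_closedin_compl openin_kify by blast
  from k_closedin_test_map[OF this assms(2)] have "closedin C {c \<in> topspace C. p c \<in> topspace X - U}" .
  moreover have "{c \<in> topspace C. p c \<in> topspace X - U} = topspace C - {c \<in> topspace C. p c \<in> U}"
    using assms(2) by (auto simp: test_map_def continuous_map_def)
  ultimately show ?thesis using openin_closedin_eq[of C "{c \<in> topspace C. p c \<in> U}"] by auto
qed

lemma openin_imp_openin_kify: "openin X U \<Longrightarrow> openin (kify X) U"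
  unfolding openin_kify
  by (auto simp: openin_subset test_map_def openin_continuous_map_preimage)

text \<open>The new topology is finer but has the same maps from compact Hausdorff spaces. Products,
  function spaces and subspaces are all formed with \<open>kify\<close>, so continuity into them can
  be tested in the underlying ordinary topology.\<close>

lemma continuous_map_into_kify:
  assumes "chaus C"
  shows "continuous_map C (kify X) f \<longleftrightarrow> continuous_map C X f"
proof
  assume "continuous_map C (kify X) f"
  then show "continuous_map C X f"
    by (auto simp: continuous_map_def openin_imp_openin_kify)
next
  assume *: "continuous_map C X f"
  then have "test_map C X f" using assms by (simp add: test_map_iff)
  then show "continuous_map C (kify X) f"
    using * openin_test_map[of X _ C f] by (auto simp: continuous_map_def)
qed

lemma test_map_kify: "test_map C (kify X) p \<longleftrightarrow> test_map C X p"
  by (auto simp: test_map_iff continuous_map_into_kify)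

lemma test_k_space_openin:
  assumes "test_k_space X"
  shows "openin X U \<longleftrightarrow> openin (kify X) U"
proof
  assume U: "openin (kify X) U"
  then have "U \<subseteq> topspace X" by (simp add: openin_kify)
  moreover from this have "k_closedin X (topspace X - U)" using U k_closedin_compl openin_kify by blast
  ultimately show "openin X U"
    using assms by (simp add: test_k_space_def openin_closedin_eq)
qed (rule openin_imp_openin_kify)

lemma test_k_spaceI:
  assumes "\<And>U. openin (kify X) U \<Longrightarrow> openin X U"
  shows "test_k_space X"
  unfolding test_k_space_def
proof (intro allI iffI)
  fix A assume "closedin X A"
  then show "k_closedin X A"
    by (auto simp: k_closedin_def test_map_def closedin_subset closedin_continuous_map_preimage)
next
  fix A assume A: "k_closedin X A"
  then have "A \<subseteq> topspace X" by (simp add: k_closedin_def)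
  then have "topspace X - (topspace X - A) = A" by auto
  with A have "openin (kify X) (topspace X - A)"
    unfolding openin_kify using k_closedin_compl[of "topspace X - A" X] by auto
  then show "closedin X A" using assms \<open>A \<subseteq> topspace X\<close> by (simp add: closedin_def)
qed

lemma test_k_space_kify: "test_k_space (kify X)"
proof (rule test_k_spaceI)
  fix U assume "openin (kify (kify X)) U"
  then show "openin (kify X) U" by (simp add: openin_kify[of "kify X"] openin_kify[of X] test_map_kify)
qed

lemma chaus_imp_test_k_space:
  assumes "chaus C" shows "test_k_space C"
proof (rule test_k_spaceI)
  fix U assume U: "openin (kify C) U"
  have "test_map C C (\<lambda>x. x)" using assms by (simp add: test_map_iff)
  from openin_test_map[OF U this] have "openin C {c \<in> topspace C. c \<in> U}" .
  moreover have "{c \<in> topspace C. c \<in> U} = U" using U by (auto simp: openin_kify)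
  ultimately show "openin C U" by simp
qed

section \<open>Spaces determined by families of test maps\<close>

text \<open>\<open>X\<close> carries the final topology for a jointly surjective family.
  Surjectivity is a separate clause because finality alone constrains nothing at points outside all
  images; it lets a map defined on \<open>X\<close> be seen to land in its codomain by looking at
  the probes only.\<close>

definition probes :: "'x topology \<Rightarrow> ('d topology \<times> ('d \<Rightarrow> 'x)) set \<Rightarrow> bool" where
  "probes X Q \<longleftrightarrow> (\<forall>(D, q) \<in> Q. test_map D X q) \<and>
     (\<forall>x \<in> topspace X. \<exists>(D, q) \<in> Q. x \<in> q ` topspace D) \<and>
     (\<forall>U \<subseteq> topspace X. (\<forall>(D, q) \<in> Q. openin D {d \<in> topspace D. q d \<in> U}) \<longrightarrow> openin X U)"

lemma probesD:
  assumes "probes X Q" "(D, q) \<in> Q"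
  shows "chaus D" "continuous_map D X q"
  using assms by (auto simp: probes_def test_map_iff)

lemma probes_cover:
  assumes "probes X Q" "x \<in> topspace X"
  obtains D q d where "(D, q) \<in> Q" "d \<in> topspace D" "x = q d"
  using assms unfolding probes_def by fast

lemma probes_openin:
  assumes "probes X Q" "U \<subseteq> topspace X"
    and "\<And>D q. (D, q) \<in> Q \<Longrightarrow> openin D {d \<in> topspace D. q d \<in> U}"
  shows "openin X U"
  using assms by (auto simp: probes_def)

text \<open>Finality is the definition of a k-space, and constant maps from a point provide the
  covering.\<close>

lemma probes_test_k_space:
  fixes X :: "'x topology"
  assumes "test_k_space X"
  shows "probes X {(D :: 'x test_point topology, q). test_map D X q}"
  unfolding probes_def
proof (intro conjI ballI allI impI)
  fix x assume "x \<in> topspace X"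
  then have "test_map (discrete_topology {undefined}) X (\<lambda>_ :: 'x test_point. x)"
    using chaus_point by (auto simp: test_map_iff)
  then show "\<exists>(D :: 'x test_point topology, q)\<in>{(D, q). test_map D X q}. x \<in> q ` topspace D"
    by (intro bexI[of _ "(discrete_topology {undefined}, \<lambda>_ :: 'x test_point. x)"]) auto
next
  fix U assume U: "U \<subseteq> topspace X" "\<forall>(D :: 'x test_point topology, q)\<in>{(D, q). test_map D X q}.
     openin D {d \<in> topspace D. q d \<in> U}"
  then show "openin X U"
    using test_k_space_openin[OF assms] openin_kify[of X U] by auto
qed auto

lemma probes_imp_test_k_space:
  assumes "probes X Q" shows "test_k_space X"
proof (rule test_k_spaceI)
  fix U assume U: "openin (kify X) U"
  show "openin X U"
  proof (rule probes_openin[OF assms])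
    fix D q assume "(D, q) \<in> Q"
    then have "test_map D X q" using assms by (auto simp: probes_def)
    with U show "openin D {d \<in> topspace D. q d \<in> U}" by (rule openin_test_map)
  qed (use U in \<open>simp add: openin_kify\<close>)
qed

lemma continuous_map_probes:
  assumes "probes X Q" and "\<And>D q. (D, q) \<in> Q \<Longrightarrow> continuous_map D Y (f \<circ> q)"
  shows "continuous_map X Y f"
  unfolding continuous_map_def
proof (intro conjI allI impI)
  show "f \<in> topspace X \<rightarrow> topspace Y"
  proof
    fix x assume "x \<in> topspace X"
    with assms(1) obtain D q d where "(D, q) \<in> Q" "d \<in> topspace D" "x = q d" by (rule probes_cover)
    then show "f x \<in> topspace Y" using assms(2)[of D q] by (auto simp: continuous_map_def)
  qed
next
  fix U assume U: "openin Y U"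
  show "openin X {x \<in> topspace X. f x \<in> U}"
  proof (rule probes_openin[OF assms(1)])
    fix D q assume Dq: "(D, q) \<in> Q"
    have "{d \<in> topspace D. q d \<in> {x \<in> topspace X. f x \<in> U}} = {d \<in> topspace D. (f \<circ> q) d \<in> U}"
      using probesD(2)[OF assms(1) Dq] by (auto simp: continuous_map_def)
    then show "openin D {d \<in> topspace D. q d \<in> {x \<in> topspace X. f x \<in> U}}"
      using openin_continuous_map_preimage[OF assms(2)[OF Dq] U] by (simp only:)
  qed auto
qed

lemma continuous_map_test_k:
  fixes X :: "'x topology"
  assumes "test_k_space X"
    and "\<And>(D :: 'x test_point topology) q. chaus D \<Longrightarrow> continuous_map D X q \<Longrightarrow> continuous_map D Y (f \<circ> q)"
  shows "continuous_map X Y f"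
  by (rule continuous_map_probes[OF probes_test_k_space]) (use assms in \<open>auto simp: test_map_iff\<close>)

text \<open>
  Whitehead's theorem on products of quotient maps with a locally compact space: a tube around
  \<open>K \<times> {x}\<close> with \<open>K\<close> a compact neighbourhood shows that \<open>{x. K \<times> {x} \<subseteq> W}\<close> is open.
\<close>

lemma continuous_map_prod_probes:
  assumes C: "chaus C" and Q: "probes X Q"
    and f: "\<And>D q. (D, q) \<in> Q \<Longrightarrow> continuous_map (prod_topology C D) Y (\<lambda>(c, d). f (c, q d))"
  shows "continuous_map (prod_topology C X) Y f"
  unfolding continuous_map_def
proof (intro conjI allI impI)
  show "f \<in> topspace (prod_topology C X) \<rightarrow> topspace Y"
  proof
    fix z assume "z \<in> topspace (prod_topology C X)"
    then obtain c x where z: "z = (c, x)" "c \<in> topspace C" "x \<in> topspace X" by auto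
    with Q obtain D q d where "(D, q) \<in> Q" "d \<in> topspace D" "x = q d" by (meson probes_cover)
    then show "f z \<in> topspace Y" using f[of D q] z by (auto simp: continuous_map_def Pi_iff)
  qed
next
  fix U assume U: "openin Y U"
  let ?W = "{z \<in> topspace (prod_topology C X). f z \<in> U}"
  have W: "openin (prod_topology C D) {(c, d) \<in> topspace C \<times> topspace D. f (c, q d) \<in> U}" if "(D, q) \<in> Q" for D q
  proof -
    have "{(c, d) \<in> topspace C \<times> topspace D. f (c, q d) \<in> U}
      = {z \<in> topspace (prod_topology C D). (\<lambda>(c, d). f (c, q d)) z \<in> U}" by auto
    then show ?thesis using openin_continuous_map_preimage[OF f[OF that] U] by (simp only:)
  qed
  have reg: "regular_space C" using C compact_Hausdorff_imp_regular_space by (auto simp: chaus_def)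
  show "openin (prod_topology C X) ?W"
  proof (subst openin_subopen, intro ballI)
    fix z assume "z \<in> ?W"
    then obtain c x where z: "z = (c, x)" "c \<in> topspace C" "x \<in> topspace X" "f (c, x) \<in> U" by auto
    with Q obtain D q d where Dq: "(D, q) \<in> Q" "d \<in> topspace D" "x = q d" by (meson probes_cover)
    have "continuous_map C (prod_topology C D) (\<lambda>c. (c, d))"
      using Dq by (simp add: continuous_map_pairedI)
    from openin_continuous_map_preimage[OF this W[OF Dq(1)]]
    have O: "openin C {c' \<in> topspace C. f (c', x) \<in> U}" using Dq by (simp cong: conj_cong)
    then obtain G K where G: "openin C G" "closedin C K" "c \<in> G" "G \<subseteq> K" "K \<subseteq> {c' \<in> topspace C. f (c', x) \<in> U}"
      using reg z unfolding neighbourhood_base_of_closedin[symmetric] neighbourhood_base_of by force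
    have K: "compactin C K" using C G(2) by (simp add: chaus_def closedin_compact_space)
    let ?V = "{y \<in> topspace X. \<forall>c' \<in> K. f (c', y) \<in> U}"
    have KC: "K \<subseteq> topspace C" using G(5) by auto
    have "openin X ?V"
    proof (rule probes_openin[OF Q])
      fix E r assume Er: "(E, r) \<in> Q"
      let ?W' = "{(c, d) \<in> topspace C \<times> topspace E. f (c, r d) \<in> U}"
      show "openin E {d \<in> topspace E. r d \<in> ?V}"
      proof (subst openin_subopen, intro ballI)
        fix e assume "e \<in> {d \<in> topspace E. r d \<in> ?V}"
        then have e: "e \<in> topspace E" "K \<times> {e} \<subseteq> ?W'" using KC by auto
        from tube_lemma_left[OF W[OF Er] K e] obtain G' V' where
          "openin C G'" "openin E V'" "K \<subseteq> G'" "e \<in> V'" "G' \<times> V' \<subseteq> ?W'" by blast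
        moreover from this have "V' \<subseteq> {d \<in> topspace E. r d \<in> ?V}"
          using probesD(2)[OF Q Er] openin_subset[of E V'] by (auto simp: continuous_map_def)
        ultimately show "\<exists>T. openin E T \<and> e \<in> T \<and> T \<subseteq> {d \<in> topspace E. r d \<in> ?V}" by blast
      qed
    qed auto
    moreover have "(c, x) \<in> G \<times> ?V" using G z by auto
    moreover have "G \<times> ?V \<subseteq> ?W" using G KC by auto
    ultimately show "\<exists>T. openin (prod_topology C X) T \<and> z \<in> T \<and> T \<subseteq> ?W"
      using G(1) z(1) by (intro exI[of _ "G \<times> ?V"]) (simp add: openin_prod_Times_iff)
  qed
qed

lemma continuous_map_prod_swap:
  "continuous_map (prod_topology X Y) Z f \<Longrightarrow> continuous_map (prod_topology Y X) Z (\<lambda>(y, x). f (x, y))"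
  using continuous_map_compose[OF continuous_map_pairedI[OF continuous_map_snd continuous_map_fst], of X Y Z f]
  by (simp add: o_def case_prod_unfold)

text \<open>Neither factor is compact, so \<open>continuous_map_prod_probes\<close> does not apply
  directly. A test map \<open>p\<close> from \<open>C\<close> is split: its second coordinate stays
  a function of \<open>C\<close> while the first is freed to range over \<open>X1\<close>. This
  gives a map on \<open>C\<close> times \<open>X1\<close> that is handled with \<open>C\<close> as
  compact factor, and the probes \<open>D\<close> of \<open>X1\<close> then serve as compact factor
  against \<open>X2\<close>. Restricting to the graph of \<open>fst o p\<close> returns to
  \<open>C\<close>.\<close>

lemma continuous_map_k_prod_probes:
  fixes X1 :: "'a topology" and X2 :: "'b topology"
  assumes X1: "probes X1 Q1" and X2: "probes X2 Q2"
    and f: "\<And>D1 q1 D2 q2. (D1, q1) \<in> Q1 \<Longrightarrow> (D2, q2) \<in> Q2 \<Longrightarrow>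
      continuous_map (prod_topology D1 D2) Y (\<lambda>(d, e). f (q1 d, q2 e))"
  shows "continuous_map (k_prod X1 X2) Y f"
  unfolding k_prod_def
proof (rule continuous_map_test_k[OF test_k_space_kify])
  fix C :: "('a \<times> 'b) test_point topology" and p
  assume C: "chaus C" and "continuous_map C (kify (prod_topology X1 X2)) p"
  then have p: "continuous_map C (prod_topology X1 X2) p" by (simp add: continuous_map_into_kify)
  then have p12: "continuous_map C X1 (fst \<circ> p)" "continuous_map C X2 (snd \<circ> p)"
    by (simp_all add: continuous_map_pairwise)
  have "continuous_map (prod_topology C X1) Y (\<lambda>(c, x). f (x, snd (p c)))"
  proof (rule continuous_map_prod_probes[OF C X1])
    fix D q assume D: "(D, q) \<in> Q1"
    have "continuous_map (prod_topology D X2) Y (\<lambda>(d, y). f (q d, y))"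
      by (rule continuous_map_prod_probes[OF probesD(1)[OF X1 D] X2]) (use f[OF D] in simp)
    then have "continuous_map (prod_topology X2 D) Y (\<lambda>(y, d). f (q d, y))"
      using continuous_map_prod_swap[of D X2 Y "\<lambda>(d, y). f (q d, y)"] by simp
    moreover have "continuous_map (prod_topology C D) (prod_topology X2 D) (\<lambda>(c, d). (snd (p c), d))"
      using p12(2) by (auto simp: continuous_map_prod_top o_def)
    ultimately have "continuous_map (prod_topology C D) Y ((\<lambda>(y, d). f (q d, y)) \<circ> (\<lambda>(c, d). (snd (p c), d)))"
      by (rule continuous_map_compose[rotated])
    then show "continuous_map (prod_topology C D) Y (\<lambda>(c, d). (\<lambda>(c, x). f (x, snd (p c))) (c, q d))"
      by (simp add: o_def case_prod_unfold)
  qed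
  moreover have "continuous_map C (prod_topology C X1) (\<lambda>c. (c, fst (p c)))"
    using p12(1) by (simp add: continuous_map_pairedI o_def)
  ultimately have "continuous_map C Y ((\<lambda>(c, x). f (x, snd (p c))) \<circ> (\<lambda>c. (c, fst (p c))))"
    by (rule continuous_map_compose[rotated])
  then show "continuous_map C Y (f \<circ> p)" by (simp add: o_def)
qed

section \<open>Mapping spaces\<close>

lemma topspace_compact_open: "topspace (compact_open_topology X Y) = cmaps X Y"
proof -
  \<comment> \<open>The subbasic set for the empty compact set is all of
    \<open>cmaps X Y\<close>.\<close>
  have "cmaps X Y \<in> {{f \<in> cmaps X Y. f ` K \<subseteq> U} | K U. compactin X K \<and> openin Y U}"
    by (intro CollectI exI[of _ "{}"]) auto
  then show ?thesis
    unfolding compact_open_topology_def topology_generated_by_topspace by auto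
qed

text \<open>Exponential law for a compact Hausdorff parameter space. From left to right a point need
  not have compact neighbourhoods in \<open>X\<close>; they are found in a test space
  \<open>D\<close> over \<open>X\<close>, and their images in \<open>X\<close> are compact sets to
  which the compact-open topology applies. From right to left the tube lemma needs compactness of
  \<open>K\<close> only, so it does not matter that compact subsets of \<open>X\<close> may fail to
  be Hausdorff.\<close>

lemma continuous_map_into_k_fun:
  fixes X :: "'x topology"
  assumes C: "chaus C" and X: "test_k_space X"
  shows "continuous_map C (k_fun X Y) \<phi> \<longleftrightarrow>
    (\<forall>c \<in> topspace C. \<phi> c \<in> extensional (topspace X)) \<and>
    continuous_map (prod_topology C X) Y (\<lambda>(c, x). \<phi> c x)" (is "?L \<longleftrightarrow> ?R")
proof
  assume ?L
  then have \<phi>: "continuous_map C (compact_open_topology X Y) \<phi>"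
    using C by (simp add: k_fun_def continuous_map_into_kify)
  then have cm: "\<phi> c \<in> cmaps X Y" if "c \<in> topspace C" for c
    using that by (auto simp: continuous_map_def topspace_compact_open)
  have sub: "openin C {c \<in> topspace C. \<phi> c ` K \<subseteq> U}" if "compactin X K" "openin Y U" for K U
  proof -
    have "openin (compact_open_topology X Y) {f \<in> cmaps X Y. f ` K \<subseteq> U}"
      unfolding compact_open_topology_def using that by (intro topology_generated_by_Basis) auto
    from openin_continuous_map_preimage[OF \<phi> this] show ?thesis using cm by (simp cong: conj_cong)
  qed
  have "continuous_map (prod_topology C X) Y (\<lambda>(c, x). \<phi> c x)"
  proof (rule continuous_map_prod_probes[OF C probes_test_k_space[OF X]])
    fix D :: "'x test_point topology" and q
    assume "(D, q) \<in> {(D, q). test_map D X q}"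
    then have D: "chaus D" and q: "continuous_map D X q" by (auto simp: test_map_iff)
    have reg: "regular_space D" using D compact_Hausdorff_imp_regular_space by (auto simp: chaus_def)
    have "continuous_map (prod_topology C D) Y (\<lambda>(c, d). \<phi> c (q d))"
      unfolding continuous_map_def
    proof (intro conjI allI impI)
      show "(\<lambda>(c, d). \<phi> c (q d)) \<in> topspace (prod_topology C D) \<rightarrow> topspace Y"
        using cm q by (auto simp: cmaps_def continuous_map_def Pi_iff)
    next
      fix U assume U: "openin Y U"
      let ?W = "{z \<in> topspace (prod_topology C D). (\<lambda>(c, d). \<phi> c (q d)) z \<in> U}"
      show "openin (prod_topology C D) ?W"
      proof (subst openin_subopen, intro ballI)
        fix z assume "z \<in> ?W"
        then obtain c d where z: "z = (c, d)" "c \<in> topspace C" "d \<in> topspace D" "\<phi> c (q d) \<in> U" by auto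
        have "continuous_map D Y (\<phi> c \<circ> q)"
          using continuous_map_compose[OF q] cm[OF z(2)] by (auto simp: cmaps_def)
        from openin_continuous_map_preimage[OF this U]
        have "openin D {d \<in> topspace D. \<phi> c (q d) \<in> U}" by simp
        then obtain G K where G: "openin D G" "closedin D K" "d \<in> G" "G \<subseteq> K" "K \<subseteq> {d \<in> topspace D. \<phi> c (q d) \<in> U}"
          using reg z unfolding neighbourhood_base_of_closedin[symmetric] neighbourhood_base_of by force
        have "compactin X (q ` K)"
          using D G(2) q by (auto simp: chaus_def intro: image_compactin closedin_compact_space)
        from sub[OF this U] have "openin C {c \<in> topspace C. \<phi> c ` q ` K \<subseteq> U}" .
        moreover have "{c \<in> topspace C. \<phi> c ` q ` K \<subseteq> U} \<times> G \<subseteq> ?W" using G openin_subset by fastforce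
        moreover have "z \<in> {c \<in> topspace C. \<phi> c ` q ` K \<subseteq> U} \<times> G" using G z by auto
        ultimately show "\<exists>T. openin (prod_topology C D) T \<and> z \<in> T \<and> T \<subseteq> ?W"
          using G(1) by (intro exI[of _ "{c \<in> topspace C. \<phi> c ` q ` K \<subseteq> U} \<times> G"]) (simp add: openin_prod_Times_iff)
      qed
    qed
    then show "continuous_map (prod_topology C D) Y (\<lambda>(c, d). (\<lambda>(c, x). \<phi> c x) (c, q d))" by simp
  qed
  then show ?R using cm by (auto simp: cmaps_def)
next
  assume R: ?R
  have cm: "\<phi> c \<in> cmaps X Y" if "c \<in> topspace C" for c
  proof -
    have "continuous_map X (prod_topology C X) (\<lambda>x. (c, x))"
      using that by (simp add: continuous_map_pairedI)
    then have "continuous_map X Y ((\<lambda>(c, x). \<phi> c x) \<circ> (\<lambda>x. (c, x)))"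
      using R continuous_map_compose by blast
    then show ?thesis using R that by (simp add: cmaps_def o_def)
  qed
  have "continuous_map C (compact_open_topology X Y) \<phi>"
    unfolding compact_open_topology_def continuous_on_generated_topo_iff
  proof (intro conjI allI impI)
    fix V assume "V \<in> {{f \<in> cmaps X Y. f ` K \<subseteq> U} | K U. compactin X K \<and> openin Y U}"
    then obtain K U where K: "V = {f \<in> cmaps X Y. f ` K \<subseteq> U}" "compactin X K" "openin Y U" by blast
    have KX: "K \<subseteq> topspace X" using K(2) compactin_subset_topspace by blast
    let ?W = "{z \<in> topspace (prod_topology C X). (\<lambda>(c, x). \<phi> c x) z \<in> U}"
    have W: "openin (prod_topology C X) ?W"
      using R K(3) openin_continuous_map_preimage by blast
    have eq: "\<phi> -` V \<inter> topspace C = {c \<in> topspace C. \<phi> c ` K \<subseteq> U}" using cm K(1) by auto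
    show "openin C (\<phi> -` V \<inter> topspace C)"
      unfolding eq
    proof (subst openin_subopen, intro ballI)
      fix c assume "c \<in> {c \<in> topspace C. \<phi> c ` K \<subseteq> U}"
      then have c: "c \<in> topspace C" "{c} \<times> K \<subseteq> ?W" using KX by auto
      from tube_lemma_right[OF W K(2) c] obtain G V' where
        G: "openin C G" "c \<in> G" "K \<subseteq> V'" "G \<times> V' \<subseteq> ?W" by blast
      have "G \<subseteq> {c \<in> topspace C. \<phi> c ` K \<subseteq> U}"
      proof
        fix x assume "x \<in> G"
        moreover from this have "(x, k) \<in> ?W" if "k \<in> K" for k using G that by blast
        ultimately show "x \<in> {c \<in> topspace C. \<phi> c ` K \<subseteq> U}" using openin_subset[OF G(1)] by auto
      qed
      then show "\<exists>T. openin C T \<and> c \<in> T \<and> T \<subseteq> {c \<in> topspace C. \<phi> c ` K \<subseteq> U}" using G by blast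
    qed
  next
    show "\<phi> ` topspace C \<subseteq> \<Union>{{f \<in> cmaps X Y. f ` K \<subseteq> U} | K U. compactin X K \<and> openin Y U}"
      using cm topspace_compact_open[of X Y]
      unfolding compact_open_topology_def topology_generated_by_topspace by auto
  qed
  then show ?L using C by (simp add: k_fun_def continuous_map_into_kify)
qed

lemma topspace_based_k_fun: "topspace (based_k_fun X x\<^sub>0 Y y\<^sub>0) = {f \<in> cmaps X Y. f x\<^sub>0 = y\<^sub>0}"
  by (auto simp: based_k_fun_def k_subspace_def k_fun_def topspace_compact_open)

lemma continuous_map_into_based_k_fun:
  assumes C: "chaus C" and X: "test_k_space X"
  shows "continuous_map C (based_k_fun X x\<^sub>0 Y y\<^sub>0) \<phi> \<longleftrightarrow>
    (\<forall>c \<in> topspace C. \<phi> c \<in> extensional (topspace X) \<and> \<phi> c x\<^sub>0 = y\<^sub>0) \<and>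
    continuous_map (prod_topology C X) Y (\<lambda>(c, x). \<phi> c x)"
  using assms
  by (auto simp: based_k_fun_def k_subspace_def continuous_map_into_kify continuous_map_in_subtopology
      continuous_map_into_k_fun Pi_iff)

lemma test_k_space_based_k_fun: "test_k_space (based_k_fun X x\<^sub>0 Y y\<^sub>0)"
  by (simp add: based_k_fun_def k_subspace_def test_k_space_kify)

section \<open>Hom spaces of commutative topological monoids\<close>

lemma CMonD:
  assumes "CMon M"
  shows "comm_monoid M" "topspace (mtop M) = carrier M" "test_k_space (mtop M)"
    "continuous_map (k_prod (mtop M) (mtop M)) (mtop M) (\<lambda>(x, y). x \<otimes>\<^bsub>M\<^esub> y)"
  using assms by (auto simp: CMon_def)

lemma CMon_homD:
  assumes "f \<in> CMon_hom M N"
  shows "f \<in> extensional (topspace (mtop M))" "continuous_map (mtop M) (mtop N) f" "f \<in> hom M N"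
    "f \<one>\<^bsub>M\<^esub> = \<one>\<^bsub>N\<^esub>"
  using assms by (auto simp: CMon_hom_def cmaps_def)

lemma topspace_CMon_space: "topspace (CMon_space M N) = CMon_hom M N"
  by (auto simp: CMon_space_def k_subspace_def topspace_based_k_fun CMon_hom_def)

lemma test_k_space_CMon_space: "test_k_space (CMon_space M N)"
  by (simp add: CMon_space_def k_subspace_def test_k_space_kify)

lemma continuous_map_into_CMon_space:
  assumes C: "chaus C" and X: "test_k_space (mtop M)"
  shows "continuous_map C (CMon_space M N) \<phi> \<longleftrightarrow>
    (\<forall>c \<in> topspace C. \<phi> c \<in> CMon_hom M N) \<and>
    continuous_map (prod_topology C (mtop M)) (mtop N) (\<lambda>(c, x). \<phi> c x)"
  using assms
  by (auto simp: CMon_space_def k_subspace_def continuous_map_into_kify continuous_map_in_subtopology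
      continuous_map_into_based_k_fun Pi_iff CMon_hom_def cmaps_def)

text \<open>The form in which enrichment is proved for \<open>B\<close>, for \<open>\<Omega>\<close>
  and for both directions of the adjunction: the exponential law turns continuity between hom spaces
  into joint continuity over compact Hausdorff families.\<close>

lemma continuous_map_CMon_spaces:
  fixes M :: "'a top_monoid" and N :: "'b top_monoid"
  assumes "test_k_space (mtop M)" "test_k_space (mtop M')"
    and "\<And>f. f \<in> CMon_hom M N \<Longrightarrow> F f \<in> CMon_hom M' N'"
    and "\<And>(C :: ('a \<Rightarrow> 'b) test_point topology) \<phi>. chaus C \<Longrightarrow> continuous_map C (CMon_space M N) \<phi> \<Longrightarrow>
      continuous_map (prod_topology C (mtop M')) (mtop N') (\<lambda>(c, x). F (\<phi> c) x)"
  shows "continuous_map (CMon_space M N) (CMon_space M' N') F"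
proof (rule continuous_map_test_k[OF test_k_space_CMon_space])
  fix C :: "('a \<Rightarrow> 'b) test_point topology" and \<phi>
  assume C: "chaus C" "continuous_map C (CMon_space M N) \<phi>"
  then have "\<forall>c \<in> topspace C. \<phi> c \<in> CMon_hom M N"
    using continuous_map_into_CMon_space[OF C(1) assms(1)] by blast
  then show "continuous_map C (CMon_space M' N') (F \<circ> \<phi>)"
    using assms(3,4) C by (simp add: continuous_map_into_CMon_space[OF C(1) assms(2)])
qed

lemma continuous_map_eval:
  assumes "continuous_map (prod_topology E X) Y (\<lambda>(c, x). \<phi> c x)" "continuous_map E X x"
  shows "continuous_map E Y (\<lambda>e. \<phi> e (x e))"
proof -
  have "continuous_map E (prod_topology E X) (\<lambda>e. (e, x e))"
    using assms(2) by (simp add: continuous_map_pairedI)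
  from continuous_map_compose[OF this assms(1)] show ?thesis by (simp add: o_def)
qed

lemma continuous_map_CMon_eval:
  assumes "chaus E" "test_k_space (mtop M)" "continuous_map E (CMon_space M N) \<phi>" "continuous_map E (mtop M) x"
  shows "continuous_map E (mtop N) (\<lambda>e. \<phi> e (x e))"
  using assms continuous_map_eval[of E "mtop M" "mtop N" \<phi> x] by (simp add: continuous_map_into_CMon_space)

lemma continuous_map_CMon_hom:
  assumes "f \<in> CMon_hom M N" "continuous_map E (mtop M) x"
  shows "continuous_map E (mtop N) (\<lambda>e. f (x e))"
  using continuous_map_compose[OF assms(2) CMon_homD(2)[OF assms(1)]] by (simp add: o_def)

text \<open>Multiplication is continuous for \<open>k_prod\<close>, whose topology is finer than the
  ordinary product; a compact Hausdorff domain does not see the difference.\<close>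

lemma continuous_map_CMon_mult:
  assumes "CMon N" "chaus E" "continuous_map E (mtop N) f" "continuous_map E (mtop N) g"
  shows "continuous_map E (mtop N) (\<lambda>e. f e \<otimes>\<^bsub>N\<^esub> g e)"
proof -
  have "continuous_map E (k_prod (mtop N) (mtop N)) (\<lambda>e. (f e, g e))"
    using assms by (simp add: k_prod_def continuous_map_into_kify continuous_map_pairedI)
  from continuous_map_compose[OF this CMonD(4)[OF assms(1)]] show ?thesis by (simp add: o_def)
qed

lemma continuous_map_CMon_finprod:
  fixes n :: nat
  assumes N: "CMon N" and E: "chaus E" and f: "\<And>i. i < n \<Longrightarrow> continuous_map E (mtop N) (f i)"
  shows "continuous_map E (mtop N) (\<lambda>e. finprod N (\<lambda>i. f i e) {..<n})"
  using f
proof (induction n)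
  case 0
  interpret comm_monoid N using CMonD(1)[OF N] .
  show ?case using CMonD(2)[OF N] by simp
next
  case (Suc n)
  interpret comm_monoid N using CMonD(1)[OF N] .
  have fc: "f i e \<in> carrier N" if "e \<in> topspace E" "i < Suc n" for i e
    using Suc.prems[OF that(2)] that(1) CMonD(2)[OF N] by (auto simp: continuous_map_def)
  have "continuous_map E (mtop N) (\<lambda>e. f n e \<otimes>\<^bsub>N\<^esub> finprod N (\<lambda>i. f i e) {..<n})"
    by (rule continuous_map_CMon_mult[OF N E]) (use Suc in auto)
  then show ?case
    by (rule continuous_map_eq) (simp add: lessThan_Suc fc Pi_iff)
qed

section \<open>The loop functor\<close>

lemma chaus_circle: "chaus circle"
  by (simp add: chaus_def circle_def Hausdorff_space_subtopology compact_space_subtopology)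

lemma topspace_circle: "topspace circle = sphere 0 1"
  by (simp add: circle_def)

lemma test_k_space_circle: "test_k_space circle"
  by (rule chaus_imp_test_k_space[OF chaus_circle])

lemma carrier_Omega:
  "\<omega> \<in> carrier (Omega_obj N) \<longleftrightarrow>
    \<omega> \<in> extensional (topspace circle) \<and> continuous_map circle (mtop N) \<omega> \<and> \<omega> 1 = \<one>\<^bsub>N\<^esub>"
  by (auto simp: Omega_obj_def Omega_space_def topspace_based_k_fun cmaps_def)

lemma mtop_Omega: "mtop (Omega_obj N) = based_k_fun circle 1 (mtop N) \<one>\<^bsub>N\<^esub>"
  by (simp add: Omega_obj_def Omega_space_def)

lemma topspace_Omega: "topspace (mtop (Omega_obj N)) = carrier (Omega_obj N)"
  by (simp add: Omega_obj_def)

lemma mult_Omega: "\<omega> \<otimes>\<^bsub>Omega_obj N\<^esub> \<eta> = (\<lambda>z\<in>topspace circle. \<omega> z \<otimes>\<^bsub>N\<^esub> \<eta> z)"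
  by (simp add: Omega_obj_def)

lemma one_Omega: "\<one>\<^bsub>Omega_obj N\<^esub> = (\<lambda>z\<in>topspace circle. \<one>\<^bsub>N\<^esub>)"
  by (simp add: Omega_obj_def)

lemma Omega_closed:
  assumes "CMon N" "\<omega> \<in> carrier (Omega_obj N)" "z \<in> topspace circle"
  shows "\<omega> z \<in> carrier N"
  using assms CMonD(2)[OF assms(1)] by (auto simp: carrier_Omega continuous_map_def)

lemma continuous_map_into_Omega:
  assumes "chaus C"
  shows "continuous_map C (mtop (Omega_obj N)) \<phi> \<longleftrightarrow>
    (\<forall>c \<in> topspace C. \<phi> c \<in> extensional (topspace circle) \<and> \<phi> c 1 = \<one>\<^bsub>N\<^esub>) \<and>
    continuous_map (prod_topology C circle) (mtop N) (\<lambda>(c, x). \<phi> c x)"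
  unfolding mtop_Omega by (rule continuous_map_into_based_k_fun[OF assms test_k_space_circle])

lemma continuous_map_Omega_eval:
  assumes "chaus E" "continuous_map E (mtop (Omega_obj N)) \<phi>" "continuous_map E circle x"
  shows "continuous_map E (mtop N) (\<lambda>e. \<phi> e (x e))"
  using assms continuous_map_eval[of E circle "mtop N" \<phi> x] by (simp add: continuous_map_into_Omega)

lemma one_in_circle [simp]: "1 \<in> topspace circle"
  by (simp add: topspace_circle)

text \<open>The axioms hold pointwise. For continuity, the exponential law adjoins the circle
  variable to a pair of test spaces, and the claim becomes continuity of a pointwise product in
  \<open>N\<close> on a compact Hausdorff space.\<close>

lemma CMon_Omega:
  fixes N :: "'a top_monoid"
  assumes N: "CMon N" shows "CMon (Omega_obj N)"
  unfolding CMon_def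
proof (intro conjI)
  interpret comm_monoid N using CMonD(1)[OF N] .
  note cl = Omega_closed[OF N]
  show "comm_monoid (Omega_obj N)"
  proof (rule comm_monoidI)
    fix x y assume *: "x \<in> carrier (Omega_obj N)" "y \<in> carrier (Omega_obj N)"
    then have "continuous_map circle (mtop N) (\<lambda>z. x z \<otimes>\<^bsub>N\<^esub> y z)"
      by (intro continuous_map_CMon_mult[OF N chaus_circle]) (auto simp: carrier_Omega)
    then have "continuous_map circle (mtop N) (\<lambda>z\<in>topspace circle. x z \<otimes>\<^bsub>N\<^esub> y z)"
      by (rule continuous_map_eq) simp
    then show "x \<otimes>\<^bsub>Omega_obj N\<^esub> y \<in> carrier (Omega_obj N)"
      using * by (auto simp: carrier_Omega mult_Omega)
    show "x \<otimes>\<^bsub>Omega_obj N\<^esub> y = y \<otimes>\<^bsub>Omega_obj N\<^esub> x"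
      using * cl by (auto simp: mult_Omega m_comm intro!: restrict_ext)
    fix z assume "z \<in> carrier (Omega_obj N)"
    then show "x \<otimes>\<^bsub>Omega_obj N\<^esub> y \<otimes>\<^bsub>Omega_obj N\<^esub> z = x \<otimes>\<^bsub>Omega_obj N\<^esub> (y \<otimes>\<^bsub>Omega_obj N\<^esub> z)"
      using * cl by (auto simp: mult_Omega m_assoc intro!: restrict_ext)
  next
    have "continuous_map circle (mtop N) (\<lambda>z. \<one>\<^bsub>N\<^esub>)" using CMonD(2)[OF N] by simp
    then have "continuous_map circle (mtop N) (\<lambda>z\<in>topspace circle. \<one>\<^bsub>N\<^esub>)"
      by (rule continuous_map_eq) simp
    then show "\<one>\<^bsub>Omega_obj N\<^esub> \<in> carrier (Omega_obj N)"
      by (auto simp: carrier_Omega one_Omega)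
  next
    fix x assume "x \<in> carrier (Omega_obj N)"
    then show "\<one>\<^bsub>Omega_obj N\<^esub> \<otimes>\<^bsub>Omega_obj N\<^esub> x = x"
      using cl by (auto simp: mult_Omega one_Omega carrier_Omega intro!: extensionalityI[of _ "topspace circle"])
  qed
  show "topspace (mtop (Omega_obj N)) = carrier (Omega_obj N)" by (rule topspace_Omega)
  show k: "test_k_space (mtop (Omega_obj N))"
    by (simp add: mtop_Omega test_k_space_based_k_fun)
  show "continuous_map (k_prod (mtop (Omega_obj N)) (mtop (Omega_obj N))) (mtop (Omega_obj N))
     (\<lambda>(x, y). x \<otimes>\<^bsub>Omega_obj N\<^esub> y)"
  proof (rule continuous_map_k_prod_probes[OF probes_test_k_space[OF k] probes_test_k_space[OF k]])
    fix D1 D2 :: "(complex \<Rightarrow> 'a) test_point topology" and q1 q2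
    assume "(D1, q1) \<in> {(D, q). test_map D (mtop (Omega_obj N)) q}"
      "(D2, q2) \<in> {(D, q). test_map D (mtop (Omega_obj N)) q}"
    then have D: "chaus D1" "chaus D2" and q: "continuous_map D1 (mtop (Omega_obj N)) q1" "continuous_map D2 (mtop (Omega_obj N)) q2"
      by (auto simp: test_map_iff)
    let ?E = "prod_topology (prod_topology D1 D2) circle"
    have E: "chaus ?E" using D chaus_circle by (simp add: chaus_prod)
    have q': "continuous_map ?E (mtop (Omega_obj N)) (\<lambda>e. q1 (fst (fst e)))"
      "continuous_map ?E (mtop (Omega_obj N)) (\<lambda>e. q2 (snd (fst e)))"
      using continuous_map_compose[OF continuous_map_compose[OF continuous_map_fst continuous_map_fst] q(1)]
        continuous_map_compose[OF continuous_map_compose[OF continuous_map_fst continuous_map_snd] q(2)]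
      by (simp_all add: o_def)
    have "continuous_map ?E (mtop N) (\<lambda>e. q1 (fst (fst e)) (snd e) \<otimes>\<^bsub>N\<^esub> q2 (snd (fst e)) (snd e))"
      by (rule continuous_map_CMon_mult[OF N E continuous_map_Omega_eval[OF E q'(1) continuous_map_snd]
            continuous_map_Omega_eval[OF E q'(2) continuous_map_snd]])
    then have "continuous_map ?E (mtop N) (\<lambda>(c, x). (q1 (fst c) \<otimes>\<^bsub>Omega_obj N\<^esub> q2 (snd c)) x)"
      by (rule continuous_map_eq) (auto simp: mult_Omega)
    moreover have "q1 (fst c) 1 = \<one>\<^bsub>N\<^esub>" "q2 (snd c) 1 = \<one>\<^bsub>N\<^esub>" if "c \<in> topspace (prod_topology D1 D2)" for c
      using that q by (auto simp: continuous_map_into_Omega[OF D(1)] continuous_map_into_Omega[OF D(2)])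
    ultimately have "continuous_map (prod_topology D1 D2) (mtop (Omega_obj N)) (\<lambda>c. q1 (fst c) \<otimes>\<^bsub>Omega_obj N\<^esub> q2 (snd c))"
      unfolding continuous_map_into_Omega[OF chaus_prod[OF D]] by (auto simp: mult_Omega restrict_def extensional_def)
    then show "continuous_map (prod_topology D1 D2) (mtop (Omega_obj N))
            (\<lambda>(d, e). case (q1 d, q2 e) of (x, y) \<Rightarrow> x \<otimes>\<^bsub>Omega_obj N\<^esub> y)"
      by (simp add: case_prod_unfold)
  qed
qed

lemma Omega_map_apply:
  "\<omega> \<in> carrier (Omega_obj N) \<Longrightarrow> Omega_map N N' g \<omega> = (\<lambda>z\<in>topspace circle. g (\<omega> z))"
  by (simp add: Omega_map_def)

lemma Omega_map_closed:
  assumes "g \<in> CMon_hom N N'" "\<omega> \<in> carrier (Omega_obj N)"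
  shows "Omega_map N N' g \<omega> \<in> carrier (Omega_obj N')"
proof -
  have "continuous_map circle (mtop N') (\<lambda>z. g (\<omega> z))"
    using assms by (intro continuous_map_CMon_hom[OF assms(1)]) (auto simp: carrier_Omega)
  then have "continuous_map circle (mtop N') (\<lambda>z\<in>topspace circle. g (\<omega> z))"
    by (rule continuous_map_eq) simp
  then show ?thesis
    using assms by (simp add: Omega_map_apply) (simp add: carrier_Omega CMon_homD(4)[OF assms(1)])
qed

text \<open>Passing to a probe \<open>q\<close> and applying the exponential law leaves the double
  evaluation \<open>\<phi> c (q d z)\<close> on the compact Hausdorff space formed by
  \<open>C\<close>, \<open>D\<close> and the circle.\<close>

lemma continuous_map_Omega_map_param:
  fixes N :: "'a top_monoid"
  assumes N: "CMon N" and C: "chaus C" and \<phi>: "continuous_map C (CMon_space N N') \<phi>"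
  shows "continuous_map (prod_topology C (mtop (Omega_obj N))) (mtop (Omega_obj N')) (\<lambda>(c, \<omega>). Omega_map N N' (\<phi> c) \<omega>)"
proof (rule continuous_map_prod_probes[OF C probes_test_k_space[OF CMonD(3)[OF CMon_Omega[OF N]]]])
  fix D :: "(complex \<Rightarrow> 'a) test_point topology" and q
  assume "(D, q) \<in> {(D, q). test_map D (mtop (Omega_obj N)) q}"
  then have D: "chaus D" and q: "continuous_map D (mtop (Omega_obj N)) q" by (auto simp: test_map_iff)
  have qc: "q d \<in> carrier (Omega_obj N)" if "d \<in> topspace D" for d
    using q that topspace_Omega[of N] by (auto simp: continuous_map_def)
  have \<phi>c: "\<phi> c \<in> CMon_hom N N'" if "c \<in> topspace C" for c
    using \<phi> that by (simp add: continuous_map_into_CMon_space[OF C CMonD(3)[OF N]])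
  let ?E = "prod_topology (prod_topology C D) circle"
  have E: "chaus ?E" using C D chaus_circle by (simp add: chaus_prod)
  have p: "continuous_map ?E (CMon_space N N') (\<lambda>e. \<phi> (fst (fst e)))"
    "continuous_map ?E (mtop (Omega_obj N)) (\<lambda>e. q (snd (fst e)))"
      using continuous_map_compose[OF continuous_map_compose[OF continuous_map_fst continuous_map_fst] \<phi>]
        continuous_map_compose[OF continuous_map_compose[OF continuous_map_fst continuous_map_snd] q]
      by (simp_all add: o_def)
  have "continuous_map ?E (mtop N') (\<lambda>e. \<phi> (fst (fst e)) (q (snd (fst e)) (snd e)))"
    by (rule continuous_map_CMon_eval[OF E CMonD(3)[OF N] p(1) continuous_map_Omega_eval[OF E p(2) continuous_map_snd]])
  then have "continuous_map ?E (mtop N') (\<lambda>(c, z). Omega_map N N' (\<phi> (fst c)) (q (snd c)) z)"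
    by (rule continuous_map_eq) (auto simp: Omega_map_apply qc)
  moreover have "Omega_map N N' (\<phi> (fst c)) (q (snd c)) \<in> carrier (Omega_obj N')"
    if "c \<in> topspace (prod_topology C D)" for c
    using that qc \<phi>c by (auto intro: Omega_map_closed)
  ultimately have "continuous_map (prod_topology C D) (mtop (Omega_obj N')) (\<lambda>c. Omega_map N N' (\<phi> (fst c)) (q (snd c)))"
    unfolding continuous_map_into_Omega[OF chaus_prod[OF C D]] by (simp add: carrier_Omega)
  then show "continuous_map (prod_topology C D) (mtop (Omega_obj N'))
       (\<lambda>(c, d). case (c, q d) of (c, \<omega>) \<Rightarrow> Omega_map N N' (\<phi> c) \<omega>)"
    by (simp add: case_prod_unfold)
qed

text \<open>A single map is a family over a point; this specializes the parametrized continuity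
  lemmas to individual homomorphisms.\<close>

lemma continuous_map_point_param:
  assumes "continuous_map (prod_topology (discrete_topology {()}) X) Y (\<lambda>(c, x). f x)"
  shows "continuous_map X Y f"
proof -
  have "continuous_map X (prod_topology (discrete_topology {()}) X) (\<lambda>x. ((), x))"
    by (simp add: continuous_map_pairedI)
  from continuous_map_compose[OF this assms] show ?thesis by (simp add: o_def)
qed

lemma continuous_map_const_CMon_space:
  "f \<in> CMon_hom M N \<Longrightarrow> continuous_map C (CMon_space M N) (\<lambda>_. f)"
  by (simp add: topspace_CMon_space)

lemma Omega_map_hom:
  assumes N: "CMon N" and N': "CMon N'" and g: "g \<in> CMon_hom N N'"
  shows "Omega_map N N' g \<in> CMon_hom (Omega_obj N) (Omega_obj N')"
proof -
  have "continuous_map (mtop (Omega_obj N)) (mtop (Omega_obj N')) (Omega_map N N' g)"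
    by (rule continuous_map_point_param[OF continuous_map_Omega_map_param[OF N chaus_point continuous_map_const_CMon_space[OF g]]])
  moreover have "Omega_map N N' g (x \<otimes>\<^bsub>Omega_obj N\<^esub> y) = Omega_map N N' g x \<otimes>\<^bsub>Omega_obj N'\<^esub> Omega_map N N' g y"
    if "x \<in> carrier (Omega_obj N)" "y \<in> carrier (Omega_obj N)" for x y
  proof -
    have "x \<otimes>\<^bsub>Omega_obj N\<^esub> y \<in> carrier (Omega_obj N)"
      using that CMonD(1)[OF CMon_Omega[OF N]] by (simp add: comm_monoid_def monoid.m_closed)
    then show ?thesis
      using that hom_mult[OF CMon_homD(3)[OF g]] Omega_closed[OF N]
      by (auto simp: Omega_map_apply mult_Omega intro!: restrict_ext)
  qed
  moreover have "\<one>\<^bsub>Omega_obj N\<^esub> \<in> carrier (Omega_obj N)"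
    using CMonD(1)[OF CMon_Omega[OF N]] by (simp add: comm_monoid_def monoid.one_closed)
  then have "Omega_map N N' g \<one>\<^bsub>Omega_obj N\<^esub> = \<one>\<^bsub>Omega_obj N'\<^esub>"
    by (auto simp: Omega_map_apply one_Omega CMon_homD(4)[OF g] intro!: restrict_ext)
  ultimately show ?thesis
    using Omega_map_closed[OF g]
    by (auto simp: CMon_hom_def cmaps_def hom_def topspace_Omega) (simp add: Omega_map_def)
qed

lemma continuous_map_Omega_map:
  assumes N: "CMon N" and N': "CMon N'"
  shows "continuous_map (CMon_space N N') (CMon_space (Omega_obj N) (Omega_obj N')) (Omega_map N N')"
  using continuous_map_Omega_map_param[OF N] Omega_map_hom[OF N N'] CMonD(3)[OF N] CMonD(3)[OF CMon_Omega[OF N]]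
  by (intro continuous_map_CMon_spaces)

lemma Omega_map_id: "CMon N \<Longrightarrow> Omega_map N N (CMon_id N) = CMon_id (Omega_obj N)"
  unfolding Omega_map_def CMon_id_def
  by (intro restrict_ext extensionalityI[of _ "topspace circle"]) (auto simp: Omega_closed carrier_Omega)

lemma Omega_map_const: "CMon N \<Longrightarrow> Omega_map N N' (CMon_const N N') = CMon_const (Omega_obj N) (Omega_obj N')"
  unfolding Omega_map_def CMon_const_def one_Omega
  by (intro restrict_ext) (auto simp: Omega_closed)

lemma Omega_map_compose:
  assumes "CMon N" "g \<in> CMon_hom N N'"
  shows "Omega_map N N'' (compose (carrier N) g' g) =
    compose (carrier (Omega_obj N)) (Omega_map N' N'' g') (Omega_map N N' g)"
  unfolding compose_def Omega_map_def[of N N'']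
proof (intro restrict_ext)
  fix \<omega> assume \<omega>: "\<omega> \<in> carrier (Omega_obj N)"
  then show "(\<lambda>z\<in>topspace circle. (\<lambda>x\<in>carrier N. g' (g x)) (\<omega> z)) = Omega_map N' N'' g' (Omega_map N N' g \<omega>)"
    using Omega_map_closed[OF assms(2) \<omega>] Omega_closed[OF assms(1) \<omega>]
    by (auto simp: Omega_map_apply intro!: restrict_ext)
qed

section \<open>Points of the bar construction as labelled configurations\<close>

text \<open>The vertices of a simplex correspond to the monotone sequences of partial sums in the unit interval.\<close>

definition knot :: "(nat \<Rightarrow> real) \<Rightarrow> nat \<Rightarrow> real" where
  "knot t j = (\<Sum>k\<le>j. t k)"

lemma knot_0: "knot t 0 = t 0" and knot_Suc: "knot t (Suc j) = knot t j + t (Suc j)"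
  by (simp_all add: knot_def)

text \<open>In partial sums, inserting a zero coordinate repeats the preceding knot, or puts 0 in
  front if \<open>i = 0\<close>. The repeated knots \<open>i - 1\<close> and \<open>i\<close> carry
  exactly the two labels that the inner face multiplies.\<close>

lemma knot_simplical_face:
  "knot (simplical_face i t) j = (if j < i then knot t j else if j = 0 then 0 else knot t (j - 1))"
proof (induction j)
  case (Suc j)
  then show ?case by (cases j) (auto simp: simplical_face_def knot_0 knot_Suc)
qed (simp add: simplical_face_def knot_0)

text \<open>In partial sums, adding coordinates \<open>i\<close> and \<open>i + 1\<close> deletes
  knot \<open>i\<close>, which is the position at which \<open>bar_degen\<close> inserts the
  unit.\<close>

lemma knot_simplical_degen:
  "knot (simplical_degen i t) j = (if j < i then knot t j else knot t (Suc j))"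
  by (induction j) (auto simp: simplical_degen_def less_Suc_eq knot_0 knot_Suc)

lemma in_standard_simplex_iff:
  "t \<in> standard_simplex n \<longleftrightarrow> (\<forall>i. 0 \<le> t i) \<and> (\<forall>i>n. t i = 0) \<and> knot t n = 1"
proof -
  have "t i \<le> 1" if "\<forall>i. 0 \<le> t i" "\<forall>i>n. t i = 0" "knot t n = 1" for i
  proof (cases "i \<le> n")
    case True
    then have "t i \<le> (\<Sum>k\<le>n. t k)" using that(1) by (intro member_le_sum) auto
    then show ?thesis using that(3) by (simp add: knot_def)
  qed (use that in simp)
  then show ?thesis by (auto simp: standard_simplex_def knot_def)
qed

lemma knot_mono: "\<forall>i. 0 \<le> t i \<Longrightarrow> i \<le> j \<Longrightarrow> knot t i \<le> knot t j"
  unfolding knot_def by (intro sum_mono2) auto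

lemma knot_eq_1: "t \<in> standard_simplex n \<Longrightarrow> n \<le> j \<Longrightarrow> knot t j = 1"
proof (induction j)
  case (Suc j)
  then show ?case by (cases "n \<le> j") (auto simp: in_standard_simplex_iff le_Suc_eq knot_Suc)
qed (auto simp: in_standard_simplex_iff)

lemma knot_bounds:
  assumes "t \<in> standard_simplex n"
  shows "0 \<le> knot t j" "knot t j \<le> 1"
proof -
  show "0 \<le> knot t j" using assms by (auto simp: knot_def in_standard_simplex_iff intro: sum_nonneg)
  \<comment> \<open>The index \<open>j + n\<close> is at least \<open>n\<close>, where the partial
    sums have reached 1.\<close>
  have "knot t j \<le> knot t (j + n)" using assms by (intro knot_mono) (auto simp: in_standard_simplex_iff)
  then show "knot t j \<le> 1" using knot_eq_1[OF assms] by simp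
qed

lemma knot_inject: "(\<And>j. knot t j = knot t' j) \<Longrightarrow> t = t'"
proof
  fix j assume *: "\<And>j. knot t j = knot t' j"
  show "t j = t' j"
    using *[of j] *[of "j - 1"] by (cases j) (auto simp: knot_0 knot_Suc)
qed

text \<open>The inverse of taking partial sums: differences of neighbouring terms of
  \<open>v 0, ..., v (n - 1)\<close>, with 0 put in front and 1 at position \<open>n\<close>. Only
  \<open>n\<close> knots are free because knot \<open>n\<close> of a point of the simplex is always
  1.\<close>

definition simplex_of_knots :: "nat \<Rightarrow> (nat \<Rightarrow> real) \<Rightarrow> nat \<Rightarrow> real" where
  "simplex_of_knots n v j =
    (if j > n then 0 else (if j < n then v j else 1) - (if j = 0 then 0 else v (j - 1)))"

lemma knot_simplex_of_knots: "j \<le> n \<Longrightarrow> knot (simplex_of_knots n v) j = (if j < n then v j else 1)"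
  by (induction j) (auto simp: simplex_of_knots_def knot_0 knot_Suc)

lemma simplex_of_knots_in_simplex:
  assumes "\<And>j. j < n \<Longrightarrow> 0 \<le> v j \<and> v j \<le> 1" "\<And>i j. i \<le> j \<Longrightarrow> j < n \<Longrightarrow> v i \<le> v j"
  shows "simplex_of_knots n v \<in> standard_simplex n"
proof -
  have "0 \<le> simplex_of_knots n v j" for j
    using assms(1)[of j] assms(1)[of "j - 1"] assms(2)[of "j - 1" j] by (auto simp: simplex_of_knots_def)
  moreover have "knot (simplex_of_knots n v) n = 1" by (simp add: knot_simplex_of_knots)
  ultimately show ?thesis by (auto simp: in_standard_simplex_iff) (simp add: simplex_of_knots_def)
qed

text \<open>Both sequences are the sorted list without repetitions of one finite set. This recovers
  positions from the support of a configuration.\<close>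

lemma strict_mono_image_unique:
  fixes u v :: "nat \<Rightarrow> real"
  assumes u: "\<And>i j. i < j \<Longrightarrow> j < n \<Longrightarrow> u i < u j" and v: "\<And>i j. i < j \<Longrightarrow> j < m \<Longrightarrow> v i < v j"
    and im: "u ` {..<n} = v ` {..<m}"
  shows "n = m" "j < n \<Longrightarrow> u j = v j"
proof -
  have s: "sorted (map w [0..<k]) \<and> distinct (map w [0..<k])"
    if "\<And>i j. i < j \<Longrightarrow> j < k \<Longrightarrow> w i < w j" for w :: "nat \<Rightarrow> real" and k
  proof -
    have "inj_on w {..<k}" using that by (auto intro!: linorder_inj_onI) force
    then have "inj_on w {0..<k}" by (simp add: lessThan_atLeast0)
    moreover have "w i \<le> w j" if "i \<le> j" "j < k" for i j
      using \<open>\<And>i j. i < j \<Longrightarrow> j < k \<Longrightarrow> w i < w j\<close>[of i j] that by (cases "i = j") auto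
    ultimately show ?thesis by (auto simp: distinct_map sorted_iff_nth_mono)
  qed
  have "set (map u [0..<n]) = set (map v [0..<m])" using im by (simp add: lessThan_atLeast0)
  then have eq: "map u [0..<n] = map v [0..<m]"
    using s[of n u] s[of m v] u v by (intro sorted_distinct_set_unique) auto
  show "n = m" using arg_cong[OF eq, of length] by simp
  then show "u j = v j" if "j < n" using arg_cong[OF eq, of "\<lambda>l. l ! j"] that by simp
qed

text \<open>For coinciding values several permutations qualify; that the choice does not affect the
  configuration is \<open>config_permute\<close>.\<close>

lemma sorting_permutation:
  fixes u :: "nat \<Rightarrow> real"
  shows "\<exists>\<sigma>. \<sigma> permutes {..<n} \<and> (\<forall>i j. i \<le> j \<longrightarrow> j < n \<longrightarrow> u (\<sigma> i) \<le> u (\<sigma> j))"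
proof -
  let ?l = "map u [0..<n]"
  have "mset (sort ?l) = mset ?l" by simp
  then obtain \<sigma> where \<sigma>: "\<sigma> permutes {..<length ?l}" "permute_list \<sigma> ?l = sort ?l"
    by (rule mset_eq_permutation)
  have "u (\<sigma> i) \<le> u (\<sigma> j)" if "i \<le> j" "j < n" for i j
  proof -
    have nth: "permute_list \<sigma> ?l ! k = u (\<sigma> k)" if "k < n" for k
      using \<sigma>(1) that permutes_in_image[OF \<sigma>(1), of k] by (simp add: permute_list_nth)
    have "sort ?l ! i \<le> sort ?l ! j" using that by (intro sorted_nth_mono) auto
    then show ?thesis using that nth \<sigma>(2) by (metis order_le_less_trans)
  qed
  with \<sigma>(1) show ?thesis by (intro exI[of _ \<sigma>]) auto
qed

text \<open>
  Entries at the end points of the unit interval are ignored because the outer faces drop them;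
  coinciding entries are multiplied because the inner faces do so.
\<close>

definition config :: "'a top_monoid \<Rightarrow> nat \<Rightarrow> (nat \<Rightarrow> 'a) \<Rightarrow> (nat \<Rightarrow> real) \<Rightarrow> real \<Rightarrow> 'a" where
  "config M n x u r =
    (if 0 < r \<and> r < 1 then finprod M (\<lambda>i. if u i = r then x i else \<one>\<^bsub>M\<^esub>) {..<n} else \<one>\<^bsub>M\<^esub>)"

text \<open>Total functions on the reals with the unit forced outside the open interval, so that
  equality of configurations is plain equality of functions.\<close>

definition config_set :: "'a top_monoid \<Rightarrow> (real \<Rightarrow> 'a) set" where
  "config_set M = {\<phi>. (\<forall>r. \<phi> r \<in> carrier M) \<and> (\<forall>r. \<not> (0 < r \<and> r < 1) \<longrightarrow> \<phi> r = \<one>\<^bsub>M\<^esub>) \<and>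
     finite {r. \<phi> r \<noteq> \<one>\<^bsub>M\<^esub>}}"

definition point_config :: "'a top_monoid \<Rightarrow> nat \<times> (nat \<Rightarrow> 'a) \<times> (nat \<Rightarrow> real) \<Rightarrow> real \<Rightarrow> 'a" where
  "point_config M = (\<lambda>(n, x, t). config M n x (knot t))"

abbreviation bar_points :: "'a top_monoid \<Rightarrow> (nat \<times> (nat \<Rightarrow> 'a) \<times> (nat \<Rightarrow> real)) set" where
  "bar_points M \<equiv> topspace (prerealization (\<lambda>n. k_power n (mtop M)))"

abbreviation bar_gen :: "'a top_monoid \<Rightarrow> (nat \<times> (nat \<Rightarrow> 'a) \<times> (nat \<Rightarrow> real)) rel" where
  "bar_gen M \<equiv> realization_gen (\<lambda>n. k_power n (mtop M)) (bar_face M) (bar_degen M)"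

abbreviation bar_rel :: "'a top_monoid \<Rightarrow> (nat \<times> (nat \<Rightarrow> 'a) \<times> (nat \<Rightarrow> real)) rel" where
  "bar_rel M \<equiv> realization_rel (\<lambda>n. k_power n (mtop M)) (bar_face M) (bar_degen M)"

text \<open>All representatives of a class have the same configuration, so the choice is immaterial;
  see \<open>config_of_B_class\<close>.\<close>

definition config_of :: "'a top_monoid \<Rightarrow> 'a bar_point \<Rightarrow> real \<Rightarrow> 'a" where
  "config_of M w = point_config M (SOME p. p \<in> w)"

definition B_pt :: "'a top_monoid \<Rightarrow> (real \<Rightarrow> 'a) \<Rightarrow> 'a bar_point" where
  "B_pt M = inv_into (topspace (B_space M)) (config_of M)"

text \<open>What the bookkeeping with bar points refers to: the algebra and the underlying set of
  the space. The product monoid that occurs in \<open>B_pair\<close> is placed in this locale by an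
  algebraic check in \<open>pre_CMon_prod\<close>.\<close>

locale pre_CMon = comm_monoid M for M :: "'a top_monoid" (structure) +
  assumes topspace_mtop: "topspace (mtop M) = carrier M"

lemma CMon_imp_pre_CMon: "CMon M \<Longrightarrow> pre_CMon M"
  by (simp add: pre_CMon_def pre_CMon_axioms_def CMon_def)

section \<open>Finite products behind the face and degeneracy relations\<close>

context comm_monoid
begin

text \<open>This identity serves the inner faces, and the next two serve the zeroth face and the
  degeneracies. They are applied with \<open>g j\<close> the label \<open>j\<close> if it sits at a
  fixed position \<open>r\<close> and the unit otherwise.\<close>

lemma finprod_merge:
  assumes "i \<le> m" "0 < i" "\<And>j. j \<le> m \<Longrightarrow> g j \<in> carrier G"
  shows "(\<Otimes>j\<in>{..<m}. if Suc j < i then g j else if Suc j = i then g j \<otimes> g (Suc j) else g (Suc j))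
    = (\<Otimes>j\<in>{..<Suc m}. g j)"
  using assms
proof (induction m)
  case (Suc m)
  let ?h = "\<lambda>j. if Suc j < i then g j else if Suc j = i then g j \<otimes> g (Suc j) else g (Suc j)"
  have hc: "?h \<in> {..<Suc m} \<rightarrow> carrier G" and gc: "g \<in> {..<Suc (Suc m)} \<rightarrow> carrier G"
    using Suc.prems by auto
  show ?case
  proof (cases "i = Suc m")
    case True
    have "finprod G ?h {..<Suc m} = ?h m \<otimes> finprod G ?h {..<m}"
      using hc by (simp add: lessThan_Suc Pi_iff)
    also have "finprod G ?h {..<m} = finprod G g {..<m}"
      using True gc by (intro finprod_cong') auto
    finally show ?thesis
      using True gc by (simp add: lessThan_Suc Pi_iff m_assoc m_lcomm m_comm)
  next
    case False
    then have i: "i \<le> m" using Suc.prems by auto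
    have "finprod G ?h {..<Suc m} = ?h m \<otimes> finprod G ?h {..<m}"
      using hc by (simp add: lessThan_Suc Pi_iff)
    also have "finprod G ?h {..<m} = finprod G g {..<Suc m}"
      using Suc.IH[OF i Suc.prems(2)] Suc.prems(3) by simp
    also have "?h m = g (Suc m)" using i by simp
    finally show ?thesis
      using gc by (simp add: lessThan_Suc[of "Suc m"] Pi_iff)
  qed
qed simp

lemma finprod_drop_first:
  assumes "g 0 = \<one>" "\<And>j. j \<le> m \<Longrightarrow> g j \<in> carrier G"
  shows "(\<Otimes>j\<in>{..<m}. g (Suc j)) = (\<Otimes>j\<in>{..<Suc m}. g j)"
  using assms by (induction m) (simp_all add: lessThan_Suc Pi_iff)

lemma finprod_insert_one:
  assumes "i \<le> m" "\<And>j. j < m \<Longrightarrow> g j \<in> carrier G"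
  shows "(\<Otimes>j\<in>{..<Suc m}. if j < i then g j else if j = i then \<one> else g (j - 1)) = (\<Otimes>j\<in>{..<m}. g j)"
  using assms
proof (induction m)
  case (Suc m)
  let ?h = "\<lambda>j. if j < i then g j else if j = i then \<one> else g (j - 1)"
  have hc: "?h \<in> {..<Suc (Suc m)} \<rightarrow> carrier G" and gc: "g \<in> {..<Suc m} \<rightarrow> carrier G"
    using Suc.prems by auto
  show ?case
  proof (cases "i = Suc m")
    case True
    have "finprod G ?h {..<Suc (Suc m)} = ?h (Suc m) \<otimes> finprod G ?h {..<Suc m}"
      using hc by (simp add: lessThan_Suc[of "Suc m"] Pi_iff)
    also have "finprod G ?h {..<Suc m} = finprod G g {..<Suc m}"
      using True gc by (intro finprod_cong') auto
    finally show ?thesis using True gc by simp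
  next
    case False
    then have i: "i \<le> m" using Suc.prems by auto
    have "finprod G ?h {..<Suc (Suc m)} = ?h (Suc m) \<otimes> finprod G ?h {..<Suc m}"
      using hc by (simp add: lessThan_Suc[of "Suc m"] Pi_iff)
    also have "finprod G ?h {..<Suc m} = finprod G g {..<m}"
      using Suc.IH[OF i] Suc.prems(2) by simp
    finally show ?thesis
      using i gc by (simp add: lessThan_Suc[of m] Pi_iff)
  qed
qed (auto intro!: finprod_one_eqI)

end

section \<open>Configurations as a complete invariant of bar points\<close>

context pre_CMon
begin

lemma bar_points_iff:
  "(n, x, t) \<in> bar_points M \<longleftrightarrow> x \<in> {..<n} \<rightarrow>\<^sub>E carrier M \<and> t \<in> standard_simplex n"
  by (simp add: prerealization_def k_prod_def k_power_def topspace_product_topology topspace_mtop simplex_topology_def)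

lemma topspace_k_power: "topspace (k_power n (mtop M)) = {..<n} \<rightarrow>\<^sub>E carrier M"
  by (simp add: k_power_def topspace_product_topology topspace_mtop)

lemma config_cong:
  assumes "\<And>i. i < n \<Longrightarrow> x i = y i" "\<And>i. i < n \<Longrightarrow> u i = v i" "\<And>i. i < n \<Longrightarrow> y i \<in> carrier M"
  shows "config M n x u = config M n y v"
  unfolding config_def using assms by (auto intro!: ext finprod_cong')

lemma config_in_config_set:
  assumes "\<And>i. i < n \<Longrightarrow> x i \<in> carrier M"
  shows "config M n x u \<in> config_set M"
proof -
  have "config M n x u r = \<one>" if "r \<notin> u ` {..<n}" for r
    using that by (auto simp: config_def intro!: finprod_one_eqI)
  then have "{r. config M n x u r \<noteq> \<one>} \<subseteq> u ` {..<n}" by auto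
  then have "finite {r. config M n x u r \<noteq> \<one>}" by (rule finite_subset) simp
  then show ?thesis using assms by (auto simp: config_set_def config_def)
qed

lemma point_config_in_config_set: "p \<in> bar_points M \<Longrightarrow> point_config M p \<in> config_set M"
  by (cases p) (auto simp: point_config_def bar_points_iff intro!: config_in_config_set)

text \<open>Reindexing a finite product, possible by commutativity. It is the reason why lists of
  labelled positions need not be sorted.\<close>

lemma config_permute:
  assumes "\<sigma> permutes {..<n}" "\<And>i. i < n \<Longrightarrow> x i \<in> carrier M"
  shows "config M n (x \<circ> \<sigma>) (u \<circ> \<sigma>) = config M n x u"
proof
  fix r
  let ?g = "\<lambda>i. if u i = r then x i else \<one>"
  have "finprod M ?g (\<sigma> ` {..<n}) = finprod M (\<lambda>i. ?g (\<sigma> i)) {..<n}"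
    using assms permutes_inj_on[OF assms(1)] permutes_image[OF assms(1)]
    by (intro finprod_reindex) auto
  then show "config M n (x \<circ> \<sigma>) (u \<circ> \<sigma>) r = config M n x u r"
    using permutes_image[OF assms(1)] by (simp add: config_def o_def)
qed

text \<open>For an inner face the coface makes two knots coincide, so their labels enter the value
  there as one product. For \<open>i = 0\<close> and \<open>i = n\<close> the label dropped by the
  face sits at 0 or 1, where configurations ignore labels.\<close>

lemma config_bar_face:
  assumes n: "1 \<le> n" "i \<le> n" and x: "\<And>j. j < n \<Longrightarrow> x j \<in> carrier M" and t: "t \<in> standard_simplex (n - 1)"
  shows "config M (n - 1) (bar_face M n i x) (knot t) = config M n x (knot (simplical_face i t))"
proof
  fix r
  obtain m where m: "n = Suc m" using n by (cases n) auto
  let ?u = "knot (simplical_face i t)"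
  let ?g = "\<lambda>j. if ?u j = r then x j else \<one>"
  have gc: "?g j \<in> carrier M" if "j \<le> m" for j using that x m by auto
  show "config M (n - 1) (bar_face M n i x) (knot t) r = config M n x ?u r"
  proof (cases "0 < r \<and> r < 1")
    case r: True
    have "finprod M (\<lambda>j. if knot t j = r then bar_face M n i x j else \<one>) {..<m} = finprod M ?g {..<Suc m}"
    proof -
      consider "i = 0" | "i = Suc m" | "0 < i" "i \<le> m" using n m by force
      then show ?thesis
      proof cases
        case 1
        then have "?g 0 = \<one>" using r by (auto simp: knot_simplical_face)
        from finprod_drop_first[of ?g, OF this gc]
        have "(\<Otimes>j\<in>{..<m}. ?g (Suc j)) = finprod M ?g {..<Suc m}" by simp
        moreover have "finprod M (\<lambda>j. if knot t j = r then bar_face M n i x j else \<one>) {..<m} = (\<Otimes>j\<in>{..<m}. ?g (Suc j))"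
          using 1 gc m x by (intro finprod_cong') (auto simp: knot_simplical_face bar_face_def)
        ultimately show ?thesis by simp
      next
        case 2
        \<comment> \<open>The last labelled knot, number \<open>m = n - 1\<close>, is the end point
          1.\<close>
        have "knot t m = 1" using knot_eq_1[OF t] m by simp
        then have "?g m = \<one>" using r 2 by (auto simp: knot_simplical_face)
        then have "finprod M ?g {..<Suc m} = finprod M ?g {..<m}"
          using gc by (simp add: lessThan_Suc Pi_iff)
        also have "\<dots> = finprod M (\<lambda>j. if knot t j = r then bar_face M n i x j else \<one>) {..<m}"
          using 2 gc m x by (intro finprod_cong') (auto simp: knot_simplical_face bar_face_def)
        finally show ?thesis by simp
      next
        case 3
        have "finprod M (\<lambda>j. if knot t j = r then bar_face M n i x j else \<one>) {..<m} =
          (\<Otimes>j\<in>{..<m}. if Suc j < i then ?g j else if Suc j = i then ?g j \<otimes> ?g (Suc j) else ?g (Suc j))"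
          using 3 m x by (intro finprod_cong') (auto simp: knot_simplical_face bar_face_def)
        also have "\<dots> = finprod M ?g {..<Suc m}" using 3 gc by (intro finprod_merge) auto
        finally show ?thesis .
      qed
    qed
    moreover have "n - 1 = m" using m by simp
    ultimately have "finprod M (\<lambda>j. if knot t j = r then bar_face M n i x j else \<one>) {..<n - 1} = finprod M ?g {..<n}"
      by (simp only: m)
    then show ?thesis using r by (simp only: config_def simp_thms if_True)
  qed (auto simp: config_def)
qed

lemma config_bar_degen:
  assumes n: "i \<le> n" and x: "\<And>j. j < n \<Longrightarrow> x j \<in> carrier M"
  shows "config M (n + 1) (bar_degen M n i x) (knot t) = config M n x (knot (simplical_degen i t))"
proof
  fix r
  let ?g = "\<lambda>j. if knot (simplical_degen i t) j = r then x j else \<one>"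
  have "(\<Otimes>j\<in>{..<Suc n}. if knot t j = r then bar_degen M n i x j else \<one>) =
     (\<Otimes>j\<in>{..<Suc n}. if j < i then ?g j else if j = i then \<one> else ?g (j - 1))"
    using n x by (intro finprod_cong') (auto simp: knot_simplical_degen bar_degen_def)
  also have "\<dots> = finprod M ?g {..<n}" using n x by (intro finprod_insert_one) auto
  finally show "config M (n + 1) (bar_degen M n i x) (knot t) r = config M n x (knot (simplical_degen i t)) r"
    by (simp add: config_def)
qed

lemma bar_gen_config:
  assumes "(p, q) \<in> bar_gen M" shows "point_config M p = point_config M q"
  using assms unfolding realization_gen_def
proof (elim UnE CollectE exE conjE)
  fix n i x t
  assume "(p, q) = ((n - 1, bar_face M n i x, t), n, x, simplical_face i t)" "1 \<le> n" "i \<le> n"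
    "x \<in> topspace (k_power n (mtop M))" "t \<in> standard_simplex (n - 1)"
  then show ?thesis using config_bar_face[of n i x t] by (auto simp: point_config_def topspace_k_power PiE_iff)
next
  fix n i x t
  assume "(p, q) = ((n + 1, bar_degen M n i x, t), n, x, simplical_degen i t)" "i \<le> n"
    "x \<in> topspace (k_power n (mtop M))"
  then show ?thesis
    using config_bar_degen[of i n x t] by (auto simp: point_config_def topspace_k_power PiE_iff)
qed

lemma bar_rtrancl_config:
  assumes "(p, q) \<in> (bar_gen M \<union> (bar_gen M)\<inverse>)\<^sup>*" shows "point_config M p = point_config M q"
  using assms by induction (auto dest: bar_gen_config)

text \<open>Normal form by descent on the dimension: a vanishing coordinate exhibits the point as a
  coface image, a unit label exhibits it as degenerate, and either generator lowers the dimension by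
  one.\<close>

lemma bar_reduce:
  assumes "(n, x, t) \<in> bar_points M"
  shows "\<exists>m y s. ((n, x, t), (m, y, s)) \<in> (bar_gen M \<union> (bar_gen M)\<inverse>)\<^sup>* \<and> (m, y, s) \<in> bar_points M \<and>
    (\<forall>i\<le>m. 0 < s i) \<and> (\<forall>i<m. y i \<noteq> \<one>)"
  using assms
proof (induction n arbitrary: x t)
  case 0
  then have "\<forall>i\<le>0. 0 < t i" by (auto simp: bar_points_iff in_standard_simplex_iff knot_0)
  then show ?case using 0 by blast
next
  case (Suc n)
  then have x: "x \<in> {..<Suc n} \<rightarrow>\<^sub>E carrier M" and t: "t \<in> standard_simplex (Suc n)"
    by (auto simp: bar_points_iff)
  have step: ?case
    if p: "((n, x', t'), (Suc n, x, t)) \<in> bar_gen M \<or> ((Suc n, x, t), (n, x', t')) \<in> bar_gen M"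
      and "(n, x', t') \<in> bar_points M" for x' t'
  proof -
    have "((Suc n, x, t), (n, x', t')) \<in> bar_gen M \<union> (bar_gen M)\<inverse>" using p by auto
    then show ?thesis using Suc.IH[OF that(2)] by (meson converse_rtrancl_into_rtrancl)
  qed
  consider (face) i where "i \<le> Suc n" "t i = 0" | (degen) i where "i \<le> n" "x i = \<one>"
    | (red) "\<forall>i\<le>Suc n. t i \<noteq> 0" "\<forall>i<Suc n. x i \<noteq> \<one>"
    by (auto simp: less_Suc_eq_le)
  then show ?case
  proof cases
    case face
    \<comment> \<open>Omits the vanishing coordinate \<open>i\<close>, which
      \<open>simplical_face i\<close> puts back.\<close>
    let ?t = "\<lambda>j. if j < i then t j else t (Suc j)"
    have ft: "simplical_face i ?t = t"
      using face(2) by (auto simp: simplical_face_def fun_eq_iff)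
    have "knot ?t n = 1"
      using knot_simplical_face[of i ?t "Suc n"] face t by (simp add: ft in_standard_simplex_iff)
    then have st: "?t \<in> standard_simplex n"
      using t face(1) by (auto simp: in_standard_simplex_iff)
    have "bar_face M (Suc n) i x \<in> {..<n} \<rightarrow>\<^sub>E carrier M"
      using x by (auto simp: bar_face_def PiE_iff)
    moreover have "((n, bar_face M (Suc n) i x, ?t), (Suc n, x, t)) \<in> bar_gen M"
      unfolding realization_gen_def
      using face(1) x st ft by (intro UnI1 CollectI exI[of _ "Suc n"] exI[of _ i] exI[of _ x] exI[of _ ?t])
        (simp add: topspace_k_power)
    ultimately show ?thesis using st by (intro step[OF disjI1]) (simp_all only: bar_points_iff simp_thms)
  next
    case degen
    \<comment> \<open>Omits the unit label \<open>i\<close>, which \<open>bar_degen\<close> puts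
      back.\<close>
    let ?x = "\<lambda>j\<in>{..<n}. if j < i then x j else x (Suc j)"
    have dx: "bar_degen M n i ?x = x"
    proof (rule extensionalityI[of _ "{..<Suc n}"])
      fix j assume "j \<in> {..<Suc n}"
      then show "bar_degen M n i ?x j = x j" using degen by (auto simp: bar_degen_def)
    qed (use x in \<open>auto simp: bar_degen_def PiE_iff\<close>)
    have xc: "?x \<in> {..<n} \<rightarrow>\<^sub>E carrier M" using x degen by (auto simp: PiE_iff)
    have "knot (simplical_degen i t) n = 1"
      using knot_simplical_degen[of i t n] degen t by (simp add: in_standard_simplex_iff)
    then have st: "simplical_degen i t \<in> standard_simplex n"
      using t degen(1) by (auto simp: in_standard_simplex_iff simplical_degen_def)
    have "((Suc n, x, t), (n, ?x, simplical_degen i t)) \<in> bar_gen M"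
      unfolding realization_gen_def
      using degen(1) xc t dx by (intro UnI2 CollectI exI[of _ n] exI[of _ i] exI[of _ ?x] exI[of _ t])
        (simp add: topspace_k_power)
    then show ?thesis using st xc by (intro step[OF disjI2]) (simp_all only: bar_points_iff simp_thms)
  next
    case red
    have "0 < t i" if "i \<le> Suc n" for i
      using red(1) that t order_le_less[of 0 "t i"] by (auto simp: in_standard_simplex_iff)
    with red Suc.prems show ?thesis by blast
  qed
qed

text \<open>Positive coordinates make the labelled knots strictly increasing inside (0,1), so no
  labels merge and none is ignored. Labels and positions can then be read off the
  configuration.\<close>

lemma reduced_config:
  assumes p: "(n, x, t) \<in> bar_points M" and t: "\<forall>i\<le>n. 0 < t i" and x: "\<forall>i<n. x i \<noteq> \<one>"
  shows "\<And>i j. i < j \<Longrightarrow> j < n \<Longrightarrow> knot t i < knot t j"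
    "j < n \<Longrightarrow> config M n x (knot t) (knot t j) = x j"
    "{r. config M n x (knot t) r \<noteq> \<one>} = knot t ` {..<n}"
proof -
  have xc: "x i \<in> carrier M" if "i < n" for i using p that by (auto simp: bar_points_iff)
  have st: "t \<in> standard_simplex n" using p by (simp add: bar_points_iff)
  have mono: "knot t i < knot t j" if "i < j" "j \<le> n" for i j
  proof -
    have "knot t i \<le> knot t (j - 1)" using that st by (intro knot_mono) (auto simp: in_standard_simplex_iff)
    also have "\<dots> < knot t j" using that t by (cases j) (auto simp: knot_Suc)
    finally show ?thesis .
  qed
  show "\<And>i j. i < j \<Longrightarrow> j < n \<Longrightarrow> knot t i < knot t j" using mono by simp
  have inj: "knot t i = knot t j \<longleftrightarrow> i = j" if "i < n" "j < n" for i j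
    using mono[of i j] mono[of j i] that by (cases i j rule: linorder_cases) auto
  have b: "0 < knot t j \<and> knot t j < 1" if "j < n" for j
  proof -
    have "t 0 \<le> knot t j" using knot_mono[of t 0 j] st by (auto simp: in_standard_simplex_iff knot_0)
    then show ?thesis using t mono[of j n] knot_eq_1[OF st, of n] that by force
  qed
  show c: "config M n x (knot t) (knot t j) = x j" if "j < n" for j
  proof -
    have "config M n x (knot t) (knot t j) = (\<Otimes>i\<in>{..<n}. if i = j then x i else \<one>)"
      using b[OF that] that inj xc by (auto simp: config_def intro!: finprod_cong')
    also have "\<dots> = x j" using that xc by (intro finprod_singleton_swap) auto
    finally show ?thesis .
  qed
  have "config M n x (knot t) r = \<one>" if "r \<notin> knot t ` {..<n}" for r
    using that by (auto simp: config_def intro!: finprod_one_eqI)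
  then show "{r. config M n x (knot t) r \<noteq> \<one>} = knot t ` {..<n}"
    using c x by auto
qed

lemma reduced_unique:
  assumes p: "(n, x, t) \<in> bar_points M" "\<forall>i\<le>n. 0 < t i" "\<forall>i<n. x i \<noteq> \<one>"
    and q: "(m, y, s) \<in> bar_points M" "\<forall>i\<le>m. 0 < s i" "\<forall>i<m. y i \<noteq> \<one>"
    and eq: "point_config M (n, x, t) = point_config M (m, y, s)"
  shows "(n, x, t) = (m, y, s)"
proof -
  note P = reduced_config[OF p] and Q = reduced_config[OF q]
  have eq': "config M n x (knot t) = config M m y (knot s)" using eq by (simp add: point_config_def)
  \<comment> \<open>Both sides are the support of the common configuration.\<close>
  have im: "knot t ` {..<n} = knot s ` {..<m}" using P(3) Q(3) eq' by simp
  have n: "n = m"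
    by (rule strict_mono_image_unique(1)[where u = "knot t" and v = "knot s"]) (use P(1) Q(1) im in auto)
  have k: "knot t j = knot s j" if "j < n" for j
    by (rule strict_mono_image_unique(2)[where n = n and m = m]) (use P(1) Q(1) im that in auto)
  have "knot t j = knot s j" for j
    using k[of j] knot_eq_1[of t n j] knot_eq_1[of s m j] p(1) q(1) n
    by (cases "j < n") (auto simp: bar_points_iff)
  then have "t = s" by (rule knot_inject)
  moreover have "x = y"
  proof (rule extensionalityI[of _ "{..<n}"])
    fix j assume "j \<in> {..<n}"
    then show "x j = y j" using P(2)[of j] Q(2)[of j] eq' k[of j] n by simp
  qed (use p(1) q(1) n in \<open>auto simp: bar_points_iff PiE_iff\<close>)
  ultimately show ?thesis using n by simp
qed

text \<open>The generators preserve the configuration, and normal forms with equal configurations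
  are equal. From here on the generated equivalence relation enters only through this
  criterion.\<close>

lemma bar_rel_iff:
  "(p, q) \<in> bar_rel M \<longleftrightarrow> p \<in> bar_points M \<and> q \<in> bar_points M \<and> point_config M p = point_config M q"
proof -
  let ?R = "(bar_gen M \<union> (bar_gen M)\<inverse>)\<^sup>*"
  have "(p, q) \<in> ?R" if pq: "p \<in> bar_points M" "q \<in> bar_points M" "point_config M p = point_config M q"
  proof -
    obtain n x t m y s where pe: "p = (n, x, t)" and qe: "q = (m, y, s)" by (cases p, cases q) auto
    obtain n' x' t' where P: "(p, (n', x', t')) \<in> ?R" "(n', x', t') \<in> bar_points M"
      "\<forall>i\<le>n'. 0 < t' i" "\<forall>i<n'. x' i \<noteq> \<one>" using bar_reduce pq(1) unfolding pe by blast
    obtain m' y' s' where Q: "(q, (m', y', s')) \<in> ?R" "(m', y', s') \<in> bar_points M"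
      "\<forall>i\<le>m'. 0 < s' i" "\<forall>i<m'. y' i \<noteq> \<one>" using bar_reduce pq(2) unfolding qe by blast
    have "(n', x', t') = (m', y', s')"
      using reduced_unique[OF P(2-4) Q(2-4)] bar_rtrancl_config[OF P(1)] bar_rtrancl_config[OF Q(1)] pq(3) by simp
    moreover have "sym ?R" by (simp add: sym_Un_converse sym_rtrancl)
    ultimately show ?thesis using P(1) Q(1) by (auto dest: symD intro: rtrancl_trans)
  qed
  then show ?thesis by (auto simp: realization_rel_def dest: bar_rtrancl_config)
qed

lemma equiv_bar_rel: "equiv (bar_points M) (bar_rel M)"
  by (rule equivI) (auto simp: refl_on_def sym_def trans_def bar_rel_iff)

lemma B_class_eq: "p \<in> bar_points M \<Longrightarrow> B_class M p = {q \<in> bar_points M. point_config M q = point_config M p}"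
  by (auto simp: B_class_def bar_rel_iff)

end

text \<open>Distinct classes are disjoint, so the union over an intersection of two sets of classes
  is the intersection of the unions; this makes the defining predicate a topology.\<close>

lemma openin_quotient_topology:
  assumes "equiv (topspace X) r"
  shows "openin (quotient_topology X r) U \<longleftrightarrow> U \<subseteq> topspace X // r \<and> openin X (\<Union>U)"
proof -
  have "istopology (\<lambda>U. U \<subseteq> topspace X // r \<and> openin X (\<Union>U))"
    unfolding istopology_def
  proof (intro conjI allI impI)
    fix S T assume *: "S \<subseteq> topspace X // r \<and> openin X (\<Union>S)" "T \<subseteq> topspace X // r \<and> openin X (\<Union>T)"
    have "\<Union>(S \<inter> T) = \<Union>S \<inter> \<Union>T"
    proof
      show "\<Union>S \<inter> \<Union>T \<subseteq> \<Union>(S \<inter> T)"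
      proof
        fix p assume "p \<in> \<Union>S \<inter> \<Union>T"
        then obtain A B where "A \<in> S" "B \<in> T" "p \<in> A" "p \<in> B" by auto
        then have "A = B" using * quotient_disj[OF assms, of A B] by blast
        then show "p \<in> \<Union>(S \<inter> T)" using \<open>A \<in> S\<close> \<open>B \<in> T\<close> \<open>p \<in> A\<close> by auto
      qed
    qed auto
    then show "openin X (\<Union>(S \<inter> T))" using * by (metis openin_Int)
  next
    fix K assume K: "\<forall>S\<in>K. S \<subseteq> topspace X // r \<and> openin X (\<Union>S)"
    have "\<Union>(\<Union>K) = \<Union>(Union ` K)" by auto
    then show "openin X (\<Union>(\<Union>K))" using K by auto
  qed blast+
  then show ?thesis unfolding quotient_topology_def by (simp add: topology_inverse')
qed

lemma topspace_quotient_topology: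
  assumes "equiv (topspace X) r"
  shows "topspace (quotient_topology X r) = topspace X // r"
proof -
  have "openin (quotient_topology X r) (topspace X // r)"
    by (simp add: openin_quotient_topology[OF assms] Union_quotient[OF assms])
  then show ?thesis
    by (meson openin_quotient_topology[OF assms] openin_subset openin_topspace subset_antisym)
qed

section \<open>The bijection between points of \<open>B M\<close> and configurations\<close>

context pre_CMon
begin

lemma topspace_B_space: "topspace (B_space M) = B_class M ` bar_points M"
  unfolding B_space_def realization_def topspace_quotient_topology[OF equiv_bar_rel]
  by (auto simp: quotient_def B_class_def)

lemma openin_B_space:
  "openin (B_space M) U \<longleftrightarrow> U \<subseteq> topspace (B_space M) \<and>
    openin (prerealization (\<lambda>n. k_power n (mtop M))) {p \<in> bar_points M. B_class M p \<in> U}"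
proof -
  have "\<Union>U = {p \<in> bar_points M. B_class M p \<in> U}" if U: "U \<subseteq> topspace (B_space M)"
  proof (intro equalityI subsetI)
    fix p assume "p \<in> \<Union>U"
    then obtain A where A: "A \<in> U" "p \<in> A" by auto
    then obtain q where q: "q \<in> bar_points M" "A = B_class M q" using U topspace_B_space by auto
    then have p: "p \<in> bar_points M" "point_config M p = point_config M q" using A by (auto simp: B_class_eq)
    then have "A = B_class M p" using q by (simp add: B_class_eq)
    then show "p \<in> {p \<in> bar_points M. B_class M p \<in> U}" using A p by simp
  next
    fix p assume "p \<in> {p \<in> bar_points M. B_class M p \<in> U}"
    then have "p \<in> B_class M p" "B_class M p \<in> U" by (auto simp: B_class_eq)
    then show "p \<in> \<Union>U" by auto
  qed
  then show ?thesis
    unfolding B_space_def realization_def openin_quotient_topology[OF equiv_bar_rel]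
      topspace_quotient_topology[OF equiv_bar_rel]
    by (cases "U \<subseteq> bar_points M // bar_rel M") auto
qed

lemma config_of_B_class: "p \<in> bar_points M \<Longrightarrow> config_of M (B_class M p) = point_config M p"
proof -
  assume p: "p \<in> bar_points M"
  then have "p \<in> B_class M p" by (simp add: B_class_eq)
  then have "(SOME q. q \<in> B_class M p) \<in> B_class M p" by (rule someI)
  then show ?thesis using p by (simp add: config_of_def B_class_eq)
qed

lemma config_of_inj: "inj_on (config_of M) (topspace (B_space M))"
proof (rule inj_onI)
  fix w w' assume "w \<in> topspace (B_space M)" "w' \<in> topspace (B_space M)" and eq: "config_of M w = config_of M w'"
  then obtain p q where "p \<in> bar_points M" "w = B_class M p" "q \<in> bar_points M" "w' = B_class M q"
    unfolding topspace_B_space by blast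
  then show "w = w'" using eq by (simp add: config_of_B_class) (simp add: B_class_eq)
qed

text \<open>An unsorted list is realized by sorting it and passing to differences. The permutation
  is a parameter, so that one \<open>\<sigma>\<close> can later be used on a whole closed set of
  parameters.\<close>

lemma config_realize:
  assumes u: "\<And>i. i < n \<Longrightarrow> 0 \<le> u i \<and> u i \<le> 1" and x: "\<And>i. i < n \<Longrightarrow> x i \<in> carrier M"
    and \<sigma>: "\<sigma> permutes {..<n}" "\<And>i j. i \<le> j \<Longrightarrow> j < n \<Longrightarrow> u (\<sigma> i) \<le> u (\<sigma> j)"
  shows "(n, \<lambda>i\<in>{..<n}. x (\<sigma> i), simplex_of_knots n (u \<circ> \<sigma>)) \<in> bar_points M"
    "point_config M (n, \<lambda>i\<in>{..<n}. x (\<sigma> i), simplex_of_knots n (u \<circ> \<sigma>)) = config M n x u"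
proof -
  have s: "\<sigma> i < n" if "i < n" for i using permutes_in_image[OF \<sigma>(1), of i] that by simp
  show "(n, \<lambda>i\<in>{..<n}. x (\<sigma> i), simplex_of_knots n (u \<circ> \<sigma>)) \<in> bar_points M"
    using u x \<sigma>(2) s by (auto simp: bar_points_iff intro!: simplex_of_knots_in_simplex)
  have "config M n (\<lambda>i\<in>{..<n}. x (\<sigma> i)) (knot (simplex_of_knots n (u \<circ> \<sigma>))) = config M n (x \<circ> \<sigma>) (u \<circ> \<sigma>)"
    using s x by (intro config_cong) (auto simp: knot_simplex_of_knots)
  also have "\<dots> = config M n x u" using \<sigma>(1) x by (rule config_permute)
  finally show "point_config M (n, \<lambda>i\<in>{..<n}. x (\<sigma> i), simplex_of_knots n (u \<circ> \<sigma>)) = config M n x u"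
    by (simp add: point_config_def)
qed

text \<open>Enumerates the finite support in any order; sorting is left to
  \<open>config_realize\<close>.\<close>

lemma config_set_enum:
  assumes "\<phi> \<in> config_set M"
  obtains n x u where "\<And>i. i < n \<Longrightarrow> 0 \<le> u i \<and> u i \<le> 1" "\<And>i. i < n \<Longrightarrow> x i \<in> carrier M" "\<phi> = config M n x u"
proof -
  define S where "S = {r. \<phi> r \<noteq> \<one>}"
  define k where "k = card S"
  have "finite S" using assms by (simp add: config_set_def S_def)
  then obtain u where u: "bij_betw u {..<k} S"
    unfolding k_def lessThan_atLeast0 using ex_bij_betw_nat_finite by blast
  have S: "0 < r \<and> r < 1" if "r \<in> S" for r using assms that by (auto simp: config_set_def S_def)
  have pc: "\<phi> r \<in> carrier M" for r using assms by (auto simp: config_set_def)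
  have im: "u i \<in> S" if "i < k" for i using bij_betwE[OF u] that by auto
  have inj: "u i = u j \<longleftrightarrow> i = j" if "i < k" "j < k" for i j
    using bij_betw_imp_inj_on[OF u] that by (simp add: inj_on_eq_iff)
  have "\<phi> r = config M k (\<phi> \<circ> u) u r" for r
  proof (cases "r \<in> S")
    case True
    then obtain j where j: "j < k" "r = u j" using bij_betw_imp_surj_on[OF u] by blast
    have "config M k (\<phi> \<circ> u) u r = (\<Otimes>i\<in>{..<k}. if i = j then \<phi> (u i) else \<one>)"
      using S[OF True] inj j pc by (auto simp: config_def intro!: finprod_cong')
    also have "\<dots> = \<phi> (u j)" using j pc by (intro finprod_singleton_swap) auto
    finally show ?thesis using j by simp
  next
    case False
    then have "config M k (\<phi> \<circ> u) u r = \<one>"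
      using im by (auto simp: config_def intro!: finprod_one_eqI)
    then show ?thesis using False by (simp add: S_def)
  qed
  then show ?thesis using S[OF im] pc by (intro that[of k u "\<phi> \<circ> u"]) (auto simp: less_imp_le)
qed

lemma config_of_bij: "bij_betw (config_of M) (topspace (B_space M)) (config_set M)"
  unfolding bij_betw_def
proof (intro conjI config_of_inj equalityI subsetI)
  fix \<phi> assume "\<phi> \<in> config_of M ` topspace (B_space M)"
  then show "\<phi> \<in> config_set M"
    by (auto simp: topspace_B_space config_of_B_class point_config_in_config_set)
next
  fix \<phi> assume "\<phi> \<in> config_set M"
  from config_set_enum[OF this] obtain n x u where
    ux: "\<And>i. i < n \<Longrightarrow> 0 \<le> u i \<and> u i \<le> 1" "\<And>i. i < n \<Longrightarrow> x i \<in> carrier M"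
    and \<phi>: "\<phi> = config M n x u" by metis
  obtain \<sigma> where \<sigma>: "\<sigma> permutes {..<n}" "\<forall>i j. i \<le> j \<longrightarrow> j < n \<longrightarrow> u (\<sigma> i) \<le> u (\<sigma> j)"
    using sorting_permutation[of n u] by blast
  let ?p = "(n, \<lambda>i\<in>{..<n}. x (\<sigma> i), simplex_of_knots n (u \<circ> \<sigma>))"
  have p: "?p \<in> bar_points M"
    by (rule config_realize(1)) (simp_all add: ux \<sigma>)
  have "point_config M ?p = config M n x u"
    by (rule config_realize(2)) (simp_all add: ux \<sigma>)
  then have "\<phi> = config_of M (B_class M ?p)"
    using \<phi> by (simp only: config_of_B_class[OF p])
  moreover have "B_class M ?p \<in> topspace (B_space M)"
    using p unfolding topspace_B_space by (rule imageI)
  ultimately show "\<phi> \<in> config_of M ` topspace (B_space M)" by (rule image_eqI)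
qed

lemma config_of_in: "w \<in> topspace (B_space M) \<Longrightarrow> config_of M w \<in> config_set M"
  using config_of_bij by (auto simp: bij_betw_def)

lemma config_of_closed: "w \<in> topspace (B_space M) \<Longrightarrow> config_of M w r \<in> carrier M"
  using config_of_in by (auto simp: config_set_def)

lemma config_of_eqI: "w \<in> topspace (B_space M) \<Longrightarrow> w' \<in> topspace (B_space M) \<Longrightarrow>
   (\<And>r. config_of M w r = config_of M w' r) \<Longrightarrow> w = w'"
  using config_of_inj by (metis inj_onD ext)

lemma B_pt: "\<phi> \<in> config_set M \<Longrightarrow> B_pt M \<phi> \<in> topspace (B_space M)"
  "\<phi> \<in> config_set M \<Longrightarrow> config_of M (B_pt M \<phi>) = \<phi>"
  using config_of_bij by (auto simp: B_pt_def bij_betw_def inv_into_into f_inv_into_f)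

lemma B_pt_eqI: "w \<in> topspace (B_space M) \<Longrightarrow> (\<And>r. config_of M w r = \<phi> r) \<Longrightarrow> w = B_pt M \<phi>"
  unfolding B_pt_def by (rule inv_into_f_eq[OF config_of_inj, symmetric]) auto

lemma B_class_eq_B_pt: "p \<in> bar_points M \<Longrightarrow> B_class M p = B_pt M (point_config M p)"
  by (rule B_pt_eqI) (auto simp: topspace_B_space config_of_B_class)

end

section \<open>The classifying space functor\<close>

lemma hom_finprod_nat:
  assumes M: "comm_monoid M" and N: "comm_monoid N" and f: "f \<in> hom M N" "f \<one>\<^bsub>M\<^esub> = \<one>\<^bsub>N\<^esub>"
    and x: "\<And>i. i < n \<Longrightarrow> x i \<in> carrier M"
  shows "f (finprod M x {..<n}) = finprod N (\<lambda>i. f (x i)) {..<(n :: nat)}"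
  using x
proof (induction n)
  case 0
  show ?case using f(2) by (simp add: comm_monoid.finprod_empty[OF M] comm_monoid.finprod_empty[OF N])
next
  case (Suc n)
  interpret M: comm_monoid M by fact
  interpret N: comm_monoid N by fact
  show ?case
    using Suc f hom_mult[OF f(1)] hom_in_carrier[OF f(1)]
    by (simp add: lessThan_Suc Pi_iff)
qed

lemma config_hom:
  assumes M: "pre_CMon M" and N: "pre_CMon N" and f: "f \<in> hom M N" "f \<one>\<^bsub>M\<^esub> = \<one>\<^bsub>N\<^esub>"
    and x: "\<And>i. i < n \<Longrightarrow> x i \<in> carrier M"
  shows "config N n (\<lambda>i. f (x i)) u = f \<circ> config M n x u"
proof
  fix r
  interpret M: pre_CMon M by fact
  interpret N: pre_CMon N by fact
  have "f (finprod M (\<lambda>i. if u i = r then x i else \<one>\<^bsub>M\<^esub>) {..<n}) =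
      finprod N (\<lambda>i. f (if u i = r then x i else \<one>\<^bsub>M\<^esub>)) {..<n}"
    using x by (intro hom_finprod_nat[OF M.comm_monoid_axioms N.comm_monoid_axioms f]) auto
  also have "\<dots> = finprod N (\<lambda>i. if u i = r then f (x i) else \<one>\<^bsub>N\<^esub>) {..<n}"
    using x f hom_in_carrier[OF f(1)] by (intro N.finprod_cong') auto
  finally show "config N n (\<lambda>i. f (x i)) u r = (f \<circ> config M n x u) r"
    using f(2) by (simp add: config_def)
qed

lemma config_set_hom:
  assumes "f \<in> hom M N" "f \<one>\<^bsub>M\<^esub> = \<one>\<^bsub>N\<^esub>" "\<phi> \<in> config_set M"
  shows "f \<circ> \<phi> \<in> config_set N"
proof -
  have "{r. f (\<phi> r) \<noteq> \<one>\<^bsub>N\<^esub>} \<subseteq> {r. \<phi> r \<noteq> \<one>\<^bsub>M\<^esub>}" using assms(2) by auto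
  then have "finite {r. f (\<phi> r) \<noteq> \<one>\<^bsub>N\<^esub>}"
    by (rule finite_subset) (use assms(3) in \<open>simp add: config_set_def\<close>)
  then show ?thesis using assms hom_in_carrier[OF assms(1)] by (auto simp: config_set_def)
qed

text \<open>This includes that \<open>B_map\<close> is well defined: the configuration of the
  levelwise image depends only on the configuration of \<open>w\<close>, so all representatives give
  one class and \<open>the_elem\<close> is applied to a singleton.\<close>

lemma B_map_eq:
  assumes M: "pre_CMon M" and N: "pre_CMon N" and f: "f \<in> hom M N" "f \<one>\<^bsub>M\<^esub> = \<one>\<^bsub>N\<^esub>"
    and w: "w \<in> topspace (B_space M)"
  shows "B_map M N f w = B_pt N (f \<circ> config_of M w)"
proof -
  interpret M: pre_CMon M by fact
  interpret N: pre_CMon N by fact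
  obtain p where p: "p \<in> bar_points M" "w = B_class M p" using w M.topspace_B_space by auto
  let ?g = "\<lambda>(n, x, t). B_class N (n, \<lambda>i\<in>{..<n}. f (x i), t)"
  have "?g q = B_pt N (f \<circ> config_of M w)" if q: "q \<in> w" for q
  proof -
    obtain n x t where qe: "q = (n, x, t)" by (cases q)
    have q': "q \<in> bar_points M" "point_config M q = config_of M w"
      using q p by (auto simp: M.B_class_eq M.config_of_B_class[OF p(1), unfolded M.B_class_eq[OF p(1)]])
    then have x: "x \<in> {..<n} \<rightarrow>\<^sub>E carrier M" "t \<in> standard_simplex n" by (auto simp: qe M.bar_points_iff)
    then have xc: "\<And>i. i < n \<Longrightarrow> x i \<in> carrier M" by auto
    have fx: "(n, \<lambda>i\<in>{..<n}. f (x i), t) \<in> bar_points N"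
      using x hom_in_carrier[OF f(1)] by (auto simp: N.bar_points_iff)
    have "config N n (\<lambda>i\<in>{..<n}. f (x i)) (knot t) = config N n (\<lambda>i. f (x i)) (knot t)"
      using xc hom_in_carrier[OF f(1)] by (intro N.config_cong) auto
    also have "\<dots> = f \<circ> config_of M w"
      using config_hom[OF M N f, of n x "knot t", OF xc] q'(2) by (simp add: qe point_config_def)
    finally show ?thesis
      using N.B_class_eq_B_pt[OF fx] by (simp add: qe point_config_def)
  qed
  then have "?g ` w = (\<lambda>_. B_pt N (f \<circ> config_of M w)) ` w" by (rule image_cong[OF refl])
  moreover have "p \<in> w" using p by (simp add: M.B_class_eq)
  ultimately have "?g ` w = {B_pt N (f \<circ> config_of M w)}" by (simp only: image_constant)
  then show ?thesis using w by (simp add: B_map_def)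
qed

lemma B_map_closed:
  assumes "pre_CMon M" "pre_CMon N" "f \<in> hom M N" "f \<one>\<^bsub>M\<^esub> = \<one>\<^bsub>N\<^esub>" "w \<in> topspace (B_space M)"
  shows "B_map M N f w \<in> topspace (B_space N)"
  unfolding B_map_eq[OF assms]
  by (intro pre_CMon.B_pt[OF assms(2)] config_set_hom[OF assms(3,4)] pre_CMon.config_of_in[OF assms(1,5)])

lemma config_of_B_map:
  assumes "pre_CMon M" "pre_CMon N" "f \<in> hom M N" "f \<one>\<^bsub>M\<^esub> = \<one>\<^bsub>N\<^esub>" "w \<in> topspace (B_space M)"
  shows "config_of N (B_map M N f w) r = f (config_of M w r)"
  unfolding B_map_eq[OF assms]
  using pre_CMon.B_pt(2)[OF assms(2) config_set_hom[OF assms(3,4) pre_CMon.config_of_in[OF assms(1,5)]]]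
  by simp

lemma pre_CMon_prod:
  assumes "pre_CMon M" "pre_CMon N" shows "pre_CMon (M \<times>\<^sub>M\<^sub>o\<^sub>n N)"
proof -
  interpret M: pre_CMon M by fact
  interpret N: pre_CMon N by fact
  have "comm_monoid (M \<times>\<^sub>M\<^sub>o\<^sub>n N)"
    by (rule comm_monoidI) (auto simp: prod_top_monoid_def M.m_assoc N.m_assoc intro: M.m_comm N.m_comm)
  moreover have "topspace (mtop (M \<times>\<^sub>M\<^sub>o\<^sub>n N)) = carrier (M \<times>\<^sub>M\<^sub>o\<^sub>n N)"
    by (simp add: prod_top_monoid_def k_prod_def M.topspace_mtop N.topspace_mtop)
  ultimately show ?thesis by (simp add: pre_CMon_def pre_CMon_axioms_def)
qed

lemma fst_snd_hom: "fst \<in> hom (M \<times>\<^sub>M\<^sub>o\<^sub>n N) M" "snd \<in> hom (M \<times>\<^sub>M\<^sub>o\<^sub>n N) N"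
  "fst \<one>\<^bsub>M \<times>\<^sub>M\<^sub>o\<^sub>n N\<^esub> = \<one>\<^bsub>M\<^esub>" "snd \<one>\<^bsub>M \<times>\<^sub>M\<^sub>o\<^sub>n N\<^esub> = \<one>\<^bsub>N\<^esub>"
  by (auto simp: hom_def prod_top_monoid_def)

lemma (in pre_CMon) mult_hom:
  "(\<lambda>(x, y). x \<otimes> y) \<in> hom (M \<times>\<^sub>M\<^sub>o\<^sub>n M) M" "(\<lambda>(x, y). x \<otimes> y) \<one>\<^bsub>M \<times>\<^sub>M\<^sub>o\<^sub>n M\<^esub> = \<one>"
  by (auto simp: hom_def prod_top_monoid_def m_ac)

context pre_CMon
begin

text \<open>On configurations the canonical map from \<open>B (M x M)\<close> to
  \<open>B M x B M\<close> splits a function into its two components, so its inverse pairs them. The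
  support of the pair lies in the union of the two finite supports.\<close>

lemma B_pair_eq:
  assumes u: "u \<in> topspace (B_space M)" and v: "v \<in> topspace (B_space M)"
  shows "B_pair M u v \<in> topspace (B_space (M \<times>\<^sub>M\<^sub>o\<^sub>n M))"
    "config_of (M \<times>\<^sub>M\<^sub>o\<^sub>n M) (B_pair M u v) r = (config_of M u r, config_of M v r)"
proof -
  let ?P = "M \<times>\<^sub>M\<^sub>o\<^sub>n M"
  have M: "pre_CMon M" by unfold_locales
  interpret P: pre_CMon ?P by (rule pre_CMon_prod[OF M M])
  have P: "pre_CMon ?P" by unfold_locales
  let ?\<phi> = "\<lambda>r. (config_of M u r, config_of M v r)"
  have "{r. ?\<phi> r \<noteq> \<one>\<^bsub>?P\<^esub>} \<subseteq> {r. config_of M u r \<noteq> \<one>} \<union> {r. config_of M v r \<noteq> \<one>}"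
    by (auto simp: prod_top_monoid_def)
  then have "finite {r. ?\<phi> r \<noteq> \<one>\<^bsub>?P\<^esub>}"
    by (rule finite_subset) (use config_of_in[OF u] config_of_in[OF v] in \<open>simp add: config_set_def\<close>)
  then have \<phi>: "?\<phi> \<in> config_set ?P"
    using config_of_in[OF u] config_of_in[OF v] by (auto simp: config_set_def prod_top_monoid_def)
  let ?Q = "\<lambda>w. w \<in> topspace (B_space ?P) \<and> B_map ?P M fst w = u \<and> B_map ?P M snd w = v"
  have Q: "?Q w \<longleftrightarrow> w = B_pt ?P ?\<phi>" for w
  proof
    assume w: "?Q w"
    then have "config_of ?P w r = ?\<phi> r" for r
      using config_of_B_map[OF P M fst_snd_hom(1,3), of w r] config_of_B_map[OF P M fst_snd_hom(2,4), of w r]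
      by (auto simp: prod_eq_iff)
    then show "w = B_pt ?P ?\<phi>" using w by (intro P.B_pt_eqI) auto
  next
    assume w: "w = B_pt ?P ?\<phi>"
    then have w': "w \<in> topspace (B_space ?P)" using P.B_pt(1)[OF \<phi>] by simp
    have c: "config_of ?P w = ?\<phi>" using P.B_pt(2)[OF \<phi>] w by simp
    have "B_map ?P M fst w = u"
      by (rule config_of_eqI[OF B_map_closed[OF P M fst_snd_hom(1,3) w'] u])
        (simp add: config_of_B_map[OF P M fst_snd_hom(1,3) w'] c)
    moreover have "B_map ?P M snd w = v"
      by (rule config_of_eqI[OF B_map_closed[OF P M fst_snd_hom(2,4) w'] v])
        (simp add: config_of_B_map[OF P M fst_snd_hom(2,4) w'] c)
    ultimately show "?Q w" using w' by simp
  qed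
  have "B_pair M u v = B_pt ?P ?\<phi>" unfolding B_pair_def Q by simp
  then show "B_pair M u v \<in> topspace (B_space ?P)" "config_of ?P (B_pair M u v) r = ?\<phi> r"
    using P.B_pt[OF \<phi>] by auto
qed

lemma carrier_B: "carrier (B_obj M) = topspace (B_space M)"
  and mtop_B: "mtop (B_obj M) = B_space M"
  by (simp_all add: B_obj_def)

lemma mult_B:
  assumes u: "u \<in> topspace (B_space M)" and v: "v \<in> topspace (B_space M)"
  shows "u \<otimes>\<^bsub>B_obj M\<^esub> v \<in> topspace (B_space M)"
    "config_of M (u \<otimes>\<^bsub>B_obj M\<^esub> v) r = config_of M u r \<otimes> config_of M v r"
proof -
  have M: "pre_CMon M" by unfold_locales
  note * = pre_CMon_prod[OF M M] M mult_hom B_pair_eq(1)[OF u v]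
  show "u \<otimes>\<^bsub>B_obj M\<^esub> v \<in> topspace (B_space M)"
    using B_map_closed[OF *] by (simp add: B_obj_def)
  show "config_of M (u \<otimes>\<^bsub>B_obj M\<^esub> v) r = config_of M u r \<otimes> config_of M v r"
    using config_of_B_map[OF *] B_pair_eq(2)[OF u v] by (simp add: B_obj_def)
qed

lemma one_B:
  "\<one>\<^bsub>B_obj M\<^esub> \<in> topspace (B_space M)" "config_of M \<one>\<^bsub>B_obj M\<^esub> r = \<one>"
proof -
  let ?p = "(0 :: nat, \<lambda>i\<in>{..<0 :: nat}. \<one>, \<lambda>j :: nat. if j = 0 then 1 else 0 :: real)"
  have p: "?p \<in> bar_points M" by (auto simp: bar_points_iff standard_simplex_0)
  then show "\<one>\<^bsub>B_obj M\<^esub> \<in> topspace (B_space M)"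
    unfolding topspace_B_space by (simp add: B_obj_def)
  show "config_of M \<one>\<^bsub>B_obj M\<^esub> r = \<one>"
    using config_of_B_class[OF p] by (simp add: B_obj_def point_config_def config_def)
qed

lemma comm_monoid_B: "comm_monoid (B_obj M)"
  unfolding carrier_B
proof (rule comm_monoidI)
  fix x y z assume "x \<in> carrier (B_obj M)" "y \<in> carrier (B_obj M)" "z \<in> carrier (B_obj M)"
  then show "x \<otimes>\<^bsub>B_obj M\<^esub> y \<otimes>\<^bsub>B_obj M\<^esub> z = x \<otimes>\<^bsub>B_obj M\<^esub> (y \<otimes>\<^bsub>B_obj M\<^esub> z)"
    unfolding carrier_B by (intro config_of_eqI) (simp_all add: mult_B config_of_closed m_assoc)
next
  fix x y assume "x \<in> carrier (B_obj M)" "y \<in> carrier (B_obj M)"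
  then show "x \<otimes>\<^bsub>B_obj M\<^esub> y = y \<otimes>\<^bsub>B_obj M\<^esub> x"
    unfolding carrier_B by (intro config_of_eqI) (simp_all add: mult_B config_of_closed m_comm)
next
  fix x assume "x \<in> carrier (B_obj M)"
  then show "\<one>\<^bsub>B_obj M\<^esub> \<otimes>\<^bsub>B_obj M\<^esub> x = x"
    unfolding carrier_B by (intro config_of_eqI) (simp_all add: mult_B one_B config_of_closed)
qed (simp_all add: carrier_B mult_B one_B)

text \<open>Pointwise products come from concatenated lists. The length \<open>n + m\<close> is
  fixed, which is what continuity of the multiplication on \<open>B M\<close> needs.\<close>

lemma config_append:
  assumes x: "\<And>i. i < n \<Longrightarrow> x i \<in> carrier M" and y: "\<And>i. i < m \<Longrightarrow> y i \<in> carrier M"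
  shows "config M (n + m) (\<lambda>i. if i < n then x i else y (i - n)) (\<lambda>i. if i < n then u i else v (i - n)) r
    = config M n x u r \<otimes> config M m y v r"
proof -
  let ?g = "\<lambda>i. if u i = r then x i else \<one>" and ?h = "\<lambda>i. if v i = r then y i else \<one>"
  let ?k = "\<lambda>i. if (if i < n then u i else v (i - n)) = r then (if i < n then x i else y (i - n)) else \<one>"
  have "finprod M ?k {..<n + m} = finprod M ?g {..<n} \<otimes> finprod M ?h {..<m}"
    using y
  proof (induction m)
    case 0
    have "finprod M ?k {..<n} = finprod M ?g {..<n}" using x by (intro finprod_cong') auto
    then show ?case using x by simp
  next
    case (Suc m)
    have k: "?k \<in> {..<n + m} \<rightarrow> carrier M" "?k (n + m) \<in> carrier M" using x Suc.prems by auto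
    have "finprod M ?k {..<n + Suc m} = ?k (n + m) \<otimes> finprod M ?k {..<n + m}"
      using k by (simp only: add_Suc_right lessThan_Suc finprod_insert finite_lessThan lessThan_iff less_irrefl not_False_eq_True)
    also have "\<dots> = ?h m \<otimes> (finprod M ?g {..<n} \<otimes> finprod M ?h {..<m})"
      using Suc by simp
    also have "\<dots> = finprod M ?g {..<n} \<otimes> finprod M ?h {..<Suc m}"
      using x Suc.prems by (simp add: lessThan_Suc Pi_iff m_lcomm)
    finally show ?case .
  qed
  then show ?thesis by (simp add: config_def)
qed

subsection \<open>Continuous families of labelled configurations\<close>

lemma bar_points_test_map:
  assumes "test_map D (prod_topology (k_power n (mtop M)) (simplex_topology n)) p" "d \<in> topspace D"
  shows "(n, p d) \<in> bar_points M"
proof -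
  have "p d \<in> topspace (prod_topology (k_power n (mtop M)) (simplex_topology n))"
    using assms continuous_map_funspace by (fastforce simp: test_map_iff)
  then show ?thesis by (cases "p d") (simp add: bar_points_iff topspace_k_power simplex_topology_def)
qed

lemma continuous_map_B_class:
  assumes p: "test_map D (prod_topology (k_power n (mtop M)) (simplex_topology n)) p"
  shows "continuous_map D (B_space M) (\<lambda>d. B_class M (n, p d))"
  unfolding continuous_map_def
proof (intro conjI allI impI)
  note pc = bar_points_test_map[OF p]
  then show "(\<lambda>d. B_class M (n, p d)) \<in> topspace D \<rightarrow> topspace (B_space M)"
    by (auto simp: topspace_B_space)
  fix U assume "openin (B_space M) U"
  then have "openin (k_prod (k_power n (mtop M)) (simplex_topology n)) {y. (n, y) \<in> {p \<in> bar_points M. B_class M p \<in> U}}"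
    by (simp only: openin_B_space prerealization_def openin_sum_topology) blast
  from openin_test_map[OF this[unfolded k_prod_def] p]
  have "openin D {d \<in> topspace D. (n, p d) \<in> bar_points M \<and> B_class M (n, p d) \<in> U}" by simp
  then show "openin D {d \<in> topspace D. B_class M (n, p d) \<in> U}" using pc by (simp cong: conj_cong)
qed

text \<open>The test spaces have exactly the type over which \<open>kify\<close> quantifies in
  forming the product of \<open>k_power n (mtop M)\<close> with a simplex, so finality on each
  summand is \<open>openin_kify\<close>. Composing with the quotient map means that no test map into
  \<open>B M\<close> ever has to be lifted.\<close>

definition bar_probes ::
    "(((nat \<Rightarrow> 'a) \<times> (nat \<Rightarrow> real)) test_point topology \<times> (((nat \<Rightarrow> 'a) \<times> (nat \<Rightarrow> real)) test_point \<Rightarrow> 'a bar_point)) set" where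
  "bar_probes = {(D, \<lambda>d. B_class M (n, p d)) | n D p.
     test_map D (prod_topology (k_power n (mtop M)) (simplex_topology n)) p}"

lemma bar_probesI:
  fixes D :: "((nat \<Rightarrow> 'a) \<times> (nat \<Rightarrow> real)) test_point topology"
  shows "test_map D (prod_topology (k_power n (mtop M)) (simplex_topology n)) p \<Longrightarrow> (D, \<lambda>d. B_class M (n, p d)) \<in> bar_probes"
  unfolding bar_probes_def by (intro CollectI exI[of _ n] exI[of _ D] exI[of _ p]) simp

text \<open>Openness in the quotient is openness of the preimage in every summand, and each summand
  is a k-product whose topology is final for its test maps.\<close>

lemma probes_B_space: "probes (B_space M) bar_probes"
  unfolding probes_def
proof (intro conjI ballI allI impI)
  fix z assume "z \<in> bar_probes"
  then obtain n p and D :: "((nat \<Rightarrow> 'a) \<times> (nat \<Rightarrow> real)) test_point topology"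
    where z: "z = (D, \<lambda>d. B_class M (n, p d))"
    and "test_map D (prod_topology (k_power n (mtop M)) (simplex_topology n)) p"
    unfolding bar_probes_def by blast
  then show "case z of (D, q) \<Rightarrow> test_map D (B_space M) q"
    using continuous_map_B_class by (auto simp: test_map_iff)
next
  fix w assume "w \<in> topspace (B_space M)"
  then obtain n x t where p: "(n, x, t) \<in> bar_points M" "w = B_class M (n, x, t)"
    by (auto simp: topspace_B_space)
  let ?D = "discrete_topology {undefined} :: ((nat \<Rightarrow> 'a) \<times> (nat \<Rightarrow> real)) test_point topology"
  have *: "test_map ?D (prod_topology (k_power n (mtop M)) (simplex_topology n)) (\<lambda>_. (x, t))"
    using p(1) chaus_point
    by (auto simp: test_map_iff bar_points_iff topspace_k_power simplex_topology_def)
  show "\<exists>(D, q) \<in> bar_probes. w \<in> q ` topspace D"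
    by (rule bexI[OF _ bar_probesI[OF *]]) (use p(2) in simp)
next
  fix U assume U: "U \<subseteq> topspace (B_space M)" "\<forall>(D, q) \<in> bar_probes. openin D {d \<in> topspace D. q d \<in> U}"
  have "openin (k_prod (k_power n (mtop M)) (simplex_topology n)) {y. (n, y) \<in> {p \<in> bar_points M. B_class M p \<in> U}}" for n
    unfolding k_prod_def openin_kify
  proof (intro conjI allI impI)
    show "{y. (n, y) \<in> {p \<in> bar_points M. B_class M p \<in> U}} \<subseteq> topspace (prod_topology (k_power n (mtop M)) (simplex_topology n))"
      by (auto simp: bar_points_iff topspace_k_power simplex_topology_def)
    fix C :: "((nat \<Rightarrow> 'a) \<times> (nat \<Rightarrow> real)) test_point topology" and p
    assume p: "test_map C (prod_topology (k_power n (mtop M)) (simplex_topology n)) p"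
    from bspec[OF U(2) bar_probesI[OF this]]
    have "openin C {d \<in> topspace C. B_class M (n, p d) \<in> U}" by simp
    then show "openin C {c \<in> topspace C. p c \<in> {y. (n, y) \<in> {p \<in> bar_points M. B_class M p \<in> U}}}"
      using bar_points_test_map[OF p] by (simp cong: conj_cong)
  qed
  then have "openin (prerealization (\<lambda>n. k_power n (mtop M))) {p \<in> bar_points M. B_class M p \<in> U}"
    unfolding prerealization_def openin_sum_topology
    by (auto simp: prerealization_def[symmetric] k_prod_def bar_points_iff topspace_k_power simplex_topology_def)
  then show "openin (B_space M) U" using U(1) by (simp add: openin_B_space)
qed

text \<open>The positions are the knots of the simplex coordinate. Their order is deliberately
  forgotten, so that probes can be concatenated.\<close>

lemma bar_probesE:
  assumes "(D, q) \<in> bar_probes"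
  obtains n x u where "\<forall>i<n. continuous_map D (mtop M) (\<lambda>d. x d i)"
    "\<forall>i. continuous_map D euclideanreal (\<lambda>d. u d i)"
    "\<forall>d\<in>topspace D. \<forall>i. 0 \<le> u d i \<and> u d i \<le> 1"
    "\<forall>d\<in>topspace D. \<forall>i<n. x d i \<in> carrier M"
    "\<forall>d\<in>topspace D. q d = B_pt M (config M n (x d) (u d))"
proof -
  obtain n p where q: "q = (\<lambda>d. B_class M (n, p d))"
    and pt: "test_map D (prod_topology (k_power n (mtop M)) (simplex_topology n)) p"
    using assms unfolding bar_probes_def by blast
  then have D: "chaus D" and p: "continuous_map D (k_power n (mtop M)) (fst \<circ> p)"
    "continuous_map D (simplex_topology n) (snd \<circ> p)"
    by (auto simp: test_map_iff continuous_map_pairwise)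
  have x: "continuous_map D (product_topology (\<lambda>_. mtop M) {..<n}) (fst \<circ> p)"
    using p(1) D by (simp add: k_power_def continuous_map_into_kify)
  have xi: "continuous_map D (mtop M) (\<lambda>d. fst (p d) i)" if "i < n" for i
    using x that by (simp add: continuous_map_componentwise)
  have t: "continuous_map D euclideanreal (\<lambda>d. snd (p d) i)" for i
    using p(2) by (simp add: simplex_topology_def continuous_map_in_subtopology continuous_map_componentwise_UNIV)
  have k: "continuous_map D euclideanreal (\<lambda>d. knot (snd (p d)) i)" for i
    unfolding knot_def using t by (intro continuous_map_sum) auto
  note s = bar_points_test_map[OF pt]
  have s': "fst (p d) \<in> {..<n} \<rightarrow>\<^sub>E carrier M \<and> snd (p d) \<in> standard_simplex n" if "d \<in> topspace D" for d
    using s[OF that] bar_points_iff[of n "fst (p d)" "snd (p d)"] by simp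
  show ?thesis
  proof (rule that[of n "\<lambda>d. fst (p d)" "\<lambda>d. knot (snd (p d))"])
    show "\<forall>d\<in>topspace D. \<forall>i. 0 \<le> knot (snd (p d)) i \<and> knot (snd (p d)) i \<le> 1"
      using s' knot_bounds by blast
    show "\<forall>d\<in>topspace D. \<forall>i<n. fst (p d) i \<in> carrier M"
      using s' by (blast intro: PiE_mem)
    show "\<forall>d\<in>topspace D. q d = B_pt M (config M n (fst (p d)) (knot (snd (p d))))"
      using s by (simp add: q B_class_eq_B_pt point_config_def case_prod_unfold)
  qed (use xi k in auto)
qed

text \<open>On the closed set where \<open>\<sigma>\<close> sorts the positions, the simplex
  coordinates are differences of neighbouring sorted positions and hence continuous. These sets
  overlap where positions coincide; there the formulas agree because both represent the same
  configuration.\<close>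

lemma continuous_map_B_pt:
  assumes D: "chaus D" and x: "\<And>i. i < n \<Longrightarrow> continuous_map D (mtop M) (\<lambda>d. x d i)"
    and u: "\<And>i. i < n \<Longrightarrow> continuous_map D euclideanreal (\<lambda>d. u d i)"
    and b: "\<And>i d. i < n \<Longrightarrow> d \<in> topspace D \<Longrightarrow> 0 \<le> u d i \<and> u d i \<le> 1"
  shows "continuous_map D (B_space M) (\<lambda>d. B_pt M (config M n (x d) (u d)))"
proof -
  have xc: "x d i \<in> carrier M" if "i < n" "d \<in> topspace D" for i d
    using x[OF that(1)] that(2) topspace_mtop by (auto simp: continuous_map_def)
  let ?I = "{\<sigma>. \<sigma> permutes {..<n}}"
  define T where "T \<sigma> = {d \<in> topspace D. \<forall>i j. i \<le> j \<longrightarrow> j < n \<longrightarrow> u d (\<sigma> i) \<le> u d (\<sigma> j)}" for \<sigma>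
  define f where "f \<sigma> d = B_class M (n, \<lambda>i\<in>{..<n}. x d (\<sigma> i), simplex_of_knots n (u d \<circ> \<sigma>))" for \<sigma> d
  have perm: "\<sigma> i < n" if "\<sigma> \<in> ?I" "i < n" for \<sigma> i
    using permutes_in_image[of \<sigma> "{..<n}" i] that by simp
  have f: "f \<sigma> d = B_pt M (config M n (x d) (u d))" if "\<sigma> \<in> ?I" "d \<in> T \<sigma>" for \<sigma> d
  proof -
    have p: "(n, \<lambda>i\<in>{..<n}. x d (\<sigma> i), simplex_of_knots n (u d \<circ> \<sigma>)) \<in> bar_points M"
      by (rule config_realize(1)) (use that b xc in \<open>auto simp: T_def\<close>)
    have "point_config M (n, \<lambda>i\<in>{..<n}. x d (\<sigma> i), simplex_of_knots n (u d \<circ> \<sigma>)) = config M n (x d) (u d)"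
      by (rule config_realize(2)) (use that b xc in \<open>auto simp: T_def\<close>)
    then show ?thesis using B_class_eq_B_pt[OF p] by (simp add: f_def)
  qed
  show ?thesis
  proof (rule pasting_lemma_closed[of ?I D T "B_space M" f])
    show "finite ?I" by (rule finite_permutations) simp
  next
    fix \<sigma> assume \<sigma>: "\<sigma> \<in> ?I"
    have "closedin D {d \<in> topspace D. u d (\<sigma> i) \<le> u d (\<sigma> j)}" if "i \<le> j" "j < n" for i j
    proof -
      have "continuous_map D euclideanreal (\<lambda>d. u d (\<sigma> j) - u d (\<sigma> i))"
        using u perm[OF \<sigma>] that by (intro continuous_map_diff) auto
      from closedin_continuous_map_preimage[OF this, of "{0..}"] show ?thesis by simp
    qed
    \<comment> \<open>Inserting \<open>topspace D\<close> keeps the intersection meaningful when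
      \<open>n = 0\<close> and there are no pairs \<open>(i, j)\<close>.\<close>
    then have "closedin D (\<Inter>(insert (topspace D) ((\<lambda>(i, j). {d \<in> topspace D. u d (\<sigma> i) \<le> u d (\<sigma> j)}) ` {(i, j). i \<le> j \<and> j < n})))"
      by (intro closedin_Inter) auto
    moreover have "\<Inter>(insert (topspace D) ((\<lambda>(i, j). {d \<in> topspace D. u d (\<sigma> i) \<le> u d (\<sigma> j)}) ` {(i, j). i \<le> j \<and> j < n})) = T \<sigma>"
      by (auto simp: T_def)
    ultimately show cl: "closedin D (T \<sigma>)" by simp
    let ?E = "subtopology D (T \<sigma>)"
    \<comment> \<open>Needed to pass from the ordinary product of copies of \<open>M\<close> to its
      k-version \<open>k_power\<close> on this piece.\<close>
    have E: "chaus ?E" by (rule chaus_closed_subspace[OF D cl])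
    have tE: "topspace ?E = T \<sigma>" by (auto simp: T_def)
    have "continuous_map ?E (product_topology (\<lambda>_. mtop M) {..<n}) (\<lambda>d. \<lambda>i\<in>{..<n}. x d (\<sigma> i))"
      unfolding continuous_map_componentwise
      using x perm[OF \<sigma>] by (auto intro: continuous_map_from_subtopology)
    then have c1: "continuous_map ?E (k_power n (mtop M)) (\<lambda>d. \<lambda>i\<in>{..<n}. x d (\<sigma> i))"
      by (simp add: k_power_def continuous_map_into_kify[OF E])
    have us: "continuous_map ?E euclideanreal (\<lambda>d. u d (\<sigma> i))" if "i < n" for i
      using u perm[OF \<sigma> that] by (auto intro: continuous_map_from_subtopology)
    have "continuous_map ?E euclideanreal (\<lambda>d. simplex_of_knots n (u d \<circ> \<sigma>) j)" for j
      using us[of j] us[of "j - 1"]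
      by (cases "j > n"; cases "j < n"; cases "j = 0") (auto simp: simplex_of_knots_def intro!: continuous_map_diff)
    moreover have "simplex_of_knots n (u d \<circ> \<sigma>) \<in> standard_simplex n" if "d \<in> T \<sigma>" for d
      using that b perm[OF \<sigma>] by (intro simplex_of_knots_in_simplex) (auto simp: T_def)
    ultimately have c2: "continuous_map ?E (simplex_topology n) (\<lambda>d. simplex_of_knots n (u d \<circ> \<sigma>))"
      by (auto simp: simplex_topology_def continuous_map_in_subtopology continuous_map_componentwise_UNIV tE)
    have "test_map ?E (prod_topology (k_power n (mtop M)) (simplex_topology n))
       (\<lambda>d. (\<lambda>i\<in>{..<n}. x d (\<sigma> i), simplex_of_knots n (u d \<circ> \<sigma>)))"
      using c1 c2 E by (simp add: test_map_iff continuous_map_pairedI)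
    from continuous_map_B_class[OF this] show "continuous_map ?E (B_space M) (f \<sigma>)"
      by (simp add: f_def[abs_def])
  next
    fix \<sigma> \<tau> d assume "\<sigma> \<in> ?I" "\<tau> \<in> ?I" "d \<in> topspace D \<inter> T \<sigma> \<inter> T \<tau>"
    then show "f \<sigma> d = f \<tau> d" using f by simp
  next
    fix d assume d: "d \<in> topspace D"
    obtain \<sigma> where "\<sigma> permutes {..<n}" "\<forall>i j. i \<le> j \<longrightarrow> j < n \<longrightarrow> u d (\<sigma> i) \<le> u d (\<sigma> j)"
      using sorting_permutation[of n "u d"] by blast
    then have "\<sigma> \<in> ?I" "d \<in> T \<sigma>" using d by (auto simp: T_def)
    then show "\<exists>\<sigma>. \<sigma> \<in> ?I \<and> d \<in> T \<sigma> \<and> B_pt M (config M n (x d) (u d)) = f \<sigma> d"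
      using f by auto
  qed
qed

lemma mult_B_pt:
  assumes x: "\<And>i. i < n \<Longrightarrow> x i \<in> carrier M" and y: "\<And>i. i < m \<Longrightarrow> y i \<in> carrier M"
  shows "B_pt M (config M n x u) \<otimes>\<^bsub>B_obj M\<^esub> B_pt M (config M m y v) =
    B_pt M (config M (n + m) (\<lambda>i. if i < n then x i else y (i - n)) (\<lambda>i. if i < n then u i else v (i - n)))"
proof -
  have c: "config M n x u \<in> config_set M" "config M m y v \<in> config_set M"
    using x y by (auto intro: config_in_config_set)
  show ?thesis
    by (rule B_pt_eqI) (simp_all add: mult_B B_pt c config_append x y)
qed

lemma CMon_B: "CMon (B_obj M)"
  unfolding CMon_def mtop_B carrier_B
proof (intro conjI comm_monoid_B refl probes_imp_test_k_space[OF probes_B_space])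
  show "continuous_map (k_prod (B_space M) (B_space M)) (B_space M) (\<lambda>(x, y). x \<otimes>\<^bsub>B_obj M\<^esub> y)"
  proof (rule continuous_map_k_prod_probes[OF probes_B_space probes_B_space])
    fix D1 q1 D2 q2 assume Q: "(D1, q1) \<in> bar_probes" "(D2, q2) \<in> bar_probes"
    have D: "chaus D1" "chaus D2" using Q probesD(1)[OF probes_B_space] by auto
    obtain n x u where X: "\<forall>i<n. continuous_map D1 (mtop M) (\<lambda>d. x d i)"
      "\<forall>i. continuous_map D1 euclideanreal (\<lambda>d. u d i)"
      "\<forall>d\<in>topspace D1. \<forall>i. 0 \<le> u d i \<and> u d i \<le> 1"
      "\<forall>d\<in>topspace D1. \<forall>i<n. x d i \<in> carrier M"
      "\<forall>d\<in>topspace D1. q1 d = B_pt M (config M n (x d) (u d))"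
      using bar_probesE[OF Q(1)] .
    obtain m y v where Y: "\<forall>i<m. continuous_map D2 (mtop M) (\<lambda>d. y d i)"
      "\<forall>i. continuous_map D2 euclideanreal (\<lambda>d. v d i)"
      "\<forall>d\<in>topspace D2. \<forall>i. 0 \<le> v d i \<and> v d i \<le> 1"
      "\<forall>d\<in>topspace D2. \<forall>i<m. y d i \<in> carrier M"
      "\<forall>d\<in>topspace D2. q2 d = B_pt M (config M m (y d) (v d))"
      using bar_probesE[OF Q(2)] .
    let ?E = "prod_topology D1 D2"
    \<comment> \<open>The first \<open>n\<close> entries come from the first factor, the others,
      shifted by \<open>n\<close>, from the second. The combined positions are in general not
      sorted, as \<open>continuous_map_B_pt\<close> allows.\<close>
    let ?x = "\<lambda>e i. if i < n then x (fst e) i else y (snd e) (i - n)"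
    let ?u = "\<lambda>e i. if i < n then u (fst e) i else v (snd e) (i - n)"
    have fs: "continuous_map ?E Z (\<lambda>e. g (fst e))" if "continuous_map D1 Z g" for Z :: "'z topology" and g
      using continuous_map_compose[OF continuous_map_fst that] by (simp add: o_def)
    have sn: "continuous_map ?E Z (\<lambda>e. g (snd e))" if "continuous_map D2 Z g" for Z :: "'z topology" and g
      using continuous_map_compose[OF continuous_map_snd that] by (simp add: o_def)
    have "continuous_map ?E (B_space M) (\<lambda>e. B_pt M (config M (n + m) (?x e) (?u e)))"
    proof (rule continuous_map_B_pt[OF chaus_prod[OF D]])
      fix i assume i: "i < n + m"
      show "continuous_map ?E (mtop M) (\<lambda>e. ?x e i)"
        using i X(1) Y(1) by (cases "i < n") (auto intro: fs sn)
      show "continuous_map ?E euclideanreal (\<lambda>e. ?u e i)"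
        using i X(2) Y(2) by (cases "i < n") (auto intro: fs sn)
    qed (use X(3) Y(3) in auto)
    moreover have "B_pt M (config M (n + m) (?x e) (?u e)) = q1 (fst e) \<otimes>\<^bsub>B_obj M\<^esub> q2 (snd e)"
      if "e \<in> topspace ?E" for e
    proof -
      have d: "fst e \<in> topspace D1" "snd e \<in> topspace D2" using that by auto
      then show ?thesis
        using X(4) Y(4) bspec[OF X(5) d(1)] bspec[OF Y(5) d(2)] by (simp add: mult_B_pt)
    qed
    ultimately have "continuous_map ?E (B_space M) (\<lambda>e. q1 (fst e) \<otimes>\<^bsub>B_obj M\<^esub> q2 (snd e))"
      by (rule continuous_map_eq)
    then show "continuous_map ?E (B_space M) (\<lambda>(d, e). case (q1 d, q2 e) of (x, y) \<Rightarrow> x \<otimes>\<^bsub>B_obj M\<^esub> y)"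
      by (simp add: case_prod_unfold)
  qed
qed

end

section \<open>Functoriality and enrichment of \<open>B\<close>\<close>

lemma continuous_map_B_map_param:
  assumes M: "CMon M" and N: "CMon N" and C: "chaus C" and \<phi>: "continuous_map C (CMon_space M N) \<phi>"
  shows "continuous_map (prod_topology C (B_space M)) (B_space N) (\<lambda>(c, w). B_map M N (\<phi> c) w)"
proof -
  note pM = CMon_imp_pre_CMon[OF M] and pN = CMon_imp_pre_CMon[OF N]
  interpret M: pre_CMon M by fact
  interpret N: pre_CMon N by fact
  have \<phi>c: "\<phi> c \<in> CMon_hom M N" if "c \<in> topspace C" for c
    using \<phi> that by (simp add: continuous_map_into_CMon_space[OF C CMonD(3)[OF M]])
  show ?thesis
  proof (rule continuous_map_prod_probes[OF C M.probes_B_space])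
    fix D q assume Q: "(D, q) \<in> M.bar_probes"
    have D: "chaus D" using Q probesD(1)[OF M.probes_B_space] by auto
    obtain n x u where X: "\<forall>i<n. continuous_map D (mtop M) (\<lambda>d. x d i)"
      "\<forall>i. continuous_map D euclideanreal (\<lambda>d. u d i)"
      "\<forall>d\<in>topspace D. \<forall>i. 0 \<le> u d i \<and> u d i \<le> 1"
      "\<forall>d\<in>topspace D. \<forall>i<n. x d i \<in> carrier M"
      "\<forall>d\<in>topspace D. q d = B_pt M (config M n (x d) (u d))"
      using M.bar_probesE[OF Q] .
    let ?E = "prod_topology C D"
    have E: "chaus ?E" by (rule chaus_prod[OF C D])
    have sn: "continuous_map ?E Z (\<lambda>e. g (snd e))" if "continuous_map D Z g" for Z :: "'z topology" and g
      using continuous_map_compose[OF continuous_map_snd that] by (simp add: o_def)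
    have \<phi>': "continuous_map ?E (CMon_space M N) (\<lambda>e. \<phi> (fst e))"
      using continuous_map_compose[OF continuous_map_fst \<phi>] by (simp add: o_def)
    have "continuous_map ?E (B_space N) (\<lambda>e. B_pt N (config N n (\<lambda>i. \<phi> (fst e) (x (snd e) i)) (u (snd e))))"
    proof (rule N.continuous_map_B_pt[OF E])
      fix i assume "i < n"
      then show "continuous_map ?E (mtop N) (\<lambda>e. \<phi> (fst e) (x (snd e) i))"
        using X(1) by (intro continuous_map_CMon_eval[OF E CMonD(3)[OF M] \<phi>'] sn) auto
    next
      fix i show "continuous_map ?E euclideanreal (\<lambda>e. u (snd e) i)"
        using X(2) by (intro sn) auto
    qed (use X(3) in auto)
    moreover have "B_pt N (config N n (\<lambda>i. \<phi> (fst e) (x (snd e) i)) (u (snd e))) = B_map M N (\<phi> (fst e)) (q (snd e))"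
      if e: "e \<in> topspace ?E" for e
    proof -
      have h: "\<phi> (fst e) \<in> hom M N" "\<phi> (fst e) \<one>\<^bsub>M\<^esub> = \<one>\<^bsub>N\<^esub>"
        using e CMon_homD(3,4)[OF \<phi>c[of "fst e"]] by auto
      have xc: "\<And>i. i < n \<Longrightarrow> x (snd e) i \<in> carrier M" using X(4) e by auto
      have c: "config M n (x (snd e)) (u (snd e)) \<in> config_set M" using xc by (rule M.config_in_config_set)
      have q: "q (snd e) = B_pt M (config M n (x (snd e)) (u (snd e)))" using X(5) e by auto
      have "config N n (\<lambda>i. \<phi> (fst e) (x (snd e) i)) (u (snd e)) = \<phi> (fst e) \<circ> config M n (x (snd e)) (u (snd e))"
        by (rule config_hom[OF pM pN h]) (rule xc)
      then show ?thesis
        unfolding q using B_map_eq[OF pM pN h M.B_pt(1)[OF c]] M.B_pt(2)[OF c] by simp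
    qed
    ultimately have "continuous_map ?E (B_space N) (\<lambda>e. B_map M N (\<phi> (fst e)) (q (snd e)))"
      by (rule continuous_map_eq)
    then show "continuous_map ?E (B_space N) (\<lambda>(c, d). case (c, q d) of (c, w) \<Rightarrow> B_map M N (\<phi> c) w)"
      by (simp add: case_prod_unfold)
  qed
qed

lemma B_map_hom:
  assumes M: "CMon M" and N: "CMon N" and f: "f \<in> CMon_hom M N"
  shows "B_map M N f \<in> CMon_hom (B_obj M) (B_obj N)"
proof -
  note pM = CMon_imp_pre_CMon[OF M] and pN = CMon_imp_pre_CMon[OF N]
  interpret M: pre_CMon M by fact
  interpret N: pre_CMon N by fact
  note h = CMon_homD(3,4)[OF f]
  note cl = B_map_closed[OF pM pN h] and co = config_of_B_map[OF pM pN h]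
  have "continuous_map (B_space M) (B_space N) (B_map M N f)"
    by (rule continuous_map_point_param[OF continuous_map_B_map_param[OF M N chaus_point continuous_map_const_CMon_space[OF f]]])
  moreover have "B_map M N f (u \<otimes>\<^bsub>B_obj M\<^esub> v) = B_map M N f u \<otimes>\<^bsub>B_obj N\<^esub> B_map M N f v"
    if "u \<in> topspace (B_space M)" "v \<in> topspace (B_space M)" for u v
    using that
    by (intro N.config_of_eqI) (simp_all add: M.mult_B N.mult_B cl co hom_mult[OF h(1)] M.config_of_closed)
  moreover have "B_map M N f \<one>\<^bsub>B_obj M\<^esub> = \<one>\<^bsub>B_obj N\<^esub>"
    by (intro N.config_of_eqI) (simp_all add: M.one_B N.one_B cl co h)
  ultimately show ?thesis
    using cl by (auto simp: CMon_hom_def cmaps_def hom_def M.mtop_B N.mtop_B M.carrier_B N.carrier_B)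
      (simp add: B_map_def)
qed

lemma continuous_map_B_map:
  assumes M: "CMon M" and N: "CMon N"
  shows "continuous_map (CMon_space M N) (CMon_space (B_obj M) (B_obj N)) (B_map M N)"
proof (rule continuous_map_CMon_spaces)
  note pM = CMon_imp_pre_CMon[OF M] and pN = CMon_imp_pre_CMon[OF N]
  show "test_k_space (mtop M)" "test_k_space (mtop (B_obj M))"
    using CMonD(3)[OF M] CMonD(3)[OF pre_CMon.CMon_B[OF pM]] by auto
  show "B_map M N f \<in> CMon_hom (B_obj M) (B_obj N)" if "f \<in> CMon_hom M N" for f
    by (rule B_map_hom[OF M N that])
qed (use continuous_map_B_map_param[OF M N] pre_CMon.mtop_B[OF CMon_imp_pre_CMon[OF M]]
    pre_CMon.mtop_B[OF CMon_imp_pre_CMon[OF N]] in simp)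

lemma B_map_eqI:
  assumes "pre_CMon M" "pre_CMon N" "f \<in> hom M N" "f \<one>\<^bsub>M\<^esub> = \<one>\<^bsub>N\<^esub>" "w \<in> topspace (B_space M)"
    and "w' \<in> topspace (B_space N)" "\<And>r. config_of N w' r = f (config_of M w r)"
  shows "B_map M N f w = w'"
  using assms(6) B_map_closed[OF assms(1-5)]
  by (intro pre_CMon.config_of_eqI[OF assms(2)]) (simp_all add: config_of_B_map[OF assms(1-5)] assms(7))

lemma CMon_id_hom: "CMon M \<Longrightarrow> CMon_id M \<in> CMon_hom M M"
proof -
  assume M: "CMon M"
  interpret comm_monoid M using CMonD(1)[OF M] .
  have "continuous_map (mtop M) (mtop M) (\<lambda>x\<in>carrier M. x)"
    by (rule continuous_map_eq[OF continuous_map_id]) (simp add: CMonD(2)[OF M])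
  then show ?thesis by (auto simp: CMon_hom_def CMon_id_def cmaps_def hom_def CMonD(2)[OF M])
qed

lemma CMon_const_hom: "CMon M \<Longrightarrow> CMon N \<Longrightarrow> CMon_const M N \<in> CMon_hom M N"
proof -
  assume M: "CMon M" and N: "CMon N"
  interpret M: comm_monoid M using CMonD(1)[OF M] .
  interpret N: comm_monoid N using CMonD(1)[OF N] .
  have "continuous_map (mtop M) (mtop N) (\<lambda>x\<in>carrier M. \<one>\<^bsub>N\<^esub>)"
    by (rule continuous_map_eq[of _ _ "\<lambda>_. \<one>\<^bsub>N\<^esub>"]) (simp_all add: CMonD(2)[OF M] CMonD(2)[OF N])
  then show ?thesis by (auto simp: CMon_hom_def CMon_const_def cmaps_def hom_def CMonD(2)[OF M])
qed

lemma CMon_hom_compose: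
  assumes M: "CMon M" and "f \<in> CMon_hom M N" "g \<in> CMon_hom N K"
  shows "compose (carrier M) g f \<in> CMon_hom M K"
proof -
  interpret comm_monoid M using CMonD(1)[OF M] .
  have "continuous_map (mtop M) (mtop K) (\<lambda>x. g (f x))"
    by (rule continuous_map_CMon_hom[OF assms(3) CMon_homD(2)[OF assms(2)]])
  then have "continuous_map (mtop M) (mtop K) (compose (carrier M) g f)"
    by (rule continuous_map_eq) (simp add: CMonD(2)[OF M] compose_def)
  moreover have "compose (carrier M) g f \<in> hom M K"
    using CMon_homD(3)[OF assms(2)] CMon_homD(3)[OF assms(3)]
    by (auto simp: hom_def compose_def Pi_iff)
  ultimately show ?thesis
    using CMon_homD(4)[OF assms(2)] CMon_homD(4)[OF assms(3)]
    by (auto simp: CMon_hom_def cmaps_def CMonD(2)[OF M] compose_def)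
qed

lemma B_map_id: "CMon M \<Longrightarrow> B_map M M (CMon_id M) = CMon_id (B_obj M)"
proof -
  assume M: "CMon M"
  note pM = CMon_imp_pre_CMon[OF M]
  interpret M: pre_CMon M by fact
  note h = CMon_homD(3,4)[OF CMon_id_hom[OF M]]
  show ?thesis
    unfolding CMon_id_def[of "B_obj M"]
  proof (rule extensionalityI[of _ "topspace (B_space M)"])
    fix w assume w: "w \<in> topspace (B_space M)"
    then show "B_map M M (CMon_id M) w = (\<lambda>x\<in>carrier (B_obj M). x) w"
      using B_map_eqI[OF pM pM h w w] by (simp add: M.carrier_B CMon_id_def restrict_def M.config_of_closed)
  qed (auto simp: B_map_def M.carrier_B)
qed

lemma B_map_const:
  assumes M: "CMon M" and N: "CMon N"
  shows "B_map M N (CMon_const M N) = CMon_const (B_obj M) (B_obj N)"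
proof -
  note pM = CMon_imp_pre_CMon[OF M] and pN = CMon_imp_pre_CMon[OF N]
  interpret M: pre_CMon M by fact
  interpret N: pre_CMon N by fact
  note h = CMon_homD(3,4)[OF CMon_const_hom[OF M N]]
  show ?thesis
    unfolding CMon_const_def[of "B_obj M"]
  proof (rule extensionalityI[of _ "topspace (B_space M)"])
    fix w assume w: "w \<in> topspace (B_space M)"
    then show "B_map M N (CMon_const M N) w = (\<lambda>x\<in>carrier (B_obj M). \<one>\<^bsub>B_obj N\<^esub>) w"
      using B_map_eqI[OF pM pN h w N.one_B(1)]
      by (simp add: M.carrier_B CMon_const_def restrict_def M.config_of_closed N.one_B)
  qed (auto simp: B_map_def M.carrier_B)
qed

lemma B_map_compose:
  assumes M: "CMon M" and N: "CMon N" and K: "CMon K" and f: "f \<in> CMon_hom M N" and g: "g \<in> CMon_hom N K"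
  shows "B_map M K (compose (carrier M) g f) = compose (carrier (B_obj M)) (B_map N K g) (B_map M N f)"
proof -
  note pM = CMon_imp_pre_CMon[OF M] and pN = CMon_imp_pre_CMon[OF N] and pK = CMon_imp_pre_CMon[OF K]
  interpret M: pre_CMon M by fact
  note hf = CMon_homD(3,4)[OF f] and hg = CMon_homD(3,4)[OF g]
    and h = CMon_homD(3,4)[OF CMon_hom_compose[OF M f g]]
  show ?thesis
  proof (rule extensionalityI[of _ "topspace (B_space M)"])
    fix w assume w: "w \<in> topspace (B_space M)"
    note w' = B_map_closed[OF pM pN hf w]
    have "B_map M K (compose (carrier M) g f) w = B_map N K g (B_map M N f w)"
      by (rule B_map_eqI[OF pM pK h w B_map_closed[OF pN pK hg w']])
        (simp add: config_of_B_map[OF pN pK hg w'] config_of_B_map[OF pM pN hf w] compose_def M.config_of_closed w)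
    then show "B_map M K (compose (carrier M) g f) w = compose (carrier (B_obj M)) (B_map N K g) (B_map M N f) w"
      using w by (simp add: compose_def M.carrier_B)
  qed (auto simp: B_map_def M.carrier_B)
qed

section \<open>The universal loop\<close>

definition circ :: "real \<Rightarrow> complex" where
  "circ s = cis (2 * pi * s)"

lemma circ_in_circle [simp]: "circ s \<in> topspace circle"
  by (simp add: circ_def topspace_circle)

lemma circ_0 [simp]: "circ 0 = 1" and circ_1 [simp]: "circ 1 = 1"
  by (simp_all add: circ_def)

lemma continuous_circ: "continuous_on S circ"
  unfolding circ_def by (intro continuous_intros)

lemma continuous_map_circ:
  assumes "continuous_map E euclideanreal u" shows "continuous_map E circle (\<lambda>e. circ (u e))"
proof -
  have "continuous_map euclideanreal circle circ"
    using continuous_circ circ_in_circle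
    unfolding circle_def by (auto simp: continuous_map_in_subtopology)
  from continuous_map_compose[OF assms this] show ?thesis by (simp add: o_def)
qed

lemma Arg2pi_circ: "0 \<le> s \<Longrightarrow> s < 1 \<Longrightarrow> Arg2pi (circ s) = 2 * pi * s"
  by (rule Arg2pi_unique[of 1]) (auto simp: circ_def cis_conv_exp)

lemma circleE:
  assumes "z \<in> topspace circle"
  obtains s where "0 \<le> s" "s < 1" "z = circ s"
proof
  show "0 \<le> Arg2pi z / (2 * pi)" "Arg2pi z / (2 * pi) < 1"
    using Arg2pi[of z] by auto
  show "z = circ (Arg2pi z / (2 * pi))"
    using complex_norm_eq_1_exp[of z] assms by (simp add: circ_def topspace_circle cis_conv_exp)
qed

text \<open>
  \<^const>\<open>Arg2pi\<close> jumps at the base point, so continuity of \<^const>\<open>B_loop\<close> has to be tested after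
  pulling back to the unit interval.
\<close>

lemma quotient_map_prod_circ:
  assumes E: "chaus E"
  shows "quotient_map (prod_topology E (top_of_set {0..1})) (prod_topology E circle) (\<lambda>(e, s). (e, circ s))"
proof (rule continuous_closed_imp_quotient_map)
  let ?f = "\<lambda>(e, s). (e, circ s)"
  have I: "chaus (top_of_set {0..1 :: real})"
    by (simp add: chaus_def Hausdorff_space_subtopology compact_space_subtopology)
  have "continuous_map (top_of_set {0..1}) circle circ"
    using continuous_circ circ_in_circle unfolding circle_def
    by (auto simp: continuous_map_in_subtopology)
  then show c: "continuous_map (prod_topology E (top_of_set {0..1})) (prod_topology E circle) ?f"
    by (simp add: continuous_map_prod_top)
  \<comment> \<open>A continuous map from a compact space to a Hausdorff space is closed; taking the
    product with \<open>E\<close> preserves this situation.\<close>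
  show "closed_map (prod_topology E (top_of_set {0..1})) (prod_topology E circle) ?f"
    using chaus_prod[OF E I] chaus_prod[OF E chaus_circle]
    by (intro continuous_imp_closed_map_gen c) (auto simp: chaus_def Hausdorff_imp_kc_space)
  show "?f ` topspace (prod_topology E (top_of_set {0..1})) = topspace (prod_topology E circle)"
  proof (intro equalityI subsetI)
    fix y assume "y \<in> topspace (prod_topology E circle)"
    then obtain e z where y: "y = (e, z)" "e \<in> topspace E" "z \<in> topspace circle" by auto
    from y(3) obtain s where "0 \<le> s" "s < 1" "z = circ s" by (rule circleE)
    then show "y \<in> ?f ` topspace (prod_topology E (top_of_set {0..1}))"
      using y by (intro image_eqI[of _ _ "(e, s)"]) auto
  qed auto
qed

context pre_CMon
begin

lemma config_1:
  "m \<in> carrier M \<Longrightarrow> config M (Suc 0) (\<lambda>_. m) (\<lambda>_. s) r = (if 0 < r \<and> r < 1 \<and> s = r then m else \<one>)"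
  by (simp add: config_def lessThan_Suc)

lemma config_Suc:
  assumes "\<And>i. i \<le> n \<Longrightarrow> x i \<in> carrier M"
  shows "config M (Suc n) x u r = config M (Suc 0) (\<lambda>_. x n) (\<lambda>_. u n) r \<otimes> config M n x u r"
  using assms by (simp add: config_1) (auto simp: config_def lessThan_Suc Pi_iff)

text \<open>\<open>B_loop\<close> uses a parameter in [0,1), but the formula persists at
  \<open>s = 1\<close>. It is therefore continuous on the closed unit interval, where the jump of
  \<open>Arg2pi\<close> is invisible.\<close>

lemma B_loop_circ:
  assumes m: "m \<in> carrier M" and s: "0 \<le> s" "s \<le> 1"
  shows "B_loop M m (circ s) = B_pt M (config M (Suc 0) (\<lambda>_. m) (\<lambda>_. s))"
proof -
  have main: "B_loop M m (circ s) = B_pt M (config M (Suc 0) (\<lambda>_. m) (\<lambda>_. s))" if s: "0 \<le> s" "s < 1" for s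
  proof -
    let ?t = "\<lambda>j :: nat. if j = 0 then s else if j = 1 then 1 - s else 0"
    have "knot ?t 1 = 1" by (simp add: knot_0 knot_Suc)
    then have p: "(1, \<lambda>i\<in>{..<1}. m, ?t) \<in> bar_points M"
      using m s by (auto simp: bar_points_iff in_standard_simplex_iff)
    have "point_config M (1, \<lambda>i\<in>{..<1}. m, ?t) = config M (Suc 0) (\<lambda>_. m) (\<lambda>_. s)"
      unfolding point_config_def prod.case One_nat_def
      by (rule config_cong) (use m in \<open>auto simp: knot_0\<close>)
    then show ?thesis
      using B_class_eq_B_pt[OF p] Arg2pi_circ[OF s] by (simp add: B_loop_def)
  qed
  show ?thesis
  proof (cases "s = 1")
    case True
    \<comment> \<open>Both configurations are the unit everywhere, since a label at an end point is
      ignored.\<close>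
    have "config M (Suc 0) (\<lambda>_. m) (\<lambda>_. 1) = config M (Suc 0) (\<lambda>_. m) (\<lambda>_. 0)"
      using m by (auto simp: config_1)
    then show ?thesis using main[of 0] True by simp
  qed (use main s in auto)
qed

lemma config_1_in: "m \<in> carrier M \<Longrightarrow> config M (Suc 0) (\<lambda>_. m) (\<lambda>_. s) \<in> config_set M"
  by (rule config_in_config_set)

lemma B_loop_closed: "m \<in> carrier M \<Longrightarrow> z \<in> topspace circle \<Longrightarrow> B_loop M m z \<in> topspace (B_space M)"
  by (elim circleE) (simp add: B_loop_circ B_pt config_1_in)

lemma B_loop_base: "m \<in> carrier M \<Longrightarrow> B_loop M m 1 = \<one>\<^bsub>B_obj M\<^esub>"
  using B_loop_circ[of m 0]
  by (intro config_of_eqI) (auto simp: B_pt config_1_in one_B config_1)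

lemma B_loop_mult:
  assumes "m \<in> carrier M" "m' \<in> carrier M" "z \<in> topspace circle"
  shows "B_loop M (m \<otimes> m') z = B_loop M m z \<otimes>\<^bsub>B_obj M\<^esub> B_loop M m' z"
proof -
  from assms(3) obtain s where "0 \<le> s" "s < 1" "z = circ s" by (rule circleE)
  then show ?thesis
    using assms by (intro config_of_eqI) (auto simp: B_loop_circ B_pt config_1_in mult_B config_1)
qed

lemma B_loop_one: "z \<in> topspace circle \<Longrightarrow> B_loop M \<one> z = \<one>\<^bsub>B_obj M\<^esub>"
  by (elim circleE, intro config_of_eqI) (auto simp: B_loop_circ B_pt config_1_in one_B config_1)

text \<open>The points of the universal loops generate \<open>B M\<close>. Hence a homomorphism on
  \<open>B M\<close> is determined by its adjunct, as \<open>coadjunct_adjunct\<close> makes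
  explicit.\<close>

lemma B_pt_config_finprod:
  assumes "\<And>i. i < n \<Longrightarrow> x i \<in> carrier M" "\<And>i. i < n \<Longrightarrow> 0 \<le> u i \<and> u i \<le> 1"
  shows "finprod (B_obj M) (\<lambda>i. B_loop M (x i) (circ (u i))) {..<n} = B_pt M (config M n x u)"
  using assms
proof (induction n)
  interpret B: comm_monoid "B_obj M" by (rule comm_monoid_B)
  case 0
  have "config M 0 x u \<in> config_set M" by (rule config_in_config_set) simp
  then show ?case by (simp, intro B_pt_eqI) (auto simp: one_B config_def)
next
  interpret B: comm_monoid "B_obj M" by (rule comm_monoid_B)
  case (Suc n)
  have c: "config M n x u \<in> config_set M" using Suc.prems by (intro config_in_config_set) auto
  have "finprod (B_obj M) (\<lambda>i. B_loop M (x i) (circ (u i))) {..<Suc n} =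
    B_loop M (x n) (circ (u n)) \<otimes>\<^bsub>B_obj M\<^esub> B_pt M (config M n x u)"
    using Suc by (simp add: lessThan_Suc Pi_iff carrier_B B_loop_closed)
  also have "\<dots> = B_pt M (config M (Suc n) x u)"
    using Suc.prems
    by (intro B_pt_eqI) (auto simp: mult_B B_loop_circ B_pt c config_1_in config_Suc[of n x u])
  finally show ?case .
qed

text \<open>Over \<open>E\<close> times the closed interval the loop is a family with one label, so
  \<open>continuous_map_B_pt\<close> applies; the result descends along the quotient map to
  \<open>E\<close> times the circle.\<close>

lemma continuous_map_B_loop:
  assumes E: "chaus E" and x: "continuous_map E (mtop M) x" and z: "continuous_map E circle z"
  shows "continuous_map E (B_space M) (\<lambda>e. B_loop M (x e) (z e))"
proof -
  let ?I = "top_of_set {0..1 :: real}"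
  let ?E = "prod_topology E ?I"
  have I: "chaus ?I" by (simp add: chaus_def Hausdorff_space_subtopology compact_space_subtopology)
  have xc: "x e \<in> carrier M" if "e \<in> topspace E" for e
    using x that topspace_mtop by (auto simp: continuous_map_def)
  have "continuous_map ?E (mtop M) (\<lambda>p. x (fst p))"
    using continuous_map_compose[OF continuous_map_fst x] by (simp add: o_def)
  moreover have "continuous_map ?E euclideanreal (\<lambda>p. snd p)"
    using continuous_map_snd[of E ?I] by (simp add: continuous_map_in_subtopology)
  ultimately have "continuous_map ?E (B_space M) (\<lambda>p. B_pt M (config M (Suc 0) (\<lambda>_. x (fst p)) (\<lambda>_. snd p)))"
    by (intro continuous_map_B_pt[OF chaus_prod[OF E I]]) auto
  then have "continuous_map ?E (B_space M) ((\<lambda>(e, z). B_loop M (x e) z) \<circ> (\<lambda>(e, s). (e, circ s)))"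
    by (rule continuous_map_eq) (auto simp: B_loop_circ xc)
  then have "continuous_map (prod_topology E circle) (B_space M) (\<lambda>(e, z). B_loop M (x e) z)"
    by (rule continuous_compose_quotient_map[OF quotient_map_prod_circ[OF E]])
  moreover have "continuous_map E (prod_topology E circle) (\<lambda>e. (e, z e))"
    using z by (simp add: continuous_map_pairedI)
  ultimately have "continuous_map E (B_space M) ((\<lambda>(e, z). B_loop M (x e) z) \<circ> (\<lambda>e. (e, z e)))"
    by (rule continuous_map_compose[rotated])
  then show ?thesis by (simp add: o_def)
qed

end

lemma B_map_B_loop:
  assumes M: "CMon M" and N: "CMon N" and f: "f \<in> CMon_hom M N" and m: "m \<in> carrier M" "z \<in> topspace circle"
  shows "B_map M N f (B_loop M m z) = B_loop N (f m) z"
proof -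
  note pM = CMon_imp_pre_CMon[OF M] and pN = CMon_imp_pre_CMon[OF N]
  interpret M: pre_CMon M by fact
  interpret N: pre_CMon N by fact
  note h = CMon_homD(3,4)[OF f]
  have fm: "f m \<in> carrier N" using hom_in_carrier[OF h(1) m(1)] .
  from m(2) obtain s where s: "0 \<le> s" "s < 1" "z = circ s" by (rule circleE)
  show ?thesis
    by (rule B_map_eqI[OF pM pN h M.B_loop_closed[OF m] N.B_loop_closed[OF fm m(2)]])
      (use s m fm h in \<open>simp add: M.B_loop_circ N.B_loop_circ M.B_pt N.B_pt M.config_1_in N.config_1_in M.config_1 N.config_1\<close>)
qed

section \<open>The adjunction\<close>

lemma continuous_map_adjunct_param:
  fixes M :: "'a top_monoid"
  assumes M: "CMon M" and C: "chaus C" and \<phi>: "continuous_map C (CMon_space (B_obj M) N) \<phi>"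
  shows "continuous_map (prod_topology C (mtop M)) (mtop (Omega_obj N)) (\<lambda>(c, m). adjunct M N (\<phi> c) m)"
proof -
  note pM = CMon_imp_pre_CMon[OF M]
  interpret M: pre_CMon M by fact
  note kB = CMonD(3)[OF M.CMon_B]
  have \<phi>c: "\<phi> c \<in> CMon_hom (B_obj M) N" if "c \<in> topspace C" for c
    using \<phi> that by (simp add: continuous_map_into_CMon_space[OF C kB])
  show ?thesis
  proof (rule continuous_map_prod_probes[OF C probes_test_k_space[OF CMonD(3)[OF M]]])
    fix D :: "'a test_point topology" and q
    assume "(D, q) \<in> {(D, q). test_map D (mtop M) q}"
    then have D: "chaus D" and q: "continuous_map D (mtop M) q" by (auto simp: test_map_iff)
    have qc: "q d \<in> carrier M" if "d \<in> topspace D" for d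
      using q that M.topspace_mtop by (auto simp: continuous_map_def)
    let ?E = "prod_topology (prod_topology C D) circle"
    have E: "chaus ?E" using C D chaus_circle by (simp add: chaus_prod)
    have p: "continuous_map ?E (CMon_space (B_obj M) N) (\<lambda>e. \<phi> (fst (fst e)))"
      "continuous_map ?E (mtop M) (\<lambda>e. q (snd (fst e)))"
        using continuous_map_compose[OF continuous_map_compose[OF continuous_map_fst continuous_map_fst] \<phi>]
          continuous_map_compose[OF continuous_map_compose[OF continuous_map_fst continuous_map_snd] q]
        by (simp_all add: o_def)
    have "continuous_map ?E (mtop (B_obj M)) (\<lambda>e. B_loop M (q (snd (fst e))) (snd e))"
      unfolding M.mtop_B by (rule M.continuous_map_B_loop[OF E p(2) continuous_map_snd])
    from continuous_map_CMon_eval[OF E kB p(1) this]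
    have "continuous_map ?E (mtop N) (\<lambda>e. \<phi> (fst (fst e)) (B_loop M (q (snd (fst e))) (snd e)))" .
    then have "continuous_map ?E (mtop N) (\<lambda>(c, z). adjunct M N (\<phi> (fst c)) (q (snd c)) z)"
      by (rule continuous_map_eq) (auto simp: adjunct_def qc)
    moreover have "adjunct M N (\<phi> (fst c)) (q (snd c)) \<in> extensional (topspace circle)"
      "adjunct M N (\<phi> (fst c)) (q (snd c)) 1 = \<one>\<^bsub>N\<^esub>"
      if "c \<in> topspace (prod_topology C D)" for c
      using that qc CMon_homD(4)[OF \<phi>c] by (auto simp: adjunct_def M.B_loop_base)
    ultimately have "continuous_map (prod_topology C D) (mtop (Omega_obj N)) (\<lambda>c. adjunct M N (\<phi> (fst c)) (q (snd c)))"
      unfolding continuous_map_into_Omega[OF chaus_prod[OF C D]] by simp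
    then show "continuous_map (prod_topology C D) (mtop (Omega_obj N))
       (\<lambda>(c, d). case (c, q d) of (c, m) \<Rightarrow> adjunct M N (\<phi> c) m)"
      by (simp add: case_prod_unfold)
  qed
qed

lemma adjunct_hom:
  assumes M: "CMon M" and N: "CMon N" and h: "h \<in> CMon_hom (B_obj M) N"
  shows "adjunct M N h \<in> CMon_hom M (Omega_obj N)"
proof -
  note pM = CMon_imp_pre_CMon[OF M]
  interpret M: pre_CMon M by fact
  have c: "continuous_map (mtop M) (mtop (Omega_obj N)) (adjunct M N h)"
    by (rule continuous_map_point_param[OF continuous_map_adjunct_param[OF M chaus_point continuous_map_const_CMon_space[OF h]]])
  then have cl: "adjunct M N h m \<in> carrier (Omega_obj N)" if "m \<in> carrier M" for m
    using that M.topspace_mtop topspace_Omega[of N] by (auto simp: continuous_map_def)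
  moreover have "adjunct M N h (m \<otimes>\<^bsub>M\<^esub> m') = adjunct M N h m \<otimes>\<^bsub>Omega_obj N\<^esub> adjunct M N h m'"
    if "m \<in> carrier M" "m' \<in> carrier M" for m m'
    using that hom_mult[OF CMon_homD(3)[OF h]]
    by (auto simp: adjunct_def mult_Omega M.B_loop_mult M.B_loop_closed M.carrier_B intro!: restrict_ext)
  moreover have "adjunct M N h \<one>\<^bsub>M\<^esub> = \<one>\<^bsub>Omega_obj N\<^esub>"
    by (auto simp: adjunct_def one_Omega M.B_loop_one CMon_homD(4)[OF h] intro!: restrict_ext)
  ultimately show ?thesis
    using c by (auto simp: CMon_hom_def cmaps_def hom_def M.topspace_mtop) (simp add: adjunct_def)
qed

text \<open>The value that a homomorphism with adjunct \<open>k\<close> must take at the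
  configuration \<open>\<phi>\<close>. Indexing by the support instead of a representative makes
  independence of the representative automatic.\<close>

definition config_eval :: "'a top_monoid \<Rightarrow> 'b top_monoid \<Rightarrow> ('a \<Rightarrow> complex \<Rightarrow> 'b) \<Rightarrow> (real \<Rightarrow> 'a) \<Rightarrow> 'b" where
  "config_eval M N k \<phi> = finprod N (\<lambda>r. k (\<phi> r) (circ r)) {r. \<phi> r \<noteq> \<one>\<^bsub>M\<^esub>}"

definition coadjunct :: "'a top_monoid \<Rightarrow> 'b top_monoid \<Rightarrow> ('a \<Rightarrow> complex \<Rightarrow> 'b) \<Rightarrow> 'a bar_point \<Rightarrow> 'b" where
  "coadjunct M N k = (\<lambda>w\<in>carrier (B_obj M). config_eval M N k (config_of M w))"

locale loop_hom = M: pre_CMon M + N: pre_CMon N for M :: "'a top_monoid" and N :: "'b top_monoid" +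
  fixes k
  assumes CMon_N: "CMon N" and k: "k \<in> CMon_hom M (Omega_obj N)"
begin

lemma k_closed: "m \<in> carrier M \<Longrightarrow> z \<in> topspace circle \<Longrightarrow> k m z \<in> carrier N"
  using Omega_closed[OF CMon_N] hom_in_carrier[OF CMon_homD(3)[OF k]] by blast

lemma k_mult: "m \<in> carrier M \<Longrightarrow> m' \<in> carrier M \<Longrightarrow> z \<in> topspace circle \<Longrightarrow>
    k (m \<otimes>\<^bsub>M\<^esub> m') z = k m z \<otimes>\<^bsub>N\<^esub> k m' z"
  using hom_mult[OF CMon_homD(3)[OF k], of m m'] by (simp add: mult_Omega)

lemma k_one: "z \<in> topspace circle \<Longrightarrow> k \<one>\<^bsub>M\<^esub> z = \<one>\<^bsub>N\<^esub>"
  using CMon_homD(4)[OF k] by (simp add: one_Omega)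

lemma k_base: "m \<in> carrier M \<Longrightarrow> k m 1 = \<one>\<^bsub>N\<^esub>"
  using hom_in_carrier[OF CMon_homD(3)[OF k]] by (auto simp: carrier_Omega)

text \<open>Positions with unit label contribute the unit loop, so different configurations can be
  evaluated over one index set.\<close>

lemma config_eval_superset:
  assumes "\<phi> \<in> config_set M" "finite S" "{r. \<phi> r \<noteq> \<one>\<^bsub>M\<^esub>} \<subseteq> S"
  shows "config_eval M N k \<phi> = finprod N (\<lambda>r. k (\<phi> r) (circ r)) S"
  unfolding config_eval_def using assms
  by (intro N.finprod_mono_neutral_cong_left) (auto simp: k_one k_closed config_set_def)

lemma config_eval_closed: "\<phi> \<in> config_set M \<Longrightarrow> config_eval M N k \<phi> \<in> carrier N"
  unfolding config_eval_def by (rule N.finprod_closed) (auto simp: k_closed config_set_def)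

lemma config_eval_mult:
  assumes "\<phi> \<in> config_set M" "\<psi> \<in> config_set M" "\<theta> \<in> config_set M"
    and \<theta>: "\<And>r. \<theta> r = \<phi> r \<otimes>\<^bsub>M\<^esub> \<psi> r"
  shows "config_eval M N k \<theta> = config_eval M N k \<phi> \<otimes>\<^bsub>N\<^esub> config_eval M N k \<psi>"
proof -
  \<comment> \<open>The support of the product can be strictly smaller than this union, because
    labels may cancel.\<close>
  let ?S = "{r. \<phi> r \<noteq> \<one>\<^bsub>M\<^esub>} \<union> {r. \<psi> r \<noteq> \<one>\<^bsub>M\<^esub>}"
  have S: "finite ?S" using assms by (simp add: config_set_def)
  have c: "\<phi> r \<in> carrier M" "\<psi> r \<in> carrier M" for r using assms by (auto simp: config_set_def)
  have "config_eval M N k \<theta> = finprod N (\<lambda>r. k (\<theta> r) (circ r)) ?S"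
    by (rule config_eval_superset[OF assms(3) S]) (auto simp: \<theta>)
  also have "\<dots> = finprod N (\<lambda>r. k (\<phi> r) (circ r) \<otimes>\<^bsub>N\<^esub> k (\<psi> r) (circ r)) ?S"
    using c by (intro N.finprod_cong') (auto simp: k_mult k_closed \<theta>)
  also have "\<dots> = finprod N (\<lambda>r. k (\<phi> r) (circ r)) ?S \<otimes>\<^bsub>N\<^esub> finprod N (\<lambda>r. k (\<psi> r) (circ r)) ?S"
    using c by (intro N.finprod_multf) (auto simp: k_closed)
  also have "\<dots> = config_eval M N k \<phi> \<otimes>\<^bsub>N\<^esub> config_eval M N k \<psi>"
    using config_eval_superset[OF assms(1) S] config_eval_superset[OF assms(2) S] by simp
  finally show ?thesis .
qed

lemma config_eval_one: "(\<And>r. \<phi> r = \<one>\<^bsub>M\<^esub>) \<Longrightarrow> config_eval M N k \<phi> = \<one>\<^bsub>N\<^esub>"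
  by (simp add: config_eval_def)

lemma config_eval_config_1:
  assumes m: "m \<in> carrier M" and s: "0 \<le> s" "s \<le> 1"
  shows "config_eval M N k (config M (Suc 0) (\<lambda>_. m) (\<lambda>_. s)) = k m (circ s)"
proof (cases "0 < s \<and> s < 1")
  case True
  have "config_eval M N k (config M (Suc 0) (\<lambda>_. m) (\<lambda>_. s)) =
     finprod N (\<lambda>r. k (config M (Suc 0) (\<lambda>_. m) (\<lambda>_. s) r) (circ r)) {s}"
    using m by (intro config_eval_superset) (auto simp: M.config_1_in M.config_1)
  also have "\<dots> = k m (circ s)"
    using m True by (simp add: M.config_1 k_closed)
  finally show ?thesis .
next
  case False
  \<comment> \<open>At both end points the label is ignored on the left, and on the right
    \<open>circ s\<close> is the base point, where \<open>k m\<close> is the unit.\<close>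
  then have "s = 0 \<or> s = 1" using s by auto
  moreover from False have "config_eval M N k (config M (Suc 0) (\<lambda>_. m) (\<lambda>_. s)) = \<one>\<^bsub>N\<^esub>"
    using m by (intro config_eval_one) (auto simp: M.config_1)
  ultimately show ?thesis using k_base[OF m] by auto
qed

text \<open>Replaces the support, which varies discontinuously with the parameters, by the fixed
  index set of a list in which positions may repeat or be end points. This is the formula from which
  continuity of \<open>coadjunct\<close> follows.\<close>

lemma config_eval_config:
  assumes "\<And>i. i < n \<Longrightarrow> x i \<in> carrier M" "\<And>i. i < n \<Longrightarrow> 0 \<le> u i \<and> u i \<le> 1"
  shows "config_eval M N k (config M n x u) = finprod N (\<lambda>i. k (x i) (circ (u i))) {..<n}"
  using assms
proof (induction n)
  case 0
  show ?case by (simp, intro config_eval_one) (simp add: config_def)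
next
  case (Suc n)
  have "config_eval M N k (config M (Suc n) x u) =
    config_eval M N k (config M (Suc 0) (\<lambda>_. x n) (\<lambda>_. u n)) \<otimes>\<^bsub>N\<^esub> config_eval M N k (config M n x u)"
    using Suc.prems
    by (intro config_eval_mult M.config_Suc M.config_in_config_set) auto
  then show ?case
    using Suc by (simp add: config_eval_config_1 lessThan_Suc Pi_iff k_closed)
qed

lemma coadjunct_B_pt: "\<phi> \<in> config_set M \<Longrightarrow> coadjunct M N k (B_pt M \<phi>) = config_eval M N k \<phi>"
  by (simp add: coadjunct_def M.carrier_B M.B_pt)

end

lemma continuous_map_coadjunct_param:
  assumes M: "CMon M" and N: "CMon N" and C: "chaus C" and \<phi>: "continuous_map C (CMon_space M (Omega_obj N)) \<phi>"
  shows "continuous_map (prod_topology C (B_space M)) (mtop N) (\<lambda>(c, w). coadjunct M N (\<phi> c) w)"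
proof -
  note pM = CMon_imp_pre_CMon[OF M] and pN = CMon_imp_pre_CMon[OF N]
  interpret M: pre_CMon M by fact
  interpret N: pre_CMon N by fact
  have \<phi>c: "\<phi> c \<in> CMon_hom M (Omega_obj N)" if "c \<in> topspace C" for c
    using \<phi> that by (simp add: continuous_map_into_CMon_space[OF C CMonD(3)[OF M]])
  show ?thesis
  proof (rule continuous_map_prod_probes[OF C M.probes_B_space])
    fix D q assume Q: "(D, q) \<in> M.bar_probes"
    have D: "chaus D" using Q probesD(1)[OF M.probes_B_space] by auto
    obtain n x u where X: "\<forall>i<n. continuous_map D (mtop M) (\<lambda>d. x d i)"
      "\<forall>i. continuous_map D euclideanreal (\<lambda>d. u d i)"
      "\<forall>d\<in>topspace D. \<forall>i. 0 \<le> u d i \<and> u d i \<le> 1"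
      "\<forall>d\<in>topspace D. \<forall>i<n. x d i \<in> carrier M"
      "\<forall>d\<in>topspace D. q d = B_pt M (config M n (x d) (u d))"
      using M.bar_probesE[OF Q] .
    let ?E = "prod_topology C D"
    have E: "chaus ?E" by (rule chaus_prod[OF C D])
    have sn: "continuous_map ?E Z (\<lambda>e. g (snd e))" if "continuous_map D Z g" for Z :: "'z topology" and g
      using continuous_map_compose[OF continuous_map_snd that] by (simp add: o_def)
    have \<phi>': "continuous_map ?E (CMon_space M (Omega_obj N)) (\<lambda>e. \<phi> (fst e))"
      using continuous_map_compose[OF continuous_map_fst \<phi>] by (simp add: o_def)
    have "continuous_map ?E (mtop N) (\<lambda>e. finprod N (\<lambda>i. \<phi> (fst e) (x (snd e) i) (circ (u (snd e) i))) {..<n})"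
    proof (rule continuous_map_CMon_finprod[OF N E])
      fix i assume "i < n"
      then have "continuous_map ?E (mtop M) (\<lambda>e. x (snd e) i)" using X(1) by (intro sn) auto
      from continuous_map_CMon_eval[OF E CMonD(3)[OF M] \<phi>' this]
      have 1: "continuous_map ?E (mtop (Omega_obj N)) (\<lambda>e. \<phi> (fst e) (x (snd e) i))" .
      have "continuous_map ?E circle (\<lambda>e. circ (u (snd e) i))"
        using X(2) by (intro continuous_map_circ sn) auto
      from continuous_map_Omega_eval[OF E 1 this]
      show "continuous_map ?E (mtop N) (\<lambda>e. \<phi> (fst e) (x (snd e) i) (circ (u (snd e) i)))" .
    qed
    moreover have "finprod N (\<lambda>i. \<phi> (fst e) (x (snd e) i) (circ (u (snd e) i))) {..<n} = coadjunct M N (\<phi> (fst e)) (q (snd e))"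
      if e: "e \<in> topspace ?E" for e
    proof -
      have d: "fst e \<in> topspace C" "snd e \<in> topspace D" using e by auto
      interpret loop_hom M N "\<phi> (fst e)" by unfold_locales (use N \<phi>c[OF d(1)] in auto)
      have xc: "\<And>i. i < n \<Longrightarrow> x (snd e) i \<in> carrier M" using X(4) d by auto
      have c: "config M n (x (snd e)) (u (snd e)) \<in> config_set M" using xc by (rule M.config_in_config_set)
      show ?thesis
        unfolding bspec[OF X(5) d(2)] coadjunct_B_pt[OF c]
        by (rule config_eval_config[symmetric]) (use xc X(3) d in auto)
    qed
    ultimately have "continuous_map ?E (mtop N) (\<lambda>e. coadjunct M N (\<phi> (fst e)) (q (snd e)))"
      by (rule continuous_map_eq)
    then show "continuous_map ?E (mtop N) (\<lambda>(c, d). case (c, q d) of (c, w) \<Rightarrow> coadjunct M N (\<phi> c) w)"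
      by (simp add: case_prod_unfold)
  qed
qed

lemma coadjunct_hom:
  assumes M: "CMon M" and N: "CMon N" and k: "k \<in> CMon_hom M (Omega_obj N)"
  shows "coadjunct M N k \<in> CMon_hom (B_obj M) N"
proof -
  note pM = CMon_imp_pre_CMon[OF M] and pN = CMon_imp_pre_CMon[OF N]
  interpret M: pre_CMon M by fact
  interpret N: pre_CMon N by fact
  interpret loop_hom M N k by unfold_locales (use N k in auto)
  have "continuous_map (B_space M) (mtop N) (coadjunct M N k)"
    by (rule continuous_map_point_param[OF continuous_map_coadjunct_param[OF M N chaus_point continuous_map_const_CMon_space[OF k]]])
  moreover have "coadjunct M N k (u \<otimes>\<^bsub>B_obj M\<^esub> v) = coadjunct M N k u \<otimes>\<^bsub>N\<^esub> coadjunct M N k v"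
    if "u \<in> topspace (B_space M)" "v \<in> topspace (B_space M)" for u v
    using that M.config_of_in M.mult_B
    by (simp add: coadjunct_def M.carrier_B) (rule config_eval_mult, auto)
  moreover have "coadjunct M N k u \<in> carrier N" if "u \<in> topspace (B_space M)" for u
    using that by (simp add: coadjunct_def M.carrier_B config_eval_closed M.config_of_in)
  moreover have "coadjunct M N k \<one>\<^bsub>B_obj M\<^esub> = \<one>\<^bsub>N\<^esub>"
    by (simp add: coadjunct_def M.carrier_B M.one_B config_eval_one)
  ultimately show ?thesis
    by (auto simp: CMon_hom_def cmaps_def hom_def M.mtop_B M.carrier_B) (simp add: coadjunct_def M.carrier_B)
qed

section \<open>The two assignments are mutually inverse\<close>

lemma adjunct_coadjunct:
  assumes M: "CMon M" and N: "CMon N" and k: "k \<in> CMon_hom M (Omega_obj N)"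
  shows "adjunct M N (coadjunct M N k) = k"
proof -
  note pM = CMon_imp_pre_CMon[OF M] and pN = CMon_imp_pre_CMon[OF N]
  interpret M: pre_CMon M by fact
  interpret N: pre_CMon N by fact
  interpret loop_hom M N k by unfold_locales (use N k in auto)
  show ?thesis
  proof (rule extensionalityI[of _ "carrier M"])
    fix m assume m: "m \<in> carrier M"
    then have km: "k m \<in> carrier (Omega_obj N)" by (rule hom_in_carrier[OF CMon_homD(3)[OF k]])
    show "adjunct M N (coadjunct M N k) m = k m"
    proof (rule extensionalityI[of _ "topspace circle"])
      fix z assume z: "z \<in> topspace circle"
      then obtain s where "0 \<le> s" "s < 1" "z = circ s" by (rule circleE)
      then show "adjunct M N (coadjunct M N k) m z = k m z"
        using m z by (simp add: adjunct_def M.B_loop_circ coadjunct_B_pt M.config_1_in config_eval_config_1)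
    qed (use km m in \<open>auto simp: carrier_Omega adjunct_def\<close>)
  qed (use CMon_homD(1)[OF k] in \<open>auto simp: adjunct_def M.topspace_mtop\<close>)
qed

text \<open>Both sides send a list of labelled positions to the product of the values of
  \<open>h\<close> on the corresponding universal loops, because \<open>h\<close> is multiplicative
  and these loops multiply to \<open>w\<close>.\<close>

lemma coadjunct_adjunct:
  assumes M: "CMon M" and N: "CMon N" and h: "h \<in> CMon_hom (B_obj M) N"
  shows "coadjunct M N (adjunct M N h) = h"
proof -
  note pM = CMon_imp_pre_CMon[OF M] and pN = CMon_imp_pre_CMon[OF N]
  interpret M: pre_CMon M by fact
  interpret N: pre_CMon N by fact
  interpret loop_hom M N "adjunct M N h" by unfold_locales (use N adjunct_hom[OF M N h] in auto)
  show ?thesis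
  proof (rule extensionalityI[of _ "carrier (B_obj M)"])
    fix w assume "w \<in> carrier (B_obj M)"
    then have w: "w \<in> topspace (B_space M)" by (simp add: M.carrier_B)
    from M.config_set_enum[OF M.config_of_in[OF w]] obtain n x u where
      ux: "\<And>i. i < n \<Longrightarrow> 0 \<le> u i \<and> u i \<le> 1" "\<And>i. i < n \<Longrightarrow> x i \<in> carrier M"
      and c: "config_of M w = config M n x u" by metis
    have weq: "w = B_pt M (config M n x u)" using w c by (intro M.B_pt_eqI) auto
    have "coadjunct M N (adjunct M N h) w = config_eval M N (adjunct M N h) (config M n x u)"
      using w by (simp add: coadjunct_def M.carrier_B c)
    also have "\<dots> = finprod N (\<lambda>i. adjunct M N h (x i) (circ (u i))) {..<n}"
      using ux by (intro config_eval_config) auto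
    also have "\<dots> = finprod N (\<lambda>i. h (B_loop M (x i) (circ (u i)))) {..<n}"
      using ux hom_in_carrier[OF CMon_homD(3)[OF h]]
      by (intro N.finprod_cong') (auto simp: adjunct_def M.B_loop_closed M.carrier_B)
    also have "\<dots> = h (finprod (B_obj M) (\<lambda>i. B_loop M (x i) (circ (u i))) {..<n})"
      using ux
      by (intro hom_finprod_nat[OF M.comm_monoid_B N.comm_monoid_axioms CMon_homD(3,4)[OF h], symmetric])
        (auto simp: M.B_loop_closed M.carrier_B)
    also have "finprod (B_obj M) (\<lambda>i. B_loop M (x i) (circ (u i))) {..<n} = w"
      unfolding weq using ux by (intro M.B_pt_config_finprod) auto
    finally show "coadjunct M N (adjunct M N h) w = h w" .
  qed (use CMon_homD(1)[OF h] in \<open>auto simp: coadjunct_def M.mtop_B M.carrier_B\<close>)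
qed

section \<open>The based homeomorphism and its naturality\<close>

lemma homeomorphic_map_adjunct:
  assumes M: "CMon M" and N: "CMon N"
  shows "homeomorphic_map (CMon_space (B_obj M) N) (CMon_space M (Omega_obj N)) (adjunct M N)"
proof -
  note pM = CMon_imp_pre_CMon[OF M]
  interpret M: pre_CMon M by fact
  have "continuous_map (CMon_space (B_obj M) N) (CMon_space M (Omega_obj N)) (adjunct M N)"
    by (rule continuous_map_CMon_spaces[OF CMonD(3)[OF M.CMon_B] CMonD(3)[OF M] adjunct_hom[OF M N]
          continuous_map_adjunct_param[OF M]])
  moreover have "continuous_map (CMon_space M (Omega_obj N)) (CMon_space (B_obj M) N) (coadjunct M N)"
    by (rule continuous_map_CMon_spaces[OF CMonD(3)[OF M] CMonD(3)[OF M.CMon_B] coadjunct_hom[OF M N]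
          continuous_map_coadjunct_param[OF M N, folded M.mtop_B]])
  ultimately have "homeomorphic_maps (CMon_space (B_obj M) N) (CMon_space M (Omega_obj N)) (adjunct M N) (coadjunct M N)"
    by (simp add: homeomorphic_maps_def topspace_CMon_space adjunct_coadjunct[OF M N] coadjunct_adjunct[OF M N])
  then show ?thesis unfolding homeomorphic_map_maps by blast
qed

lemma adjunct_const:
  assumes M: "CMon M" and N: "CMon N"
  shows "adjunct M N (CMon_const (B_obj M) N) = CMon_const M (Omega_obj N)"
proof -
  interpret M: pre_CMon M by (rule CMon_imp_pre_CMon[OF M])
  show ?thesis
    unfolding adjunct_def CMon_const_def one_Omega
    by (intro restrict_ext) (simp add: M.carrier_B M.B_loop_closed)
qed

text \<open>Composition with \<open>g\<close> acts pointwise on loops, which gives naturality in the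
  target. Naturality in the source is naturality of the universal loop,
  \<open>B_map_B_loop\<close>.\<close>

lemma adjunct_natural:
  assumes M: "CMon M" and M': "CMon M'" and N: "CMon N"
    and f: "f \<in> CMon_hom M M'" and g: "g \<in> CMon_hom N N'" and h: "h \<in> CMon_hom (B_obj M') N"
  shows "adjunct M N' (compose (carrier (B_obj M)) g (compose (carrier (B_obj M)) h (B_map M M' f))) =
    compose (carrier M) (Omega_map N N' g) (compose (carrier M) (adjunct M' N h) f)"
proof -
  interpret M: pre_CMon M by (rule CMon_imp_pre_CMon[OF M])
  show ?thesis
    unfolding adjunct_def[of M] compose_def[of "carrier M"]
  proof (rule restrict_ext)
    fix m assume m: "m \<in> carrier M"
    then have fm: "f m \<in> carrier M'" by (rule hom_in_carrier[OF CMon_homD(3)[OF f]])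
    have "adjunct M' N h (f m) \<in> carrier (Omega_obj N)"
      by (rule hom_in_carrier[OF CMon_homD(3)[OF adjunct_hom[OF M' N h]] fm])
    then show "(\<lambda>z\<in>topspace circle. compose (carrier (B_obj M)) g (compose (carrier (B_obj M)) h (B_map M M' f)) (B_loop M m z)) =
      Omega_map N N' g ((\<lambda>x\<in>carrier M. adjunct M' N h (f x)) m)"
      using m fm by (auto simp: Omega_map_apply adjunct_def compose_def M.carrier_B M.B_loop_closed
          B_map_B_loop[OF M M' f] intro!: restrict_ext)
  qed
qed

theorem proposition1p1:
  fixes M :: "'m top_monoid" and M' :: "'m1 top_monoid" and M'' :: "'m2 top_monoid"
    and N :: "'n top_monoid" and N' :: "'n1 top_monoid" and N'' :: "'n2 top_monoid"
  assumes "CMon M" and "CMon M'" and "CMon M''"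
    and "CMon N" and "CMon N'" and "CMon N''"
  shows
    \<comment> \<open>\<open>B\<close> is a functor enriched over based k-spaces\<close>
    "CMon (B_obj M) \<and>
     B_map M M (CMon_id M) = CMon_id (B_obj M) \<and>
     (\<forall>f \<in> CMon_hom M M'. B_map M M' f \<in> CMon_hom (B_obj M) (B_obj M')) \<and>
     (\<forall>f \<in> CMon_hom M M'. \<forall>f' \<in> CMon_hom M' M''.
        B_map M M'' (compose (carrier M) f' f) =
        compose (carrier (B_obj M)) (B_map M' M'' f') (B_map M M' f)) \<and>
     continuous_map (CMon_space M M') (CMon_space (B_obj M) (B_obj M')) (B_map M M') \<and>
     B_map M M' (CMon_const M M') = CMon_const (B_obj M) (B_obj M') \<and>
     \<comment> \<open>\<open>\<Omega>\<close> is a functor enriched over based k-spaces\<close>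
     CMon (Omega_obj N) \<and>
     Omega_map N N (CMon_id N) = CMon_id (Omega_obj N) \<and>
     (\<forall>g \<in> CMon_hom N N'. Omega_map N N' g \<in> CMon_hom (Omega_obj N) (Omega_obj N')) \<and>
     (\<forall>g \<in> CMon_hom N N'. \<forall>g' \<in> CMon_hom N' N''.
        Omega_map N N'' (compose (carrier N) g' g) =
        compose (carrier (Omega_obj N)) (Omega_map N' N'' g') (Omega_map N N' g)) \<and>
     continuous_map (CMon_space N N') (CMon_space (Omega_obj N) (Omega_obj N')) (Omega_map N N') \<and>
     Omega_map N N' (CMon_const N N') = CMon_const (Omega_obj N) (Omega_obj N') \<and>
     \<comment> \<open>based homeomorphisms of hom spaces\<close>
     topspace (CMon_space (B_obj M) N) = CMon_hom (B_obj M) N \<and>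
     topspace (CMon_space M (Omega_obj N)) = CMon_hom M (Omega_obj N) \<and>
     homeomorphic_map (CMon_space (B_obj M) N) (CMon_space M (Omega_obj N)) (adjunct M N) \<and>
     adjunct M N (CMon_const (B_obj M) N) = CMon_const M (Omega_obj N) \<and>
     \<comment> \<open>naturality\<close>
     (\<forall>f \<in> CMon_hom M M'. \<forall>g \<in> CMon_hom N N'. \<forall>h \<in> CMon_hom (B_obj M') N.
        adjunct M N' (compose (carrier (B_obj M)) g
                       (compose (carrier (B_obj M)) h (B_map M M' f))) =
        compose (carrier M) (Omega_map N N' g) (compose (carrier M) (adjunct M' N h) f))"
proof (intro conjI ballI)
  note M = assms(1-3) and N = assms(4-6)
  show "CMon (B_obj M)" by (rule pre_CMon.CMon_B[OF CMon_imp_pre_CMon[OF M(1)]])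
  show "B_map M M (CMon_id M) = CMon_id (B_obj M)" by (rule B_map_id[OF M(1)])
  show "B_map M M' f \<in> CMon_hom (B_obj M) (B_obj M')" if "f \<in> CMon_hom M M'" for f
    by (rule B_map_hom[OF M(1,2) that])
  show "B_map M M'' (compose (carrier M) f' f) = compose (carrier (B_obj M)) (B_map M' M'' f') (B_map M M' f)"
    if "f \<in> CMon_hom M M'" "f' \<in> CMon_hom M' M''" for f f'
    by (rule B_map_compose[OF M that])
  show "continuous_map (CMon_space M M') (CMon_space (B_obj M) (B_obj M')) (B_map M M')"
    by (rule continuous_map_B_map[OF M(1,2)])
  show "B_map M M' (CMon_const M M') = CMon_const (B_obj M) (B_obj M')"
    by (rule B_map_const[OF M(1,2)])
  show "CMon (Omega_obj N)" by (rule CMon_Omega[OF N(1)])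
  show "Omega_map N N (CMon_id N) = CMon_id (Omega_obj N)" by (rule Omega_map_id[OF N(1)])
  show "Omega_map N N' g \<in> CMon_hom (Omega_obj N) (Omega_obj N')" if "g \<in> CMon_hom N N'" for g
    by (rule Omega_map_hom[OF N(1,2) that])
  show "Omega_map N N'' (compose (carrier N) g' g) =
      compose (carrier (Omega_obj N)) (Omega_map N' N'' g') (Omega_map N N' g)"
    if "g \<in> CMon_hom N N'" "g' \<in> CMon_hom N' N''" for g g'
    by (rule Omega_map_compose[OF N(1) that(1)])
  show "continuous_map (CMon_space N N') (CMon_space (Omega_obj N) (Omega_obj N')) (Omega_map N N')"
    by (rule continuous_map_Omega_map[OF N(1,2)])
  show "Omega_map N N' (CMon_const N N') = CMon_const (Omega_obj N) (Omega_obj N')"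
    by (rule Omega_map_const[OF N(1)])
  show "topspace (CMon_space (B_obj M) N) = CMon_hom (B_obj M) N"
    "topspace (CMon_space M (Omega_obj N)) = CMon_hom M (Omega_obj N)"
    by (rule topspace_CMon_space)+
  show "homeomorphic_map (CMon_space (B_obj M) N) (CMon_space M (Omega_obj N)) (adjunct M N)"
    by (rule homeomorphic_map_adjunct[OF M(1) N(1)])
  show "adjunct M N (CMon_const (B_obj M) N) = CMon_const M (Omega_obj N)"
    by (rule adjunct_const[OF M(1) N(1)])
  show "adjunct M N' (compose (carrier (B_obj M)) g (compose (carrier (B_obj M)) h (B_map M M' f))) =
      compose (carrier M) (Omega_map N N' g) (compose (carrier M) (adjunct M' N h) f)"
    if "f \<in> CMon_hom M M'" "g \<in> CMon_hom N N'" "h \<in> CMon_hom (B_obj M') N" for f g h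
    by (rule adjunct_natural[OF M(1,2) N(1) that])
qed

end
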